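(* Let $\mathfrak R$ be a complete, separated topological associative ring with a base of neighborhoods of zero formed by open right ideals. Let $\mathfrak H\subset\mathfrak R$ be a topologically left T-nilpotent strongly closed two-sided ideal such that the quotient ring $\mathfrak S=\mathfrak R/\mathfrak H$ (with the quotient topology) is isomorphic, as a topological ring, to the product $\prod_{\gamma\in\Gamma}S_\gamma$ (with the product topology) of a family of discrete rings $S_\gamma$, each of which is simple Artinian. Then every left $\mathfrak R$-contramodule has a projective cover.
   Context: Rings are associative with unit. All topological abelian groups/rings have a base of neighborhoods of zero consisting of open subgroups; such a group $A$ is separated (resp. complete) if $A\to\varprojlim_U A/U$ ($U$ ranging over open subgroups) is injective (resp. surjective). For a complete, separated topological abelian group $\mathfrak A$ and a set $X$, $\mathfrak A[[X]]$ is the group of formal linear combinations $\sum_{x\in X}a_xx$ with $a_x\in\mathfrak A$ such that for every open subgroup $\mathfrak U\subset\mathfrak A$ one has $a_x\in\mathfrak U$ for all but finitely many $x$. A map $f\colon X\to Y$ induces $\mathfrak A[[f]]\colon\sum_x a_xx\mapsto\sum_y(\sum_{f(x)=y}a_x)y$ (sums are limits of finite partial sums). The functor $X\mapsto\mathfrak R[[X]]$ is a monad on the category of sets, with unit $\epsilon_X\colon x\mapsto 1\cdot x$ and multiplication $\phi_X\colon\mathfrak R[[\mathfrak R[[X]]]]\to\mathfrak R[[X]]$ opening parentheses: $\sum_y r_yy\mapsto\sum_x(\sum_y r_ys_{y,x})x$ where $y=\sum_xs_{y,x}x$. A left $\mathfrak R$-contramodule is an algebra over this monad: a set $\mathfrak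 C$ with a map $\pi_{\mathfrak C}\colon\mathfrak R[[\mathfrak C]]\to\mathfrak C$ such that $\pi_{\mathfrak C}\epsilon_{\mathfrak C}=\mathrm{id}$ and $\pi_{\mathfrak C}\circ\phi_{\mathfrak C}=\pi_{\mathfrak C}\circ\mathfrak R[[\pi_{\mathfrak C}]]$; morphisms are morphisms of algebras. Left $\mathfrak R$-contramodules form an abelian category; the free contramodules $\mathfrak R[[X]]$ are projective, and projectives are the direct summands of free ones. A projective cover of an object $C$ of an abelian category is an epimorphism $p\colon P\to C$ with $P$ projective such that every endomorphism $e$ of $P$ with $pe=p$ is an automorphism. A closed subgroup $\mathfrak H$ of a complete, separated topological abelian group $\mathfrak A$ is strongly closed if $\mathfrak A/\mathfrak H$ is complete in the quotient topology and $\mathfrak A[[X]]\to(\mathfrak A/\mathfrak H)[[X]]$ is surjective for every set $X$. An ideal $\mathfrak H$ is topologically left T-nilpotent if for every sequence $a_1,a_2,\ldots$ in $\mathfrak H$ the sequence $a_1,\ a_1a_2,\ a_1a_2a_3,\dots$ converges to zero. *)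

theory Defs
  imports "HOL-Algebra.QuotRing" "HOL-Analysis.Abstract_Limits" "HOL-Analysis.Product_Topology"
    "HOL-Analysis.Function_Topology"
begin

section \<open>Linearly topologized abelian groups and rings\<close>

text \<open>
  Abelian groups are the additive parts of ring records; in this way quotient groups are provided
  by \<^const>\<open>FactRing\<close>, whose additive part involves only the additive part of its argument.
\<close>

definition open_subgroups :: "('a, 'm) ring_scheme \<Rightarrow> 'a topology \<Rightarrow> 'a set set" where
  "open_subgroups A T = {U. additive_subgroup U A \<and> openin T U}"

definition topological_abgroup :: "('a, 'm) ring_scheme \<Rightarrow> 'a topology \<Rightarrow> bool" where
  "topological_abgroup A T \<longleftrightarrow>
     abelian_group A \<and> topspace T = carrier A \<and>
     continuous_map (prod_topology T T) T (\<lambda>(x, y). x \<oplus>\<^bsub>A\<^esub> y) \<and>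
     continuous_map T T (\<lambda>x. \<ominus>\<^bsub>A\<^esub> x) \<and>
     (\<forall>W. openin T W \<and> \<zero>\<^bsub>A\<^esub> \<in> W \<longrightarrow> (\<exists>U\<in>open_subgroups A T. U \<subseteq> W))"

definition topological_ring :: "('a, 'm) ring_scheme \<Rightarrow> 'a topology \<Rightarrow> bool" where
  "topological_ring R T \<longleftrightarrow>
     ring R \<and> topological_abgroup R T \<and>
     continuous_map (prod_topology T T) T (\<lambda>(x, y). x \<otimes>\<^bsub>R\<^esub> y)"

text \<open>The inverse limit of the groups \<open>A/U\<close>: the transition map \<open>A/U \<rightarrow> A/V\<close> for
  \<open>U \<subseteq> V\<close> sends a coset of \<open>U\<close> to the unique coset of \<open>V\<close> containing it.\<close>

definition inverse_limit :: "('a, 'm) ring_scheme \<Rightarrow> 'a topology \<Rightarrow> ('a set \<Rightarrow> 'a set) set" where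
  "inverse_limit A T =
     {c \<in> (\<Pi>\<^sub>E U\<in>open_subgroups A T. a_rcosets\<^bsub>A\<^esub> U).
        \<forall>U\<in>open_subgroups A T. \<forall>V\<in>open_subgroups A T. U \<subseteq> V \<longrightarrow> c U \<subseteq> c V}"

definition completion_map :: "('a, 'm) ring_scheme \<Rightarrow> 'a topology \<Rightarrow> 'a \<Rightarrow> 'a set \<Rightarrow> 'a set" where
  "completion_map A T a = (\<lambda>U\<in>open_subgroups A T. U +>\<^bsub>A\<^esub> a)"

definition top_separated :: "('a, 'm) ring_scheme \<Rightarrow> 'a topology \<Rightarrow> bool" where
  "top_separated A T \<longleftrightarrow> inj_on (completion_map A T) (carrier A)"

definition top_complete :: "('a, 'm) ring_scheme \<Rightarrow> 'a topology \<Rightarrow> bool" where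
  "top_complete A T \<longleftrightarrow> completion_map A T ` carrier A = inverse_limit A T"

definition right_ideal :: "('a, 'm) ring_scheme \<Rightarrow> 'a set \<Rightarrow> bool" where
  "right_ideal R I \<longleftrightarrow> additive_subgroup I R \<and> (\<forall>a\<in>I. \<forall>r\<in>carrier R. a \<otimes>\<^bsub>R\<^esub> r \<in> I)"

definition left_ideal :: "('a, 'm) ring_scheme \<Rightarrow> 'a set \<Rightarrow> bool" where
  "left_ideal R I \<longleftrightarrow> additive_subgroup I R \<and> (\<forall>a\<in>I. \<forall>r\<in>carrier R. r \<otimes>\<^bsub>R\<^esub> a \<in> I)"

definition open_right_ideal_base :: "('a, 'm) ring_scheme \<Rightarrow> 'a topology \<Rightarrow> bool" where
  "open_right_ideal_base R T \<longleftrightarrow>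
     (\<forall>W. openin T W \<and> \<zero>\<^bsub>R\<^esub> \<in> W \<longrightarrow> (\<exists>I. right_ideal R I \<and> openin T I \<and> I \<subseteq> W))"

section \<open>Formal linear combinations\<close>

definition formal_combs :: "('a, 'm) ring_scheme \<Rightarrow> 'a topology \<Rightarrow> 'x set \<Rightarrow> ('x \<Rightarrow> 'a) set" where
  "formal_combs A T X =
     {a \<in> X \<rightarrow>\<^sub>E carrier A. \<forall>U\<in>open_subgroups A T. finite {x \<in> X. a x \<notin> U}}"

text \<open>The limit of the net of finite partial sums.\<close>

definition top_sum :: "('a, 'm) ring_scheme \<Rightarrow> 'a topology \<Rightarrow> ('i \<Rightarrow> 'a) \<Rightarrow> 'i set \<Rightarrow> 'a" where
  "top_sum A T a I = (THE l. limitin T (\<lambda>F. finsum A a F) l (finite_subsets_at_top I))"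

definition comb_map ::
    "('a, 'm) ring_scheme \<Rightarrow> 'a topology \<Rightarrow> 'x set \<Rightarrow> 'y set \<Rightarrow> ('x \<Rightarrow> 'y) \<Rightarrow> ('x \<Rightarrow> 'a) \<Rightarrow> 'y \<Rightarrow> 'a" where
  "comb_map A T X Y f a = (\<lambda>y\<in>Y. top_sum A T a {x \<in> X. f x = y})"

definition comb_unit :: "('a, 'm) ring_scheme \<Rightarrow> 'x set \<Rightarrow> 'x \<Rightarrow> 'x \<Rightarrow> 'a" where
  "comb_unit R X x = (\<lambda>z\<in>X. if z = x then \<one>\<^bsub>R\<^esub> else \<zero>\<^bsub>R\<^esub>)"

definition comb_mult ::
    "('a, 'm) ring_scheme \<Rightarrow> 'a topology \<Rightarrow> 'x set \<Rightarrow> (('x \<Rightarrow> 'a) \<Rightarrow> 'a) \<Rightarrow> 'x \<Rightarrow> 'a" where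
  "comb_mult R T X r =
     (\<lambda>x\<in>X. top_sum R T (\<lambda>y. r y \<otimes>\<^bsub>R\<^esub> y x) (formal_combs R T X))"

section \<open>Contramodules\<close>

record ('c, 'a) contra = "'c partial_object" +
  act :: "('c \<Rightarrow> 'a) \<Rightarrow> 'c"

definition contramodule :: "('a, 'm) ring_scheme \<Rightarrow> 'a topology \<Rightarrow> ('c, 'a) contra \<Rightarrow> bool" where
  "contramodule R T C \<longleftrightarrow>
     act C \<in> formal_combs R T (carrier C) \<rightarrow> carrier C \<and>
     (\<forall>c\<in>carrier C. act C (comb_unit R (carrier C) c) = c) \<and>
     (\<forall>r\<in>formal_combs R T (formal_combs R T (carrier C)).
        act C (comb_mult R T (carrier C) r) =
        act C (comb_map R T (formal_combs R T (carrier C)) (carrier C) (act C) r))"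

definition contra_hom ::
    "('a, 'm) ring_scheme \<Rightarrow> 'a topology \<Rightarrow> ('b, 'a) contra \<Rightarrow> ('c, 'a) contra \<Rightarrow> ('b \<Rightarrow> 'c) set" where
  "contra_hom R T B C =
     {f \<in> carrier B \<rightarrow> carrier C.
        \<forall>r\<in>formal_combs R T (carrier B).
          f (act B r) = act C (comb_map R T (carrier B) (carrier C) f r)}"

text \<open>
  Epimorphisms are the right cancellable morphisms. Objects on the type of the codomain suffice
  for testing, as every quotient of the codomain has an isomorphic copy there; see
  \<open>complete_lin_ring.contra_epi_iff_surj\<close> below, by which epimorphisms are precisely the surjective morphisms.
\<close>

definition contra_epi ::
    "('a, 'm) ring_scheme \<Rightarrow> 'a topology \<Rightarrow> ('b, 'a) contra \<Rightarrow> ('c, 'a) contra \<Rightarrow> ('b \<Rightarrow> 'c) \<Rightarrow> bool" where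
  "contra_epi R T B C p \<longleftrightarrow>
     p \<in> contra_hom R T B C \<and>
     (\<forall>(D :: ('c, 'a) contra) u v.
        contramodule R T D \<and> u \<in> contra_hom R T C D \<and> v \<in> contra_hom R T C D \<and>
        (\<forall>b\<in>carrier B. u (p b) = v (p b)) \<longrightarrow> (\<forall>c\<in>carrier C. u c = v c))"

text \<open>
  The lifting property against an epimorphism \<open>g : A \<rightarrow> B\<close>. A definition cannot quantify over
  the types carrying \<open>A\<close> and \<open>B\<close>; we use types large enough to carry the canonical
  epimorphism from the free contramodule on the set \<open>P\<close> onto \<open>P\<close>. Lifting against
  that one makes \<open>P\<close> a direct summand of a free contramodule, so the lifting property against
  epimorphisms of contramodules on arbitrary types follows; see
  \<open>complete_lin_ring.contra_projective_lift\<close> below.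
\<close>

definition contra_projective ::
    "('a, 'm) ring_scheme \<Rightarrow> 'a topology \<Rightarrow> ('p, 'a) contra \<Rightarrow> bool" where
  "contra_projective R T P \<longleftrightarrow>
     contramodule R T P \<and>
     (\<forall>(A :: ('p \<Rightarrow> 'a, 'a) contra) (B :: ('p, 'a) contra) g f.
        contramodule R T A \<and> contramodule R T B \<and> contra_epi R T A B g \<and> f \<in> contra_hom R T P B \<longrightarrow>
        (\<exists>h\<in>contra_hom R T P A. \<forall>x\<in>carrier P. g (h x) = f x))"

definition contra_aut ::
    "('a, 'm) ring_scheme \<Rightarrow> 'a topology \<Rightarrow> ('p, 'a) contra \<Rightarrow> ('p \<Rightarrow> 'p) \<Rightarrow> bool" where
  "contra_aut R T P e \<longleftrightarrow>
     e \<in> contra_hom R T P P \<and>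
     (\<exists>e'\<in>contra_hom R T P P. \<forall>x\<in>carrier P. e' (e x) = x \<and> e (e' x) = x)"

definition projective_cover ::
    "('a, 'm) ring_scheme \<Rightarrow> 'a topology \<Rightarrow> ('p, 'a) contra \<Rightarrow> ('c, 'a) contra \<Rightarrow> ('p \<Rightarrow> 'c) \<Rightarrow> bool" where
  "projective_cover R T P C p \<longleftrightarrow>
     contra_projective R T P \<and> contra_epi R T P C p \<and>
     (\<forall>e\<in>contra_hom R T P P. (\<forall>x\<in>carrier P. p (e x) = p x) \<longrightarrow> contra_aut R T P e)"

section \<open>Conditions on the ideal and its quotient ring\<close>

definition quot_topology :: "('a, 'm) ring_scheme \<Rightarrow> 'a topology \<Rightarrow> 'a set \<Rightarrow> 'a set topology" where
  "quot_topology A T H =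
     topology (\<lambda>W. W \<subseteq> a_rcosets\<^bsub>A\<^esub> H \<and> openin T {a \<in> carrier A. H +>\<^bsub>A\<^esub> a \<in> W})"

text \<open>
  The type of the index sets \<open>X\<close> is large enough to represent all sets \<open>X\<close>: since \<open>H\<close> is
  closed, in an element of \<open>(A/H)[[X]]\<close> every nonzero element of \<open>A/H\<close> occurs as a
  coefficient only finitely many times; see \<open>strongly_closed_lift\<close> below.
\<close>

definition strongly_closed :: "('a, 'm) ring_scheme \<Rightarrow> 'a topology \<Rightarrow> 'a set \<Rightarrow> bool" where
  "strongly_closed A T H \<longleftrightarrow>
     additive_subgroup H A \<and> closedin T H \<and>
     top_complete (A Quot H) (quot_topology A T H) \<and>
     (\<forall>X :: ('a set \<times> nat) set.
        (\<lambda>a. \<lambda>x\<in>X. H +>\<^bsub>A\<^esub> a x) ` formal_combs A T X =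
        formal_combs (A Quot H) (quot_topology A T H) X)"

primrec seq_prod :: "('a, 'm) ring_scheme \<Rightarrow> (nat \<Rightarrow> 'a) \<Rightarrow> nat \<Rightarrow> 'a" where
  "seq_prod R a 0 = a 0"
| "seq_prod R a (Suc n) = seq_prod R a n \<otimes>\<^bsub>R\<^esub> a (Suc n)"

definition top_left_T_nilpotent :: "('a, 'm) ring_scheme \<Rightarrow> 'a topology \<Rightarrow> 'a set \<Rightarrow> bool" where
  "top_left_T_nilpotent R T H \<longleftrightarrow>
     (\<forall>a :: nat \<Rightarrow> 'a. (\<forall>n. a n \<in> H) \<longrightarrow> limitin T (seq_prod R a) \<zero>\<^bsub>R\<^esub> sequentially)"

definition artinian :: "('a, 'm) ring_scheme \<Rightarrow> bool" where
  "artinian R \<longleftrightarrow>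
     (\<forall>I :: nat \<Rightarrow> 'a set. decseq I \<and> (\<forall>n. left_ideal R (I n)) \<longrightarrow> (\<exists>N. \<forall>n\<ge>N. I n = I N)) \<and>
     (\<forall>I :: nat \<Rightarrow> 'a set. decseq I \<and> (\<forall>n. right_ideal R (I n)) \<longrightarrow> (\<exists>N. \<forall>n\<ge>N. I n = I N))"

definition simple_ring :: "('a, 'm) ring_scheme \<Rightarrow> bool" where
  "simple_ring R \<longleftrightarrow>
     ring R \<and> \<one>\<^bsub>R\<^esub> \<noteq> \<zero>\<^bsub>R\<^esub> \<and> (\<forall>I. ideal I R \<longrightarrow> I = {\<zero>\<^bsub>R\<^esub>} \<or> I = carrier R)"

definition product_ring :: "'i set \<Rightarrow> ('i \<Rightarrow> ('s, 'n) ring_scheme) \<Rightarrow> ('i \<Rightarrow> 's) ring" where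
  "product_ring \<Gamma> S =
     \<lparr>carrier = (\<Pi>\<^sub>E \<gamma>\<in>\<Gamma>. carrier (S \<gamma>)),
      mult = (\<lambda>x y. \<lambda>\<gamma>\<in>\<Gamma>. x \<gamma> \<otimes>\<^bsub>S \<gamma>\<^esub> y \<gamma>),
      one = (\<lambda>\<gamma>\<in>\<Gamma>. \<one>\<^bsub>S \<gamma>\<^esub>),
      zero = (\<lambda>\<gamma>\<in>\<Gamma>. \<zero>\<^bsub>S \<gamma>\<^esub>),
      add = (\<lambda>x y. \<lambda>\<gamma>\<in>\<Gamma>. x \<gamma> \<oplus>\<^bsub>S \<gamma>\<^esub> y \<gamma>)\<rparr>"

definition top_ring_iso ::
    "('a, 'm) ring_scheme \<Rightarrow> 'a topology \<Rightarrow> ('b, 'n) ring_scheme \<Rightarrow> 'b topology \<Rightarrow> ('a \<Rightarrow> 'b) set" where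
  "top_ring_iso R T S T' = {h \<in> ring_iso R S. homeomorphic_map T T' h}"

section \<open>Index sets of arbitrary type in strong closedness\<close>

lemma openin_quot_topology:
  "openin (quot_topology A T H) W \<longleftrightarrow>
     W \<subseteq> a_rcosets\<^bsub>A\<^esub> H \<and> openin T {a \<in> carrier A. H +>\<^bsub>A\<^esub> a \<in> W}"
proof -
  have "istopology (\<lambda>W. W \<subseteq> a_rcosets\<^bsub>A\<^esub> H \<and> openin T {a \<in> carrier A. H +>\<^bsub>A\<^esub> a \<in> W})"
    unfolding istopology_def
  proof (intro conjI allI impI)
    fix S S'
    assume "S \<subseteq> a_rcosets\<^bsub>A\<^esub> H \<and> openin T {a \<in> carrier A. H +>\<^bsub>A\<^esub> a \<in> S}"
      and "S' \<subseteq> a_rcosets\<^bsub>A\<^esub> H \<and> openin T {a \<in> carrier A. H +>\<^bsub>A\<^esub> a \<in> S'}"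
    moreover have "{a \<in> carrier A. H +>\<^bsub>A\<^esub> a \<in> S \<inter> S'} =
        {a \<in> carrier A. H +>\<^bsub>A\<^esub> a \<in> S} \<inter> {a \<in> carrier A. H +>\<^bsub>A\<^esub> a \<in> S'}" by auto
    ultimately show "S \<inter> S' \<subseteq> a_rcosets\<^bsub>A\<^esub> H" "openin T {a \<in> carrier A. H +>\<^bsub>A\<^esub> a \<in> S \<inter> S'}"
      by (auto simp: openin_Int)
  next
    fix \<K> assume K: "\<forall>K\<in>\<K>. K \<subseteq> a_rcosets\<^bsub>A\<^esub> H \<and> openin T {a \<in> carrier A. H +>\<^bsub>A\<^esub> a \<in> K}"
    have "{a \<in> carrier A. H +>\<^bsub>A\<^esub> a \<in> \<Union> \<K>} = (\<Union>K\<in>\<K>. {a \<in> carrier A. H +>\<^bsub>A\<^esub> a \<in> K})" by auto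
    with K show "openin T {a \<in> carrier A. H +>\<^bsub>A\<^esub> a \<in> \<Union> \<K>}" by (auto intro: openin_Union)
    show "\<Union> \<K> \<subseteq> a_rcosets\<^bsub>A\<^esub> H" using K by blast
  qed
  then show ?thesis unfolding quot_topology_def by (simp add: topology_inverse')
qed

lemma quot_separating:
  fixes A (structure)
  assumes top: "topological_abgroup A T" and H: "additive_subgroup H A" and cl: "closedin T H"
    and c: "c \<in> a_rcosets H" "c \<noteq> H"
  shows "\<exists>V\<in>open_subgroups (A Quot H) (quot_topology A T H). c \<notin> V"
proof -
  interpret abelian_group A using top by (simp add: topological_abgroup_def)
  interpret abelian_subgroup H A by (rule abelian_subgroupI3[OF H]) (rule abelian_group_axioms)
  have ts: "topspace T = carrier A" using top by (simp add: topological_abgroup_def)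
  have cont: "continuous_map (prod_topology T T) T (\<lambda>(x, y). x \<oplus> y)"
    using top by (simp add: topological_abgroup_def)
  have tr: "continuous_map T T (\<lambda>x. l \<oplus> x)" if "l \<in> carrier A" for l
    using continuous_map_compose[of T "prod_topology T T" "\<lambda>x. (l, x)" T "\<lambda>(x, y). x \<oplus> y"] cont that
    by (simp add: o_def continuous_map_pairedI ts)
  have tro: "openin T {x \<in> carrier A. l \<oplus> x \<in> W}" if "l \<in> carrier A" "openin T W" for l W
    using openin_continuous_map_preimage[OF tr[OF that(1)] that(2)] by (simp add: ts)
  obtain a where a: "a \<in> carrier A" "c = H +> a" using c(1) by (auto simp: A_RCOSETS_def')
  have aH: "a \<notin> H" using a c(2) a_rcos_const by blast
  have "openin T (carrier A - H)" using cl by (metis closedin_def ts)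
  from tro[OF a(1) this] have "openin T {x \<in> carrier A. a \<oplus> x \<in> carrier A - H}" .
  moreover have "\<zero> \<in> {x \<in> carrier A. a \<oplus> x \<in> carrier A - H}" using a(1) aH by simp
  ultimately obtain U where U: "U \<in> open_subgroups A T" "U \<subseteq> {x \<in> carrier A. a \<oplus> x \<in> carrier A - H}"
    using top unfolding topological_abgroup_def by meson
  have Us: "additive_subgroup U A" and Uo: "openin T U" using U(1) by (auto simp: open_subgroups_def)
  have Uc: "U \<subseteq> carrier A" using U(2) by auto
  define V where "V = (\<lambda>u. H +> u) ` U"
  have am: "add_monoid (A Quot H) = A A_Mod H" by (simp add: FactRing_def A_FactGroup_def')
  have "subgroup V (A A_Mod H)"
    unfolding V_def
  proof (rule group_hom.subgroup_img_is_subgroup[of "add_monoid A"])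
    show "group_hom (add_monoid A) (A A_Mod H) ((+>) H)"
      unfolding group_hom_def group_hom_axioms_def
      using a_group a_factorgroup_is_group a_r_coset_hom_A_Mod by simp
    show "subgroup U (add_monoid A)" by (rule additive_subgroup.a_subgroup[OF Us])
  qed
  then have Vs: "additive_subgroup V (A Quot H)" unfolding additive_subgroup_def am .
  have Vp: "{x \<in> carrier A. H +> x \<in> V} = (\<Union>h\<in>H. {x \<in> carrier A. (\<ominus> h) \<oplus> x \<in> U})"
  proof (intro equalityI subsetI)
    fix x assume "x \<in> {x \<in> carrier A. H +> x \<in> V}"
    then obtain u where x: "x \<in> carrier A" and u: "u \<in> U" "H +> x = H +> u" by (auto simp: V_def)
    then have "x \<in> H +> u" using a_rcos_self[OF x] by simp
    then obtain h where h: "h \<in> H" "x = h \<oplus> u" by (auto simp: a_r_coset_def')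
    then have "(\<ominus> h) \<oplus> x = u" using u Uc a_subset by (metis r_neg1 subsetD)
    then have "(\<ominus> h) \<oplus> x \<in> U" using u by simp
    then show "x \<in> (\<Union>h\<in>H. {x \<in> carrier A. (\<ominus> h) \<oplus> x \<in> U})" using h(1) x by blast
  next
    fix x assume "x \<in> (\<Union>h\<in>H. {x \<in> carrier A. (\<ominus> h) \<oplus> x \<in> U})"
    then obtain h where h: "h \<in> H" "x \<in> carrier A" "(\<ominus> h) \<oplus> x \<in> U" by blast
    have hc: "h \<in> carrier A" using h a_subset by blast
    have "x = h \<oplus> ((\<ominus> h) \<oplus> x)" using h hc by (simp add: r_neg2)
    then have "x \<in> H +> ((\<ominus> h) \<oplus> x)" using h(1) unfolding a_r_coset_def' by blast
    then have "H +> ((\<ominus> h) \<oplus> x) = H +> x" 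
      by (rule a_repr_independence) (use h hc in \<open>auto intro: a_subgroup\<close>)
    then show "x \<in> {x \<in> carrier A. H +> x \<in> V}" using h unfolding V_def by (metis (mono_tags, lifting) image_eqI mem_Collect_eq)
  qed
  have "openin T {x \<in> carrier A. H +> x \<in> V}"
    unfolding Vp using tro Uo a_subset by (auto intro!: openin_Union)
  moreover have "V \<subseteq> a_rcosets H" using Uc a_rcosetsI[OF a_subset] by (auto simp: V_def)
  ultimately have "V \<in> open_subgroups (A Quot H) (quot_topology A T H)"
    using Vs by (simp add: open_subgroups_def openin_quot_topology)
  moreover have "c \<notin> V"
  proof
    assume "c \<in> V"
    then obtain u where u: "u \<in> U" "H +> a = H +> u" using a by (auto simp: V_def)
    have uc: "u \<in> carrier A" using u Uc by blast
    have "a \<in> H +> u" using a_rcos_self[OF a(1)] u by simp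
    then obtain h where h: "h \<in> H" "a = h \<oplus> u" by (auto simp: a_r_coset_def')
    have hc: "h \<in> carrier A" using h a_subset by blast
    have nu: "\<ominus> u \<in> U" using Us u
      by (metis a_inv_def additive_subgroup.a_subgroup subgroup.m_inv_closed)
    have "a \<oplus> (\<ominus> u) = h" using h hc uc by (simp add: a_assoc r_neg)
    then show False using U(2) nu h(1) by auto
  qed
  ultimately show ?thesis by blast
qed

lemma strongly_closed_lift:
  fixes A (structure) and X :: "'x set"
  assumes top: "topological_abgroup A T" and sc: "strongly_closed A T H"
    and b: "b \<in> formal_combs (A Quot H) (quot_topology A T H) X"
  shows "\<exists>a\<in>formal_combs A T X. (\<lambda>x\<in>X. H +> a x) = b"
proof -
  interpret abelian_group A using top by (simp add: topological_abgroup_def)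
  have Hs: "additive_subgroup H A" and cl: "closedin T H" using sc by (auto simp: strongly_closed_def)
  interpret abelian_subgroup H A by (rule abelian_subgroupI3[OF Hs]) (rule abelian_group_axioms)
  let ?Q = "A Quot H" and ?q = "quot_topology A T H"
  have cQ: "carrier ?Q = a_rcosets H" by (simp add: FactRing_def)
  have bc: "b x \<in> a_rcosets H" if "x \<in> X" for x using b that by (auto simp: formal_combs_def cQ)
  have bext: "b \<in> extensional X" using b by (auto simp: formal_combs_def PiE_def)
  have bf: "finite {x \<in> X. b x \<notin> V}" if "V \<in> open_subgroups ?Q ?q" for V
    using b that by (auto simp: formal_combs_def)
  have fib: "finite {x \<in> X. b x = c}" if c: "c \<noteq> H" for c
  proof (cases "c \<in> a_rcosets H")
    case True
    from quot_separating[OF top Hs cl True c]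
    obtain V where "V \<in> open_subgroups ?Q ?q" "c \<notin> V" by blast
    then show ?thesis using finite_subset[OF _ bf[of V], of "{x \<in> X. b x = c}"] by blast
  next
    case False
    then have "{x \<in> X. b x = c} = {}" using bc by blast
    then show ?thesis by (metis finite.emptyI)
  qed
  have "\<forall>c. \<exists>g :: 'x \<Rightarrow> nat. c \<noteq> H \<longrightarrow> inj_on g {x \<in> X. b x = c}"
    using finite_imp_inj_to_nat_seg[OF fib] by metis
  then obtain g :: "'a set \<Rightarrow> 'x \<Rightarrow> nat" where g: "\<And>c. c \<noteq> H \<Longrightarrow> inj_on (g c) {x \<in> X. b x = c}" by metis
  define Y where "Y = {x \<in> X. b x \<noteq> H}"
  define i where "i x = (b x, g (b x) x)" for x
  have inj: "inj_on i Y"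
  proof (rule inj_onI)
    fix x y assume xy: "x \<in> Y" "y \<in> Y" "i x = i y"
    then have "b x = b y" "g (b x) x = g (b x) y" by (auto simp: i_def)
    then show "x = y" using g[of "b x"] xy by (auto simp: Y_def inj_on_def)
  qed
  define b' where "b' = (\<lambda>p\<in>i ` Y. fst p)"
  have "b' \<in> formal_combs ?Q ?q (i ` Y)"
    unfolding formal_combs_def
  proof (intro CollectI conjI ballI)
    show "b' \<in> i ` Y \<rightarrow>\<^sub>E carrier ?Q" using bc by (auto simp: b'_def i_def Y_def cQ)
    fix V assume "V \<in> open_subgroups ?Q ?q"
    from finite_imageI[OF bf[OF this], of i] show "finite {p \<in> i ` Y. b' p \<notin> V}"
      by (rule rev_finite_subset) (auto simp: b'_def i_def Y_def)
  qed
  then have "b' \<in> (\<lambda>a. \<lambda>x\<in>i ` Y. H +> a x) ` formal_combs A T (i ` Y)"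
    using sc by (simp add: strongly_closed_def)
  then obtain a' where a': "a' \<in> formal_combs A T (i ` Y)" "b' = (\<lambda>p\<in>i ` Y. H +> a' p)" by blast
  define a where "a = (\<lambda>x\<in>X. if x \<in> Y then a' (i x) else \<zero>)"
  have "a \<in> formal_combs A T X"
    unfolding formal_combs_def
  proof (intro CollectI conjI ballI)
    have "a' (i x) \<in> carrier A" if "x \<in> Y" for x
      using a'(1) that unfolding formal_combs_def by (blast dest: PiE_mem)
    then show "a \<in> X \<rightarrow>\<^sub>E carrier A" by (auto simp: a_def)
    fix U assume U: "U \<in> open_subgroups A T"
    have "\<zero> \<in> U" using U by (simp add: open_subgroups_def additive_subgroup.zero_closed)
    then have e: "{x \<in> X. a x \<notin> U} = {x \<in> Y. a' (i x) \<notin> U}" by (auto simp: a_def Y_def)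
    have "finite {p \<in> i ` Y. a' p \<notin> U}" using a'(1) U by (simp add: formal_combs_def)
    then have "finite (i ` {x \<in> Y. a' (i x) \<notin> U})" by (rule rev_finite_subset) auto
    then show "finite {x \<in> X. a x \<notin> U}"
      unfolding e by (rule finite_imageD) (rule inj_on_subset[OF inj], blast)
  qed
  moreover have "(\<lambda>x\<in>X. H +> a x) = b"
  proof (rule extensionalityI[OF _ bext])
    fix x assume x: "x \<in> X"
    show "(\<lambda>x\<in>X. H +> a x) x = b x"
    proof (cases "x \<in> Y")
      case True
      then have "H +> a' (i x) = b' (i x)" by (simp add: a'(2))
      then show ?thesis using True x by (simp add: a_def b'_def i_def)
    next
      case False
      then have "b x = H" using x by (simp add: Y_def)
      then show ?thesis using False x a_coset_add_zero[OF a_subset] by (simp add: a_def)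
    qed
  qed simp
  ultimately show ?thesis by blast
qed

section \<open>Epimorphisms, and projectivity for contramodules on arbitrary types\<close>

definition free_contra :: "('a, 'm) ring_scheme \<Rightarrow> 'a topology \<Rightarrow> 'x set \<Rightarrow> ('x \<Rightarrow> 'a, 'a) contra" where
  "free_contra R T X = \<lparr>carrier = formal_combs R T X, act = comb_mult R T X\<rparr>"

locale complete_lin_ring = ring R for R :: "('a, 'm) ring_scheme" (structure) +
  fixes T :: "'a topology"
  assumes top_ring: "topological_ring R T"
    and sep: "top_separated R T"
    and comp: "top_complete R T"
    and base: "open_right_ideal_base R T"
begin

lemma tops [simp]: "topspace T = carrier R"
  using top_ring by (auto simp: topological_ring_def topological_abgroup_def)

abbreviation "OS \<equiv> open_subgroups R T"
abbreviation "FC \<equiv> formal_combs R T"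
abbreviation "tsum \<equiv> top_sum R T"
abbreviation "cmap \<equiv> comb_map R T"
abbreviation "cmult \<equiv> comb_mult R T"

lemma OS_sub: "U \<in> OS \<Longrightarrow> x \<in> U \<Longrightarrow> x \<in> carrier R"
  using additive_subgroup.a_subset by (fastforce simp: open_subgroups_def)
lemma OS_zero: "U \<in> OS \<Longrightarrow> \<zero> \<in> U"
  by (simp add: additive_subgroup.zero_closed open_subgroups_def)
lemma OS_add: "U \<in> OS \<Longrightarrow> x \<in> U \<Longrightarrow> y \<in> U \<Longrightarrow> x \<oplus> y \<in> U"
  by (simp add: additive_subgroup.a_closed open_subgroups_def)
lemma OS_neg: "U \<in> OS \<Longrightarrow> x \<in> U \<Longrightarrow> \<ominus> x \<in> U"
  by (metis (mono_tags, lifting) a_inv_def add.m_inv_consistent additive_subgroup.a_subgroup mem_Collect_eq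
        open_subgroups_def subgroup.m_inv_closed)
lemma OS_diff: "U \<in> OS \<Longrightarrow> x \<in> U \<Longrightarrow> y \<in> U \<Longrightarrow> x \<ominus> y \<in> U"
  by (simp add: OS_add OS_neg a_minus_def)

lemma diff_trans: "\<lbrakk>U \<in> OS; x \<ominus> y \<in> U; y \<ominus> z \<in> U; x \<in> carrier R; y \<in> carrier R; z \<in> carrier R\<rbrakk> \<Longrightarrow> x \<ominus> z \<in> U"
proof -
  assume a: "U \<in> OS" "x \<ominus> y \<in> U" "y \<ominus> z \<in> U" "x \<in> carrier R" "y \<in> carrier R" "z \<in> carrier R"
  have "x \<ominus> z = (x \<ominus> y) \<oplus> (y \<ominus> z)" using a(4-6) by (simp add: a_minus_def a_assoc r_neg1 r_neg2)
  then show ?thesis using OS_add a by simp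
qed

lemma diff_sym: "\<lbrakk>U \<in> OS; x \<ominus> y \<in> U; x \<in> carrier R; y \<in> carrier R\<rbrakk> \<Longrightarrow> y \<ominus> x \<in> U"
proof -
  assume a: "U \<in> OS" "x \<ominus> y \<in> U" "x \<in> carrier R" "y \<in> carrier R"
  have "y \<ominus> x = \<ominus> (x \<ominus> y)" using a(3-4) by (simp add: a_minus_def minus_add a_comm)
  then show ?thesis using OS_neg a by simp
qed

lemma diff_mem: "\<lbrakk>U \<in> OS; x \<ominus> y \<in> U; y \<in> U; x \<in> carrier R\<rbrakk> \<Longrightarrow> x \<in> U"
proof -
  assume a: "U \<in> OS" "x \<ominus> y \<in> U" "y \<in> U" "x \<in> carrier R"
  have "x = (x \<ominus> y) \<oplus> y" using a OS_sub[OF a(1) a(3)] by (simp add: a_minus_def a_assoc l_neg)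
  then show ?thesis using OS_add a by metis
qed

lemma add_diff: "\<lbrakk>x \<in> carrier R; y \<in> carrier R\<rbrakk> \<Longrightarrow> x \<oplus> (y \<ominus> x) = y"
  using a_lcomm[of x y "\<ominus> x"] by (simp add: a_minus_def r_neg)

definition "ORI = {U. right_ideal R U \<and> openin T U}"

lemma ORI_OS: "U \<in> ORI \<Longrightarrow> U \<in> OS"
  by (auto simp: ORI_def open_subgroups_def right_ideal_def)
lemma ORI_mult: "U \<in> ORI \<Longrightarrow> x \<in> U \<Longrightarrow> r \<in> carrier R \<Longrightarrow> x \<otimes> r \<in> U"
  by (auto simp: ORI_def right_ideal_def)

lemma ORI_refine: "openin T W \<Longrightarrow> \<zero> \<in> W \<Longrightarrow> \<exists>U\<in>ORI. U \<subseteq> W"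
  using base by (auto simp: ORI_def open_right_ideal_base_def)

lemma ORI_OS_refine: "W \<in> OS \<Longrightarrow> \<exists>U\<in>ORI. U \<subseteq> W"
  by (rule ORI_refine) (auto simp: OS_zero, simp add: open_subgroups_def)

lemma cont_add: "continuous_map (prod_topology T T) T (\<lambda>(x, y). x \<oplus> y)"
  and cont_neg: "continuous_map T T (\<lambda>x. \<ominus> x)"
  and cont_mult: "continuous_map (prod_topology T T) T (\<lambda>(x, y). x \<otimes> y)"
  using top_ring by (auto simp: topological_ring_def topological_abgroup_def)

lemma cont_add_left: "l \<in> carrier R \<Longrightarrow> continuous_map T T (\<lambda>x. l \<oplus> x)"
  using continuous_map_compose[of T "prod_topology T T" "\<lambda>x. (l, x)" T "\<lambda>(x, y). x \<oplus> y"] cont_add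
  by (simp add: o_def continuous_map_pairedI)

lemma cont_mult_left: "l \<in> carrier R \<Longrightarrow> continuous_map T T (\<lambda>x. l \<otimes> x)"
  using continuous_map_compose[of T "prod_topology T T" "\<lambda>x. (l, x)" T "\<lambda>(x, y). x \<otimes> y"] cont_mult
  by (simp add: o_def continuous_map_pairedI)

lemma ORI_mult_left: "l \<in> carrier R \<Longrightarrow> U \<in> OS \<Longrightarrow> \<exists>V\<in>ORI. \<forall>v\<in>V. l \<otimes> v \<in> U"
proof -
  assume l: "l \<in> carrier R" and U: "U \<in> OS"
  have "openin T {x \<in> topspace T. l \<otimes> x \<in> U}"
    by (rule openin_continuous_map_preimage[OF cont_mult_left[OF l]]) (use U in \<open>simp add: open_subgroups_def\<close>)
  then have "\<exists>V\<in>ORI. V \<subseteq> {x \<in> topspace T. l \<otimes> x \<in> U}"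
    by (rule ORI_refine) (use l U OS_zero in auto)
  then show ?thesis by auto
qed

lemma eqI: "\<lbrakk>x \<in> carrier R; y \<in> carrier R; \<And>U. U \<in> ORI \<Longrightarrow> x \<ominus> y \<in> U\<rbrakk> \<Longrightarrow> x = y"
proof -
  assume x: "x \<in> carrier R" and y: "y \<in> carrier R" and *: "\<And>U. U \<in> ORI \<Longrightarrow> x \<ominus> y \<in> U"
  have **: "x \<ominus> y \<in> U" if "U \<in> OS" for U using ORI_OS_refine[OF that] * by blast
  have "U +> x = U +> y" if U: "U \<in> OS" for U
  proof -
    have "x = (x \<ominus> y) \<oplus> y" using x y by (simp add: a_minus_def a_assoc l_neg)
    then have "x \<in> U +> y" unfolding a_r_coset_def' using **[OF U] by blast
    then show ?thesis using U y
      by (metis (no_types, lifting) a_repr_independence additive_subgroup.a_subgroup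
          mem_Collect_eq open_subgroups_def)
  qed
  then have "completion_map R T x = completion_map R T y"
    unfolding completion_map_def by (intro restrict_ext)
  then show ?thesis using sep x y by (auto simp: top_separated_def inj_on_def)
qed

lemma limit_iff:
  assumes "l \<in> carrier R" "eventually (\<lambda>F. s F \<in> carrier R) Fl"
  shows "limitin T s l Fl \<longleftrightarrow> (\<forall>U\<in>OS. eventually (\<lambda>F. s F \<ominus> l \<in> U) Fl)"
proof
  assume L: "limitin T s l Fl"
  show "\<forall>U\<in>OS. eventually (\<lambda>F. s F \<ominus> l \<in> U) Fl"
  proof
    fix U assume U: "U \<in> OS"
    have "openin T {x \<in> topspace T. (\<ominus> l) \<oplus> x \<in> U}"
      by (rule openin_continuous_map_preimage[OF cont_add_left]) (use U assms in \<open>auto simp add: open_subgroups_def\<close>)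
    moreover have "l \<in> {x \<in> topspace T. (\<ominus> l) \<oplus> x \<in> U}" using assms OS_zero[OF U] by (simp add: l_neg)
    ultimately have "eventually (\<lambda>F. s F \<in> {x \<in> topspace T. (\<ominus> l) \<oplus> x \<in> U}) Fl"
      using L by (auto simp: limitin_def)
    then show "eventually (\<lambda>F. s F \<ominus> l \<in> U) Fl"
      by (rule eventually_mono) (use assms in \<open>auto simp: a_minus_def a_comm\<close>)
  qed
next
  assume R: "\<forall>U\<in>OS. eventually (\<lambda>F. s F \<ominus> l \<in> U) Fl"
  show "limitin T s l Fl"
    unfolding limitin_def
  proof (intro conjI allI impI)
    show "l \<in> topspace T" using assms by simp
    fix W assume W: "openin T W \<and> l \<in> W"
    have "openin T {x \<in> topspace T. l \<oplus> x \<in> W}"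
      by (rule openin_continuous_map_preimage[OF cont_add_left]) (use W assms in auto)
    then have "\<exists>V\<in>ORI. V \<subseteq> {x \<in> topspace T. l \<oplus> x \<in> W}"
      by (rule ORI_refine) (use W assms in auto)
    then obtain V where V: "V \<in> OS" "\<And>v. v \<in> V \<Longrightarrow> l \<oplus> v \<in> W" using ORI_OS by blast
    have "eventually (\<lambda>F. s F \<ominus> l \<in> V) Fl" using R V by blast
    then show "eventually (\<lambda>F. s F \<in> W) Fl"
      using assms(2)
    proof eventually_elim
      case (elim F)
      have "l \<oplus> (s F \<ominus> l) = s F" using elim assms(1)
        by (simp add: add_diff)
      then show ?case using V(2)[OF elim(1)] by simp
    qed
  qed
qed

definition nullfam :: "('i \<Rightarrow> 'a) \<Rightarrow> 'i set \<Rightarrow> bool" where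
  "nullfam a I \<longleftrightarrow> a \<in> I \<rightarrow> carrier R \<and> (\<forall>U\<in>OS. finite {i \<in> I. a i \<notin> U})"

lemma finsum_OS: "\<lbrakk>U \<in> OS; \<And>i. i \<in> F \<Longrightarrow> a i \<in> U\<rbrakk> \<Longrightarrow> finsum R a F \<in> U"
proof (induction F rule: infinite_finite_induct)
  case (insert x F)
  then have "finsum R a (insert x F) = a x \<oplus> finsum R a F"
    by (intro finsum_insert) (auto intro: OS_sub)
  then show ?case using insert OS_add by simp
qed (auto simp: OS_zero finsum_infinite)

lemma finsum_mod:
  assumes "U \<in> OS" "a \<in> F \<rightarrow> carrier R" "finite F" "B \<subseteq> F" "\<And>i. i \<in> F - B \<Longrightarrow> a i \<in> U"
  shows "finsum R a F \<ominus> finsum R a B \<in> U"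
proof -
  have F: "F = B \<union> (F - B)" using assms by auto
  have c: "finsum R a B \<in> carrier R" "finsum R a (F - B) \<in> carrier R"
    using assms by (auto intro!: finsum_closed)
  have "finsum R a F = finsum R a B \<oplus> finsum R a (F - B)"
    by (subst F, rule finsum_Un_disjoint) (use assms in \<open>auto intro: finite_subset\<close>)
  then have "finsum R a F \<ominus> finsum R a B = finsum R a (F - B)"
    using c by (simp add: a_minus_def a_ac r_neg1 r_neg2 r_neg)
  moreover have "finsum R a (F - B) \<in> U" using assms by (intro finsum_OS) auto
  ultimately show ?thesis by simp
qed

lemma nullfam_ORI: "a \<in> I \<rightarrow> carrier R \<Longrightarrow> (\<And>U. U \<in> ORI \<Longrightarrow> finite {i \<in> I. a i \<notin> U}) \<Longrightarrow> nullfam a I"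
proof -
  assume a: "a \<in> I \<rightarrow> carrier R" and *: "\<And>U. U \<in> ORI \<Longrightarrow> finite {i \<in> I. a i \<notin> U}"
  have "finite {i \<in> I. a i \<notin> U}" if U: "U \<in> OS" for U
  proof -
    obtain V where "V \<in> ORI" "V \<subseteq> U" using ORI_OS_refine[OF U] by blast
    then show ?thesis using finite_subset[OF _ *[of V], of "{i \<in> I. a i \<notin> U}"] by blast
  qed
  then show ?thesis using a by (simp add: nullfam_def)
qed

lemma tsum_ex:
  assumes a: "nullfam a I"
  shows "\<exists>l\<in>carrier R. \<forall>U\<in>OS. \<forall>F. finite F \<and> F \<subseteq> I \<and> {i \<in> I. a i \<notin> U} \<subseteq> F \<longrightarrow> finsum R a F \<ominus> l \<in> U"
proof -
  let ?B = "\<lambda>U. {i \<in> I. a i \<notin> U}"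
  have ac: "a \<in> F \<rightarrow> carrier R" if "F \<subseteq> I" for F using a that by (auto simp: nullfam_def)
  have fb: "finite (?B U)" if "U \<in> OS" for U using a that by (auto simp: nullfam_def)
  have sc: "finsum R a F \<in> carrier R" if "F \<subseteq> I" for F using ac that by (intro finsum_closed) 
  define c where "c = (\<lambda>U\<in>OS. U +> finsum R a (?B U))"
  have "c \<in> inverse_limit R T"
    unfolding inverse_limit_def
  proof (intro CollectI conjI ballI impI)
    show "c \<in> (\<Pi>\<^sub>E U\<in>OS. a_rcosets U)"
    proof (rule PiE_I)
      fix U assume U: "U \<in> OS"
      have "finsum R a (?B U) \<in> carrier R" by (rule sc) blast
      then show "c U \<in> a_rcosets U" using U by (auto simp: c_def A_RCOSETS_def')
    qed (simp add: c_def)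
    fix U V assume U: "U \<in> OS" and V: "V \<in> OS" and UV: "U \<subseteq> V"
    have *: "finsum R a (?B U) \<ominus> finsum R a (?B V) \<in> V"
      by (rule finsum_mod) (use V UV fb[OF U] ac in auto)
    show "c U \<subseteq> c V"
    proof
      fix x assume "x \<in> c U"
      then obtain u where u: "u \<in> U" "x = u \<oplus> finsum R a (?B U)"
        using U by (auto simp: c_def a_r_coset_def')
      have uc: "u \<in> carrier R" using u U OS_sub by blast
      let ?d = "finsum R a (?B U) \<ominus> finsum R a (?B V)"
      have "x = (u \<oplus> ?d) \<oplus> finsum R a (?B V)" using u uc sc[of "?B U"] sc[of "?B V"]
        by (auto simp: a_minus_def a_assoc l_neg)
      moreover have "u \<oplus> ?d \<in> V" using u UV * V by (auto intro: OS_add)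
      ultimately show "x \<in> c V" using V by (auto simp: c_def a_r_coset_def')
    qed
  qed
  then have "c \<in> completion_map R T ` carrier R" using comp by (simp add: top_complete_def)
  then obtain l where l: "l \<in> carrier R" "completion_map R T l = c" by blast
  have "finsum R a F \<ominus> l \<in> U"
    if U: "U \<in> OS" and F: "finite F" "F \<subseteq> I" "?B U \<subseteq> F" for U F
  proof -
    have "U +> l = U +> finsum R a (?B U)" using l(2) U by (auto simp: completion_map_def c_def dest: fun_cong[where x = U])
    moreover have "finsum R a (?B U) \<in> U +> finsum R a (?B U)"
      unfolding a_r_coset_def' using OS_zero[OF U] sc[of "?B U"] by (auto intro!: bexI[of _ \<zero>])
    ultimately obtain u where u: "u \<in> U" "finsum R a (?B U) = u \<oplus> l" by (auto simp: a_r_coset_def')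
    have "u \<in> carrier R" using u U OS_sub by blast
    then have "finsum R a (?B U) \<ominus> l = u" using u l(1) by (simp add: a_minus_def a_assoc r_neg)
    then have 1: "finsum R a (?B U) \<ominus> l \<in> U" using u by simp
    have "finsum R a F \<ominus> finsum R a (?B U) \<in> U" by (rule finsum_mod) (use U F ac in auto)
    then show ?thesis using 1 by (rule diff_trans[OF U]) (use sc F l in auto)
  qed
  then show ?thesis using l by blast
qed

lemma tsum_limit_unique:
  assumes a: "a \<in> I \<rightarrow> carrier R" "l \<in> carrier R" "l' \<in> carrier R"
    "limitin T (\<lambda>F. finsum R a F) l (finite_subsets_at_top I)"
    "limitin T (\<lambda>F. finsum R a F) l' (finite_subsets_at_top I)"
  shows "l = l'"
proof (rule eqI)
  fix U assume U: "U \<in> ORI"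
  have e: "eventually (\<lambda>F. finsum R a F \<in> carrier R) (finite_subsets_at_top I)"
    by (rule eventually_finite_subsets_at_top_weakI) (use a in \<open>auto intro!: finsum_closed\<close>)
  have "eventually (\<lambda>F. finsum R a F \<ominus> l \<in> U) (finite_subsets_at_top I)"
    "eventually (\<lambda>F. finsum R a F \<ominus> l' \<in> U) (finite_subsets_at_top I)"
    using limit_iff[OF a(2) e] limit_iff[OF a(3) e] a(4,5) ORI_OS[OF U] by auto
  with e have "eventually (\<lambda>F. l \<ominus> l' \<in> U) (finite_subsets_at_top I)"
  proof eventually_elim
    case (elim F)
    show ?case using diff_trans[OF ORI_OS[OF U] diff_sym[OF ORI_OS[OF U] elim(2)] elim(3)] elim(1) a by simp
  qed
  then show "l \<ominus> l' \<in> U" by (simp add: eventually_const_iff finite_subsets_at_top_neq_bot)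
qed (use a in auto)

lemma tsum_limit:
  assumes a: "nullfam a I" 
  shows "\<exists>l\<in>carrier R. limitin T (\<lambda>F. finsum R a F) l (finite_subsets_at_top I) \<and> tsum a I = l \<and> 
   (\<forall>U\<in>OS. \<forall>F. finite F \<and> F \<subseteq> I \<and> {i \<in> I. a i \<notin> U} \<subseteq> F \<longrightarrow> finsum R a F \<ominus> l \<in> U)"
proof -
  obtain l where l0: "l \<in> carrier R"
    "\<forall>U\<in>OS. \<forall>F. finite F \<and> F \<subseteq> I \<and> {i \<in> I. a i \<notin> U} \<subseteq> F \<longrightarrow> finsum R a F \<ominus> l \<in> U"
    using tsum_ex[OF a] by blast
  have l: "l \<in> carrier R"
    "\<And>U F. U \<in> OS \<Longrightarrow> finite F \<Longrightarrow> F \<subseteq> I \<Longrightarrow> {i \<in> I. a i \<notin> U} \<subseteq> F \<Longrightarrow> finsum R a F \<ominus> l \<in> U"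
    using l0 by simp_all
  have ac: "a \<in> I \<rightarrow> carrier R" using a by (simp add: nullfam_def)
  have e: "eventually (\<lambda>F. finsum R a F \<in> carrier R) (finite_subsets_at_top I)"
  proof (rule eventually_finite_subsets_at_top_weakI)
    fix X assume "X \<subseteq> I"
    with ac have "a \<in> X \<rightarrow> carrier R" by blast
    then show "finsum R a X \<in> carrier R" by (rule finsum_closed)
  qed
  have L: "limitin T (\<lambda>F. finsum R a F) l (finite_subsets_at_top I)"
    unfolding limit_iff[OF l(1) e] eventually_finite_subsets_at_top
  proof
    fix U assume U: "U \<in> OS"
    show "\<exists>X. finite X \<and> X \<subseteq> I \<and> (\<forall>Y. finite Y \<and> X \<subseteq> Y \<and> Y \<subseteq> I \<longrightarrow> finsum R a Y \<ominus> l \<in> U)"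
    proof (intro exI conjI allI impI)
      show "finite {i \<in> I. a i \<notin> U}" using a U by (simp add: nullfam_def)
      show "{i \<in> I. a i \<notin> U} \<subseteq> I" by blast
      fix Y assume "finite Y \<and> {i \<in> I. a i \<notin> U} \<subseteq> Y \<and> Y \<subseteq> I"
      then show "finsum R a Y \<ominus> l \<in> U" using l(2)[OF U] by blast
    qed
  qed
  have "tsum a I = l" unfolding top_sum_def
  proof (rule the_equality)
    show "limitin T (\<lambda>F. finsum R a F) l (finite_subsets_at_top I)" by (rule L)
  next
    fix l' assume L': "limitin T (\<lambda>F. finsum R a F) l' (finite_subsets_at_top I)"
    then have "l' \<in> carrier R" using limitin_topspace by fastforce
    then show "l' = l" using tsum_limit_unique[OF ac _ l(1) L' L] by simp
  qed
  then show ?thesis using l L by blast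
qed

lemma tsum_closed: "nullfam a I \<Longrightarrow> tsum a I \<in> carrier R"
  using tsum_limit by blast

lemma tsum_mod: "\<lbrakk>nullfam a I; U \<in> OS; finite F; F \<subseteq> I; \<And>i. i \<in> I \<Longrightarrow> i \<notin> F \<Longrightarrow> a i \<in> U\<rbrakk> \<Longrightarrow> tsum a I \<ominus> finsum R a F \<in> U"
proof -
  assume a: "nullfam a I" "U \<in> OS" "finite F" "F \<subseteq> I" "\<And>i. i \<in> I \<Longrightarrow> i \<notin> F \<Longrightarrow> a i \<in> U"
  have "a \<in> F \<rightarrow> carrier R" using a by (auto simp: nullfam_def)
  then have c: "finsum R a F \<in> carrier R" by (rule finsum_closed)
  from tsum_limit[OF a(1)] have "finsum R a F \<ominus> tsum a I \<in> U" using a by blast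
  then show ?thesis using diff_sym a(2) c tsum_closed[OF a(1)] by blast
qed

lemma nullfamD: "nullfam a I \<Longrightarrow> i \<in> I \<Longrightarrow> a i \<in> carrier R"
  by (auto simp: nullfam_def)

lemma nullfam_fin: "nullfam a I \<Longrightarrow> U \<in> OS \<Longrightarrow> finite {i \<in> I. a i \<notin> U}"
  by (auto simp: nullfam_def)

lemma nullfam_cong: "I = J \<Longrightarrow> (\<And>i. i \<in> J \<Longrightarrow> a i = b i) \<Longrightarrow> nullfam a I = nullfam b J"
proof -
  assume [simp]: "I = J" and *: "\<And>i. i \<in> J \<Longrightarrow> a i = b i"
  have "{i \<in> J. a i \<notin> U} = {i \<in> J. b i \<notin> U}" for U using * by auto
  moreover have "a \<in> J \<rightarrow> carrier R \<longleftrightarrow> b \<in> J \<rightarrow> carrier R" using * by (simp add: Pi_iff)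
  ultimately show ?thesis by (simp add: nullfam_def)
qed

lemma nullfam_subset: "nullfam a I \<Longrightarrow> J \<subseteq> I \<Longrightarrow> nullfam a J"
proof -
  assume a: "nullfam a I" and J: "J \<subseteq> I"
  have "finite {i \<in> J. a i \<notin> U}" if "U \<in> OS" for U
    by (rule finite_subset[OF _ nullfam_fin[OF a that]]) (use J in auto)
  then show ?thesis using a J by (auto simp: nullfam_def)
qed

lemma finsum_diff_OS:
  assumes "U \<in> OS" "\<And>y. y \<in> F \<Longrightarrow> s y \<in> carrier R" "\<And>y. y \<in> F \<Longrightarrow> t y \<in> carrier R" "\<And>y. y \<in> F \<Longrightarrow> s y \<ominus> t y \<in> U"
  shows "finsum R s F \<ominus> finsum R t F \<in> U"
  using assms(2-)
proof (induction F rule: infinite_finite_induct)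
  case (insert x F)
  have c: "s x \<in> carrier R" "t x \<in> carrier R" "finsum R s F \<in> carrier R" "finsum R t F \<in> carrier R"
    using insert.prems by (auto intro!: finsum_closed)
  have e: "finsum R s (insert x F) = s x \<oplus> finsum R s F" "finsum R t (insert x F) = t x \<oplus> finsum R t F"
    using insert by (auto intro!: finsum_insert)
  have "finsum R s (insert x F) \<ominus> finsum R t (insert x F) = (s x \<ominus> t x) \<oplus> (finsum R s F \<ominus> finsum R t F)"
    unfolding e using c by (simp add: a_minus_def a_ac minus_add)
  moreover have "finsum R s F \<ominus> finsum R t F \<in> U" using insert by simp
  moreover have "s x \<ominus> t x \<in> U" using insert by simp
  ultimately show ?case using OS_add assms(1) by simp
qed (auto simp: a_minus_def OS_zero assms(1))

lemma tsum_eqI: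
  assumes a: "nullfam a I" "l \<in> carrier R"
    and *: "\<And>U. U \<in> ORI \<Longrightarrow> \<exists>F. finite F \<and> F \<subseteq> I \<and> (\<forall>i\<in>I-F. a i \<in> U) \<and> l \<ominus> finsum R a F \<in> U"
  shows "tsum a I = l"
proof (rule eqI)
  fix U assume U: "U \<in> ORI"
  then have U': "U \<in> OS" by (rule ORI_OS)
  obtain F where F: "finite F" "F \<subseteq> I" "\<forall>i\<in>I-F. a i \<in> U" "l \<ominus> finsum R a F \<in> U" using *[OF U] by blast
  have c: "finsum R a F \<in> carrier R" using F nullfamD[OF a(1)] by (intro finsum_closed) auto
  have "tsum a I \<ominus> finsum R a F \<in> U" by (rule tsum_mod) (use a F U' in auto)
  then show "tsum a I \<ominus> l \<in> U" by (rule diff_trans[OF U' _ diff_sym[OF U' F(4)]]) (use a c tsum_closed in auto)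
qed (use a tsum_closed in auto)

lemma tsum_cong: "I = J \<Longrightarrow> (\<And>i. i \<in> J \<Longrightarrow> a i = b i) \<Longrightarrow> nullfam b J \<Longrightarrow> tsum a I = tsum b J"
proof -
  assume [simp]: "I = J" and *: "\<And>i. i \<in> J \<Longrightarrow> a i = b i" and b: "nullfam b J"
  have a: "nullfam a I" using b nullfam_cong[of I J a b] * by auto
  show ?thesis
  proof (rule tsum_eqI[OF a tsum_closed[OF b]])
    fix U assume U: "U \<in> ORI"
    let ?F = "{i \<in> J. b i \<notin> U}"
    have "finsum R a ?F = finsum R b ?F" by (rule finsum_cong') (use * nullfamD[OF b] in auto)
    moreover have "tsum b J \<ominus> finsum R b ?F \<in> U"
      by (rule tsum_mod) (use b U ORI_OS nullfam_fin[OF b] in auto)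
    ultimately show "\<exists>F. finite F \<and> F \<subseteq> I \<and> (\<forall>i\<in>I-F. a i \<in> U) \<and> tsum b J \<ominus> finsum R a F \<in> U"
      using * nullfam_fin[OF b ORI_OS[OF U]] by (intro exI[of _ ?F]) auto
  qed
qed

lemma tsum_finite:
  assumes "F \<subseteq> I" "finite F" "\<And>i. i \<in> F \<Longrightarrow> a i \<in> carrier R" "\<And>i. i \<in> I \<Longrightarrow> i \<notin> F \<Longrightarrow> a i = \<zero>"
  shows "nullfam a I" "tsum a I = finsum R a F"
proof -
  show n: "nullfam a I"
  proof (rule nullfam_ORI)
    show "a \<in> I \<rightarrow> carrier R" using assms(3,4) by fastforce
    fix U assume U: "U \<in> ORI"
    show "finite {i \<in> I. a i \<notin> U}"
      by (rule finite_subset[OF _ assms(2)]) (use assms OS_zero[OF ORI_OS[OF U]] in force)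
  qed
  have c: "finsum R a F \<in> carrier R" using assms(3) by (intro finsum_closed) auto
  show "tsum a I = finsum R a F"
  proof (rule tsum_eqI[OF n c])
    fix U assume U: "U \<in> ORI"
    show "\<exists>F'. finite F' \<and> F' \<subseteq> I \<and> (\<forall>i\<in>I - F'. a i \<in> U) \<and> finsum R a F \<ominus> finsum R a F' \<in> U"
      using assms c OS_zero[OF ORI_OS[OF U]] by (intro exI[of _ F]) (auto simp: a_minus_def r_neg)
  qed
qed

lemma tsum_single:
  assumes "x \<in> I" "a x \<in> carrier R" "\<And>i. i \<in> I \<Longrightarrow> i \<noteq> x \<Longrightarrow> a i = \<zero>"
  shows "nullfam a I" "tsum a I = a x"
  using tsum_finite[of "{x}" I a] assms by auto

lemma tsum_zero:
  assumes "\<And>i. i \<in> I \<Longrightarrow> a i = \<zero>"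
  shows "nullfam a I" "tsum a I = \<zero>"
  using tsum_finite[of "{}" I a] assms by auto

lemma tsum_OS:
  assumes "nullfam a I" "U \<in> OS" "\<And>i. i \<in> I \<Longrightarrow> a i \<in> U"
  shows "tsum a I \<in> U"
proof (rule diff_mem)
  show "tsum a I \<ominus> \<zero> \<in> U" using tsum_mod[of a I U "{}"] assms by auto
qed (use assms tsum_closed OS_zero in auto)

lemma nullfam_diff:
  assumes a: "nullfam a I" and b: "nullfam b I"
  shows "nullfam (\<lambda>i. a i \<ominus> b i) I"
proof (rule nullfam_ORI)
  show "(\<lambda>i. a i \<ominus> b i) \<in> I \<rightarrow> carrier R" using nullfamD[OF a] nullfamD[OF b] by auto
  fix U assume "U \<in> ORI"
  then have U: "U \<in> OS" by (rule ORI_OS)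
  show "finite {i \<in> I. a i \<ominus> b i \<notin> U}"
    by (rule finite_subset[OF _ finite_UnI[OF nullfam_fin[OF a U] nullfam_fin[OF b U]]]) (use OS_diff[OF U] in auto)
qed

lemma finsum_diff:
  assumes "finite F" "\<And>y. y \<in> F \<Longrightarrow> s y \<in> carrier R" "\<And>y. y \<in> F \<Longrightarrow> t y \<in> carrier R"
  shows "finsum R (\<lambda>y. s y \<ominus> t y) F = finsum R s F \<ominus> finsum R t F"
  using assms
proof (induction F rule: finite_induct)
  case (insert x F)
  have c: "s x \<in> carrier R" "t x \<in> carrier R" "finsum R s F \<in> carrier R" "finsum R t F \<in> carrier R"
    using insert.prems by (auto intro!: finsum_closed)
  have e: "finsum R s (insert x F) = s x \<oplus> finsum R s F" "finsum R t (insert x F) = t x \<oplus> finsum R t F"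
    "finsum R (\<lambda>y. s y \<ominus> t y) (insert x F) = (s x \<ominus> t x) \<oplus> finsum R (\<lambda>y. s y \<ominus> t y) F"
    using insert by (auto intro!: finsum_insert)
  have i: "finsum R (\<lambda>y. s y \<ominus> t y) F = finsum R s F \<ominus> finsum R t F" using insert by simp
  show ?case unfolding e i using c by (simp add: a_minus_def a_ac minus_add)
qed (simp add: a_minus_def)

lemma tsum_diff:
  assumes a: "nullfam a I" and b: "nullfam b I"
  shows "tsum (\<lambda>i. a i \<ominus> b i) I = tsum a I \<ominus> tsum b I"
proof (rule tsum_eqI[OF nullfam_diff[OF a b]])
  show "tsum a I \<ominus> tsum b I \<in> carrier R" using tsum_closed[OF a] tsum_closed[OF b] by simp
  fix U assume "U \<in> ORI"
  then have U: "U \<in> OS" by (rule ORI_OS)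
  let ?F = "{i \<in> I. a i \<notin> U} \<union> {i \<in> I. b i \<notin> U}"
  have f: "finite ?F" using nullfam_fin[OF a U] nullfam_fin[OF b U] by simp
  have 1: "tsum a I \<ominus> finsum R a ?F \<in> U" by (rule tsum_mod) (use a U f in auto)
  have 2: "tsum b I \<ominus> finsum R b ?F \<in> U" by (rule tsum_mod) (use b U f in auto)
  have 3: "finsum R (\<lambda>i. a i \<ominus> b i) ?F = finsum R a ?F \<ominus> finsum R b ?F"
    by (rule finsum_diff[OF f]) (use nullfamD[OF a] nullfamD[OF b] in auto)
  have c: "finsum R a ?F \<in> carrier R" "finsum R b ?F \<in> carrier R"
    using nullfamD[OF a] nullfamD[OF b] by (auto intro!: finsum_closed)
  have "tsum a I \<ominus> tsum b I \<ominus> (finsum R a ?F \<ominus> finsum R b ?F)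
    = (tsum a I \<ominus> finsum R a ?F) \<ominus> (tsum b I \<ominus> finsum R b ?F)"
    using c tsum_closed[OF a] tsum_closed[OF b] by (simp add: a_minus_def a_ac minus_add)
  also have "\<dots> \<in> U" using 1 2 OS_diff[OF U] by blast
  finally show "\<exists>F. finite F \<and> F \<subseteq> I \<and> (\<forall>i\<in>I - F. a i \<ominus> b i \<in> U) \<and> 
     tsum a I \<ominus> tsum b I \<ominus> (\<Oplus>i\<in>F. a i \<ominus> b i) \<in> U"
    unfolding 3[symmetric] using f OS_diff[OF U] by (intro exI[of _ ?F]) auto
qed

lemma finsum_fiber:
  assumes "finite B" "finite F" "f ` B \<subseteq> F" "\<And>x. x \<in> B \<Longrightarrow> a x \<in> carrier R"
  shows "finsum R (\<lambda>y. finsum R a {x \<in> B. f x = y}) F = finsum R a B"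
proof -
  have "finsum R a (\<Union>y\<in>F. {x \<in> B. f x = y}) = finsum R (\<lambda>y. finsum R a {x \<in> B. f x = y}) F"
    by (rule add.finprod_UN_disjoint) (use assms in \<open>auto simp: pairwise_def disjnt_def\<close>)
  moreover have "(\<Union>y\<in>F. {x \<in> B. f x = y}) = B" using assms(3) by auto
  ultimately show ?thesis by simp
qed

lemma tsum_fiber:
  assumes a: "nullfam a X" and f: "f \<in> X \<rightarrow> Y"
  shows "nullfam (\<lambda>y. tsum a {x \<in> X. f x = y}) Y" (is "nullfam ?s Y")
    and "tsum (\<lambda>y. tsum a {x \<in> X. f x = y}) Y = tsum a X"
proof -
  have af: "nullfam a {x \<in> X. f x = y}" for y by (rule nullfam_subset[OF a]) auto
  have out: "?s y \<in> U" if "U \<in> OS" "y \<notin> f ` {x \<in> X. a x \<notin> U}" for U y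
    by (rule tsum_OS[OF af]) (use that in auto)
  show n: "nullfam ?s Y"
  proof (rule nullfam_ORI)
    fix U assume "U \<in> ORI"
    then have U: "U \<in> OS" by (rule ORI_OS)
    show "finite {y \<in> Y. ?s y \<notin> U}"
      by (rule finite_subset[OF _ finite_imageI[OF nullfam_fin[OF a U]]]) (use out[OF U] in blast)
  qed (use tsum_closed[OF af] in auto)
  show "tsum ?s Y = tsum a X"
  proof (rule tsum_eqI[OF n tsum_closed[OF a]])
    fix U assume "U \<in> ORI"
    then have U: "U \<in> OS" by (rule ORI_OS)
    let ?B = "{x \<in> X. a x \<notin> U}"
    have fB: "finite ?B" by (rule nullfam_fin[OF a U])
    have 1: "tsum a X \<ominus> finsum R a ?B \<in> U" by (rule tsum_mod) (use a U fB in auto)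
    have c: "finsum R a {x \<in> ?B. f x = y} \<in> carrier R" for y
      using nullfamD[OF a] by (auto intro!: finsum_closed)
    have "finsum R ?s (f ` ?B) \<ominus> finsum R (\<lambda>y. finsum R a {x \<in> ?B. f x = y}) (f ` ?B) \<in> U"
    proof (rule finsum_diff_OS[OF U tsum_closed[OF af] c])
      fix y
      have "finite {x \<in> ?B. f x = y}" by (rule finite_subset[OF _ fB]) blast
      then show "?s y \<ominus> finsum R a {x \<in> ?B. f x = y} \<in> U" by (rule tsum_mod[OF af U]) auto
    qed
    then have 2: "finsum R a ?B \<ominus> finsum R ?s (f ` ?B) \<in> U"
      by (subst (asm) finsum_fiber)
         (use fB nullfamD[OF a] tsum_closed[OF af] in \<open>auto intro!: diff_sym[OF U] finsum_closed\<close>)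
    have "tsum a X \<ominus> finsum R ?s (f ` ?B) \<in> U"
      by (rule diff_trans[OF U 1 2]) (use tsum_closed[OF a] tsum_closed[OF af] nullfamD[OF a] in \<open>auto intro!: finsum_closed\<close>)
    moreover have "f ` ?B \<subseteq> Y" using f by blast
    moreover have "\<forall>y\<in>Y - f ` ?B. ?s y \<in> U" using out[OF U] by blast
    ultimately show "\<exists>F. finite F \<and> F \<subseteq> Y \<and> (\<forall>y\<in>Y-F. ?s y \<in> U) \<and> tsum a X \<ominus> finsum R ?s F \<in> U"
      using fB by (intro exI[of _ "f ` ?B"]) simp
  qed
qed

lemma tsum_reindex:
  assumes a: "nullfam a (h ` I)" and h: "inj_on h I"
  shows "nullfam (\<lambda>i. a (h i)) I" "tsum (\<lambda>i. a (h i)) I = tsum a (h ` I)"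
proof -
  have *: "{i \<in> I. a (h i) \<notin> U} = {i \<in> I. h i \<in> {j \<in> h ` I. a j \<notin> U}}" for U by auto
  show n: "nullfam (\<lambda>i. a (h i)) I"
  proof (rule nullfam_ORI)
    fix U assume "U \<in> ORI"
    then have U: "U \<in> OS" by (rule ORI_OS)
    have "h ` {i \<in> I. a (h i) \<notin> U} \<subseteq> {j \<in> h ` I. a j \<notin> U}" by auto
    then have "finite (h ` {i \<in> I. a (h i) \<notin> U})" by (rule finite_subset[OF _ nullfam_fin[OF a U]])
    then show "finite {i \<in> I. a (h i) \<notin> U}"
      by (rule finite_imageD) (rule inj_on_subset[OF h], blast)
  qed (use nullfamD[OF a] in auto)
  show "tsum (\<lambda>i. a (h i)) I = tsum a (h ` I)"
  proof (rule tsum_eqI[OF n tsum_closed[OF a]])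
    fix U assume "U \<in> ORI"
    then have U: "U \<in> OS" by (rule ORI_OS)
    let ?F = "{i \<in> I. a (h i) \<notin> U}"
    have f: "finite ?F" using nullfam_fin[OF n U] .
    have "finsum R a (h ` ?F) = finsum R (\<lambda>i. a (h i)) ?F"
      by (rule finsum_reindex) (use nullfamD[OF a] h in \<open>auto simp: inj_on_def\<close>)
    moreover have "tsum a (h ` I) \<ominus> finsum R a (h ` ?F) \<in> U"
      by (rule tsum_mod) (use a U f in auto)
    ultimately show "\<exists>F. finite F \<and> F \<subseteq> I \<and> (\<forall>i\<in>I-F. a (h i) \<in> U) \<and> tsum a (h ` I) \<ominus> (\<Oplus>i\<in>F. a (h i)) \<in> U"
      using f by (intro exI[of _ ?F]) auto
  qed
qed

lemma FC_iff: "r \<in> FC X \<longleftrightarrow> nullfam r X \<and> r \<in> extensional X"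
  by (auto simp: formal_combs_def nullfam_def PiE_def)

lemma FC_nullfam: "r \<in> FC X \<Longrightarrow> nullfam r X"
  by (simp add: FC_iff)

lemma FC_eqI: "\<lbrakk>r \<in> FC X; s \<in> FC X; \<And>x. x \<in> X \<Longrightarrow> r x = s x\<rbrakk> \<Longrightarrow> r = s"
  by (auto simp: FC_iff intro: extensionalityI)

lemma FC_D: "r \<in> FC X \<Longrightarrow> x \<in> X \<Longrightarrow> r x \<in> carrier R"
  by (auto simp: FC_iff nullfamD)

lemma restrict_FC: "nullfam r X \<Longrightarrow> (\<lambda>x\<in>X. r x) \<in> FC X"
  using nullfam_cong[of X X "\<lambda>x\<in>X. r x" r] by (simp add: FC_iff)

lemma cmap_FC: "r \<in> FC X \<Longrightarrow> f \<in> X \<rightarrow> Y \<Longrightarrow> cmap X Y f r \<in> FC Y"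
  unfolding comb_map_def by (rule restrict_FC, rule tsum_fiber(1)) (auto simp: FC_nullfam)

lemma cmap_cong: "(\<And>x. x \<in> X \<Longrightarrow> f x = g x) \<Longrightarrow> cmap X Y f r = cmap X Y g r"
proof -
  assume *: "\<And>x. x \<in> X \<Longrightarrow> f x = g x"
  have "{x \<in> X. f x = y} = {x \<in> X. g x = y}" for y using * by auto
  then show ?thesis by (simp add: comb_map_def)
qed

lemma cmap_id: "r \<in> FC X \<Longrightarrow> (\<And>x. x \<in> X \<Longrightarrow> f x = x) \<Longrightarrow> cmap X X f r = r"
proof (rule FC_eqI)
  assume r: "r \<in> FC X" and f: "\<And>x. x \<in> X \<Longrightarrow> f x = x"
  show "cmap X X f r \<in> FC X" by (rule cmap_FC[OF r]) (use f in auto)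
  fix x assume x: "x \<in> X"
  have "{z \<in> X. f z = x} = {x}" using f x by auto
  then show "cmap X X f r x = r x"
    using x tsum_single(2)[of x "{x}" r] FC_D[OF r x] by (simp add: comb_map_def)
qed

lemma cmap_comp:
  assumes r: "r \<in> FC X" and f: "f \<in> X \<rightarrow> Y" and g: "g \<in> Y \<rightarrow> Z"
  shows "cmap Y Z g (cmap X Y f r) = cmap X Z (\<lambda>x. g (f x)) r"
proof (rule FC_eqI)
  show "cmap Y Z g (cmap X Y f r) \<in> FC Z" by (rule cmap_FC[OF cmap_FC[OF r f] g])
  show "cmap X Z (\<lambda>x. g (f x)) r \<in> FC Z" by (rule cmap_FC[OF r]) (use f g in auto)
  fix z assume z: "z \<in> Z"
  have n: "nullfam r {x \<in> X. g (f x) = z}" by (rule nullfam_subset[OF FC_nullfam[OF r]]) auto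
  have f': "f \<in> {x \<in> X. g (f x) = z} \<rightarrow> {y \<in> Y. g y = z}" using f by auto
  have "tsum (cmap X Y f r) {y \<in> Y. g y = z}
     = tsum (\<lambda>y. tsum r {x \<in> {x \<in> X. g (f x) = z}. f x = y}) {y \<in> Y. g y = z}"
  proof (rule tsum_cong[OF refl _ tsum_fiber(1)[OF n f']])
    fix y assume y: "y \<in> {y \<in> Y. g y = z}"
    then have "{x \<in> {x \<in> X. g (f x) = z}. f x = y} = {x \<in> X. f x = y}" by auto
    then show "cmap X Y f r y = tsum r {x \<in> {x \<in> X. g (f x) = z}. f x = y}"
      using y by (simp add: comb_map_def)
  qed
  also have "\<dots> = tsum r {x \<in> X. g (f x) = z}" by (rule tsum_fiber(2)[OF n f'])
  finally show "cmap Y Z g (cmap X Y f r) z = cmap X Z (\<lambda>x. g (f x)) r z"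
    using z by (simp add: comb_map_def[of R T Y] comb_map_def[of R T X Z])
qed

lemma unit_FC: "x \<in> X \<Longrightarrow> comb_unit R X x \<in> FC X"
  unfolding comb_unit_def by (rule restrict_FC, rule tsum_single(1)[of x]) auto

lemma cmap_unit:
  assumes x: "x \<in> X" and f: "f \<in> X \<rightarrow> Y"
  shows "cmap X Y f (comb_unit R X x) = comb_unit R Y (f x)"
proof (rule FC_eqI)
  show "cmap X Y f (comb_unit R X x) \<in> FC Y" by (rule cmap_FC[OF unit_FC[OF x] f])
  show "comb_unit R Y (f x) \<in> FC Y" by (rule unit_FC) (use x f in auto)
  fix y assume y: "y \<in> Y"
  show "cmap X Y f (comb_unit R X x) y = comb_unit R Y (f x) y"
  proof (cases "f x = y")
    case True
    then show ?thesis using x y tsum_single(2)[of x "{z \<in> X. f z = y}" "comb_unit R X x"]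
      by (simp add: comb_map_def comb_unit_def)
  next
    case False
    then have "tsum (comb_unit R X x) {z \<in> X. f z = y} = \<zero>"
      by (intro tsum_zero(2)) (auto simp: comb_unit_def)
    then show ?thesis using False y by (simp add: comb_map_def comb_unit_def)
  qed
qed

lemma nullfam_rmult:
  assumes a: "nullfam a I" and b: "\<And>i. i \<in> I \<Longrightarrow> b i \<in> carrier R"
  shows "nullfam (\<lambda>i. a i \<otimes> b i) I"
proof (rule nullfam_ORI)
  fix U assume U: "U \<in> ORI"
  show "finite {i \<in> I. a i \<otimes> b i \<notin> U}"
    by (rule finite_subset[OF _ nullfam_fin[OF a ORI_OS[OF U]]]) (use b ORI_mult[OF U] in auto)
qed (use nullfamD[OF a] b in auto)

lemma nullfam_lmult:
  assumes a: "nullfam a I" and c: "c \<in> carrier R"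
  shows "nullfam (\<lambda>i. c \<otimes> a i) I"
proof (rule nullfam_ORI)
  fix U assume "U \<in> ORI"
  then obtain V where V: "V \<in> ORI" "\<forall>v\<in>V. c \<otimes> v \<in> U" using ORI_mult_left[OF c ORI_OS] by blast
  show "finite {i \<in> I. c \<otimes> a i \<notin> U}"
    by (rule finite_subset[OF _ nullfam_fin[OF a ORI_OS[OF V(1)]]]) (use V(2) in auto)
qed (use nullfamD[OF a] c in auto)

lemma tsum_rmult:
  assumes a: "nullfam a I" and c: "c \<in> carrier R"
  shows "tsum (\<lambda>i. a i \<otimes> c) I = tsum a I \<otimes> c"
proof (rule tsum_eqI[OF nullfam_rmult[OF a c]])
  show "tsum a I \<otimes> c \<in> carrier R" using tsum_closed[OF a] c by simp
  fix U assume U: "U \<in> ORI"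
  let ?F = "{i \<in> I. a i \<notin> U}"
  have f: "finite ?F" by (rule nullfam_fin[OF a ORI_OS[OF U]])
  have "tsum a I \<ominus> finsum R a ?F \<in> U" by (rule tsum_mod) (use a ORI_OS[OF U] f in auto)
  then have "(tsum a I \<ominus> finsum R a ?F) \<otimes> c \<in> U" using ORI_mult[OF U] c by blast
  moreover have "finsum R a ?F \<in> carrier R" using nullfamD[OF a] by (intro finsum_closed) auto
  moreover have "finsum R (\<lambda>i. a i \<otimes> c) ?F = finsum R a ?F \<otimes> c"
    by (rule finsum_ldistr[symmetric]) (use f c nullfamD[OF a] in auto)
  ultimately have "tsum a I \<otimes> c \<ominus> finsum R (\<lambda>i. a i \<otimes> c) ?F \<in> U"
    using tsum_closed[OF a] c by (simp add: a_minus_def l_distr l_minus)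
  then show "\<exists>F. finite F \<and> F \<subseteq> I \<and> (\<forall>i\<in>I - F. a i \<otimes> c \<in> U) \<and> tsum a I \<otimes> c \<ominus> (\<Oplus>i\<in>F. a i \<otimes> c) \<in> U"
    using f ORI_mult[OF U _ c] by (intro exI[of _ ?F]) auto
qed

lemma tsum_lmult:
  assumes a: "nullfam a I" and c: "c \<in> carrier R"
  shows "tsum (\<lambda>i. c \<otimes> a i) I = c \<otimes> tsum a I"
proof (rule tsum_eqI[OF nullfam_lmult[OF a c]])
  show "c \<otimes> tsum a I \<in> carrier R" using tsum_closed[OF a] c by simp
  fix U assume "U \<in> ORI"
  then obtain V where V: "V \<in> ORI" "\<And>v. v \<in> V \<Longrightarrow> c \<otimes> v \<in> U" using ORI_mult_left[OF c ORI_OS] by blast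
  let ?F = "{i \<in> I. a i \<notin> V}"
  have f: "finite ?F" by (rule nullfam_fin[OF a ORI_OS[OF V(1)]])
  have "tsum a I \<ominus> finsum R a ?F \<in> V" by (rule tsum_mod) (use a ORI_OS[OF V(1)] f in auto)
  then have "c \<otimes> (tsum a I \<ominus> finsum R a ?F) \<in> U" by (rule V(2))
  moreover have "finsum R a ?F \<in> carrier R" using nullfamD[OF a] by (intro finsum_closed) auto
  moreover have "finsum R (\<lambda>i. c \<otimes> a i) ?F = c \<otimes> finsum R a ?F"
    by (rule finsum_rdistr[symmetric]) (use f c nullfamD[OF a] in auto)
  ultimately have "c \<otimes> tsum a I \<ominus> finsum R (\<lambda>i. c \<otimes> a i) ?F \<in> U"
    using tsum_closed[OF a] c by (simp add: a_minus_def r_distr r_minus)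
  then show "\<exists>F. finite F \<and> F \<subseteq> I \<and> (\<forall>i\<in>I - F. c \<otimes> a i \<in> U) \<and> c \<otimes> tsum a I \<ominus> (\<Oplus>i\<in>F. c \<otimes> a i) \<in> U"
    using f V(2) by (intro exI[of _ ?F]) auto
qed

lemma nullfam_prod:
  assumes u: "nullfam u I" and w: "\<And>i. i \<in> I \<Longrightarrow> nullfam (w i) J"
  shows "nullfam (\<lambda>(i, j). u i \<otimes> w i j) (I \<times> J)"
proof (rule nullfam_ORI)
  show "(\<lambda>(i, j). u i \<otimes> w i j) \<in> I \<times> J \<rightarrow> carrier R"
    using nullfamD[OF u] nullfamD[OF w] by auto
  fix U assume U: "U \<in> ORI"
  let ?F = "{i \<in> I. u i \<notin> U}"
  have f: "finite ?F" by (rule nullfam_fin[OF u ORI_OS[OF U]])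
  have "finite {j \<in> J. u i \<otimes> w i j \<notin> U}" if "i \<in> I" for i
    by (rule nullfam_fin[OF nullfam_lmult[OF w[OF that] nullfamD[OF u that]] ORI_OS[OF U]])
  then have "finite (SIGMA i:?F. {j \<in> J. u i \<otimes> w i j \<notin> U})" using f by (intro finite_SigmaI) auto
  then show "finite {p \<in> I \<times> J. (case p of (i, j) \<Rightarrow> u i \<otimes> w i j) \<notin> U}"
    by (rule rev_finite_subset) (use ORI_mult[OF U] nullfamD[OF w] in auto)
qed

lemma tsum_swap:
  assumes n: "nullfam (\<lambda>(i, j). c i j) (I \<times> J)"
  shows "tsum (\<lambda>i. tsum (\<lambda>j. c i j) J) I = tsum (\<lambda>j. tsum (\<lambda>i. c i j) I) J"
    and "nullfam (\<lambda>j. tsum (\<lambda>i. c i j) I) J"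
proof -
  let ?c = "\<lambda>(i, j). c i j"
  have 1: "tsum ?c {p \<in> I \<times> J. fst p = i} = tsum (\<lambda>j. c i j) J" if i: "i \<in> I" for i
  proof -
    have e: "{p \<in> I \<times> J. fst p = i} = Pair i ` J" using i by auto
    have "nullfam ?c (Pair i ` J)" by (rule nullfam_subset[OF n]) (use i in auto)
    from tsum_reindex(2)[OF this] show ?thesis by (simp add: e inj_on_def)
  qed
  have 2: "tsum ?c {p \<in> I \<times> J. snd p = j} = tsum (\<lambda>i. c i j) I" if j: "j \<in> J" for j
  proof -
    have e: "{p \<in> I \<times> J. snd p = j} = (\<lambda>i. (i, j)) ` I" using j by auto
    have "nullfam ?c ((\<lambda>i. (i, j)) ` I)" by (rule nullfam_subset[OF n]) (use j in auto)
    from tsum_reindex(2)[OF this] show ?thesis by (simp add: e inj_on_def)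
  qed
  have n2: "nullfam (\<lambda>j. tsum (\<lambda>i. c i j) I) J"
  proof -
    have "nullfam (\<lambda>j. tsum (\<lambda>i. c i j) I) J = nullfam (\<lambda>j. tsum ?c {p \<in> I \<times> J. snd p = j}) J"
      by (rule nullfam_cong[OF refl 2[symmetric]])
    also have \<dots> by (rule tsum_fiber(1)[OF n]) auto
    finally show ?thesis .
  qed
  have fi: "fst \<in> I \<times> J \<rightarrow> I" "snd \<in> I \<times> J \<rightarrow> J" by auto
  have "tsum (\<lambda>i. tsum (\<lambda>j. c i j) J) I = tsum (\<lambda>i. tsum ?c {p \<in> I \<times> J. fst p = i}) I"
    by (rule tsum_cong[OF refl 1[symmetric] tsum_fiber(1)[OF n fi(1)]])
  also have "\<dots> = tsum ?c (I \<times> J)" by (rule tsum_fiber(2)[OF n fi(1)])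
  also have "\<dots> = tsum (\<lambda>j. tsum ?c {p \<in> I \<times> J. snd p = j}) J" by (rule tsum_fiber(2)[OF n fi(2), symmetric])
  also have "\<dots> = tsum (\<lambda>j. tsum (\<lambda>i. c i j) I) J"
    by (rule tsum_cong[OF refl 2 n2])
  finally show "tsum (\<lambda>i. tsum (\<lambda>j. c i j) J) I = tsum (\<lambda>j. tsum (\<lambda>i. c i j) I) J" .
  show "nullfam (\<lambda>j. tsum (\<lambda>i. c i j) I) J" by (rule n2)
qed

lemma tsum_push:
  assumes t: "nullfam t I" and F: "F \<in> I \<rightarrow> J" and z: "\<And>j. j \<in> J \<Longrightarrow> z j \<in> carrier R"
  shows "tsum (\<lambda>j. tsum t {i \<in> I. F i = j} \<otimes> z j) J = tsum (\<lambda>i. t i \<otimes> z (F i)) I"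
proof -
  have n: "nullfam (\<lambda>i. t i \<otimes> z (F i)) I" by (rule nullfam_rmult[OF t]) (use F z in auto)
  have ts: "nullfam t {i \<in> I. F i = j}" for j by (rule nullfam_subset[OF t]) auto
  have "tsum (\<lambda>j. tsum t {i \<in> I. F i = j} \<otimes> z j) J = tsum (\<lambda>j. tsum (\<lambda>i. t i \<otimes> z (F i)) {i \<in> I. F i = j}) J"
  proof (rule tsum_cong[OF refl _ tsum_fiber(1)[OF n F]])
    fix j assume j: "j \<in> J"
    have "tsum t {i \<in> I. F i = j} \<otimes> z j = tsum (\<lambda>i. t i \<otimes> z j) {i \<in> I. F i = j}"
      by (rule tsum_rmult[OF ts z[OF j], symmetric])
    also have "\<dots> = tsum (\<lambda>i. t i \<otimes> z (F i)) {i \<in> I. F i = j}"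
      by (rule tsum_cong) (auto intro: nullfam_subset[OF n])
    finally show "tsum t {i \<in> I. F i = j} \<otimes> z j = tsum (\<lambda>i. t i \<otimes> z (F i)) {i \<in> I. F i = j}" .
  qed
  also have "\<dots> = tsum (\<lambda>i. t i \<otimes> z (F i)) I" by (rule tsum_fiber(2)[OF n F])
  finally show ?thesis .
qed

lemma nullfam_FC_prod: "r \<in> FC (FC X) \<Longrightarrow> nullfam (\<lambda>(y, x). r y \<otimes> y x) (FC X \<times> X)"
  by (rule nullfam_prod) (auto simp: FC_nullfam)

lemma cmult_FC: "r \<in> FC (FC X) \<Longrightarrow> cmult X r \<in> FC X"
  unfolding comb_mult_def by (rule restrict_FC, rule tsum_swap(2)[OF nullfam_FC_prod])

lemma cmult_apply: "x \<in> X \<Longrightarrow> cmult X r x = tsum (\<lambda>y. r y \<otimes> y x) (FC X)"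
  by (simp add: comb_mult_def)

lemma cmult_unit:
  assumes s: "s \<in> FC X"
  shows "cmult X (comb_unit R (FC X) s) = s"
proof (rule FC_eqI[OF cmult_FC[OF unit_FC[OF s]] s])
  fix x assume x: "x \<in> X"
  have "tsum (\<lambda>y. comb_unit R (FC X) s y \<otimes> y x) (FC X) = comb_unit R (FC X) s s \<otimes> s x"
    by (rule tsum_single(2)) (use s FC_D[OF _ x] in \<open>auto simp: comb_unit_def\<close>)
  then show "cmult X (comb_unit R (FC X) s) x = s x"
    using s FC_D[OF s x] by (simp add: cmult_apply[OF x]) (simp add: comb_unit_def)
qed

lemma cmult_assoc:
  assumes u: "u \<in> FC (FC (FC X))"
  shows "cmult X (cmult (FC X) u) = cmult X (cmap (FC (FC X)) (FC X) (cmult X) u)"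
proof (rule FC_eqI)
  show "cmult X (cmult (FC X) u) \<in> FC X" by (intro cmult_FC u)
  show "cmult X (cmap (FC (FC X)) (FC X) (cmult X) u) \<in> FC X"
    by (intro cmult_FC cmap_FC u) (auto intro: cmult_FC)
  fix x assume x: "x \<in> X"
  let ?c = "\<lambda>w y. u w \<otimes> (w y \<otimes> y x)"
  have wn: "nullfam (\<lambda>y. w y \<otimes> y x) (FC X)" if "w \<in> FC (FC X)" for w
    by (rule nullfam_rmult[OF FC_nullfam[OF that]]) (use FC_D[OF _ x] in auto)
  have n: "nullfam (\<lambda>(w, y). ?c w y) (FC (FC X) \<times> FC X)"
    by (rule nullfam_prod[OF FC_nullfam[OF u] wn])
  have "cmult X (cmult (FC X) u) x = tsum (\<lambda>y. tsum (\<lambda>w. ?c w y) (FC (FC X))) (FC X)"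
    unfolding cmult_apply[OF x]
  proof (rule tsum_cong[OF refl _ tsum_swap(2)[OF n]])
    fix y assume y: "y \<in> FC X"
    have m: "nullfam (\<lambda>w. u w \<otimes> w y) (FC (FC X))"
      by (rule nullfam_rmult[OF FC_nullfam[OF u]]) (use FC_D[OF _ y] in auto)
    have m': "nullfam (\<lambda>w. ?c w y) (FC (FC X))"
      by (rule nullfam_rmult[OF FC_nullfam[OF u]]) (use x y FC_D[OF y] FC_D[OF _ y] in auto)
    have "cmult (FC X) u y \<otimes> y x = tsum (\<lambda>w. u w \<otimes> w y \<otimes> y x) (FC (FC X))"
      unfolding cmult_apply[OF y] by (rule tsum_rmult[OF m FC_D[OF y x], symmetric])
    also have "\<dots> = tsum (\<lambda>w. ?c w y) (FC (FC X))"
      by (rule tsum_cong[OF refl _ m']) (use x y FC_D[OF u] FC_D[OF y] FC_D[OF _ y] in \<open>simp add: m_assoc\<close>)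
    finally show "cmult (FC X) u y \<otimes> y x = tsum (\<lambda>w. ?c w y) (FC (FC X))" .
  qed
  also have "\<dots> = tsum (\<lambda>w. tsum (\<lambda>y. ?c w y) (FC X)) (FC (FC X))"
    by (rule tsum_swap(1)[OF n, symmetric])
  also have "\<dots> = tsum (\<lambda>w. u w \<otimes> cmult X w x) (FC (FC X))"
  proof (rule tsum_cong[OF refl])
    fix w assume w: "w \<in> FC (FC X)"
    show "tsum (\<lambda>y. ?c w y) (FC X) = u w \<otimes> cmult X w x"
      unfolding cmult_apply[OF x] by (rule tsum_lmult[OF wn[OF w] FC_D[OF u w]])
  qed (rule nullfam_rmult[OF FC_nullfam[OF u] FC_D[OF cmult_FC x]])
  also have "\<dots> = tsum (\<lambda>y. tsum u {w \<in> FC (FC X). cmult X w = y} \<otimes> y x) (FC X)"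
    by (rule tsum_push[symmetric, where z = "\<lambda>y. y x"])
       (use FC_nullfam[OF u] cmult_FC FC_D[OF _ x] in auto)
  also have "\<dots> = cmult X (cmap (FC (FC X)) (FC X) (cmult X) u) x"
    unfolding cmult_apply[OF x]
    by (rule tsum_cong[OF refl], simp add: comb_map_def, rule nullfam_rmult[OF FC_nullfam[OF cmap_FC[OF u]]])
       (use cmult_FC FC_D[OF _ x] in auto)
  finally show "cmult X (cmult (FC X) u) x = cmult X (cmap (FC (FC X)) (FC X) (cmult X) u) x" .
qed

lemma cmult_natural:
  assumes t: "t \<in> FC (FC X)" and f: "f \<in> X \<rightarrow> Y"
  shows "cmap X Y f (cmult X t) = cmult Y (cmap (FC X) (FC Y) (cmap X Y f) t)"
proof (rule FC_eqI)
  show "cmap X Y f (cmult X t) \<in> FC Y" by (intro cmult_FC cmap_FC t f)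
  have F: "cmap X Y f \<in> FC X \<rightarrow> FC Y" using cmap_FC f by blast
  then show "cmult Y (cmap (FC X) (FC Y) (cmap X Y f) t) \<in> FC Y" by (intro cmult_FC cmap_FC t)
  fix y assume y: "y \<in> Y"
  let ?X = "{x \<in> X. f x = y}"
  have sn: "nullfam s ?X" if "s \<in> FC X" for s by (rule nullfam_subset[OF FC_nullfam[OF that]]) auto
  have n: "nullfam (\<lambda>(s, x). t s \<otimes> s x) (FC X \<times> ?X)"
    by (rule nullfam_prod[OF FC_nullfam[OF t] sn])
  have "cmap X Y f (cmult X t) y = tsum (cmult X t) ?X" using y by (simp add: comb_map_def)
  also have "\<dots> = tsum (\<lambda>x. tsum (\<lambda>s. t s \<otimes> s x) (FC X)) ?X"
    by (rule tsum_cong[OF refl _ tsum_swap(2)[OF n]]) (simp add: cmult_apply)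
  also have "\<dots> = tsum (\<lambda>s. tsum (\<lambda>x. t s \<otimes> s x) ?X) (FC X)" by (rule tsum_swap(1)[OF n, symmetric])
  also have "\<dots> = tsum (\<lambda>s. t s \<otimes> cmap X Y f s y) (FC X)"
  proof (rule tsum_cong[OF refl])
    fix s assume s: "s \<in> FC X"
    show "tsum (\<lambda>x. t s \<otimes> s x) ?X = t s \<otimes> cmap X Y f s y"
      using tsum_lmult[OF sn[OF s] FC_D[OF t s]] y by (simp add: comb_map_def)
  qed (rule nullfam_rmult[OF FC_nullfam[OF t] FC_D[OF funcset_mem[OF F] y]])
  also have "\<dots> = tsum (\<lambda>z. tsum t {s \<in> FC X. cmap X Y f s = z} \<otimes> z y) (FC Y)"
    by (rule tsum_push[symmetric, where z = "\<lambda>z. z y"])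
       (use FC_nullfam[OF t] F FC_D[OF _ y] in auto)
  also have "\<dots> = cmult Y (cmap (FC X) (FC Y) (cmap X Y f) t) y"
    unfolding cmult_apply[OF y]
    by (rule tsum_cong[OF refl], simp add: comb_map_def[of R T "FC X"], rule nullfam_rmult[OF FC_nullfam[OF cmap_FC[OF t F]]])
       (use FC_D[OF _ y] in auto)
  finally show "cmap X Y f (cmult X t) y = cmult Y (cmap (FC X) (FC Y) (cmap X Y f) t) y" .
qed

abbreviation "cunit \<equiv> comb_unit R"
abbreviation "chom \<equiv> contra_hom R T"

lemma act_closed: "contramodule R T C \<Longrightarrow> r \<in> FC (carrier C) \<Longrightarrow> act C r \<in> carrier C"
  by (auto simp: contramodule_def)

lemma act_unit: "contramodule R T C \<Longrightarrow> c \<in> carrier C \<Longrightarrow> act C (cunit (carrier C) c) = c"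
  by (auto simp: contramodule_def)

lemma act_assoc: "contramodule R T C \<Longrightarrow> r \<in> FC (FC (carrier C)) \<Longrightarrow>
    act C (cmult (carrier C) r) = act C (cmap (FC (carrier C)) (carrier C) (act C) r)"
  by (auto simp: contramodule_def)

lemma hom_map: "f \<in> chom A B \<Longrightarrow> f \<in> carrier A \<rightarrow> carrier B"
  by (auto simp: contra_hom_def)

lemma hom_act: "f \<in> chom A B \<Longrightarrow> r \<in> FC (carrier A) \<Longrightarrow> f (act A r) = act B (cmap (carrier A) (carrier B) f r)"
  by (auto simp: contra_hom_def)

lemma hom_comp:
  assumes f: "f \<in> chom A B" and g: "g \<in> chom B C"
  shows "(\<lambda>x. g (f x)) \<in> chom A C"
proof -
  have "g (f (act A r)) = act C (cmap (carrier A) (carrier C) (\<lambda>x. g (f x)) r)" if r: "r \<in> FC (carrier A)" for r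
    using hom_act[OF f r] hom_act[OF g cmap_FC[OF r hom_map[OF f]]] cmap_comp[OF r hom_map[OF f] hom_map[OF g]]
    by simp
  then show ?thesis using hom_map[OF f] hom_map[OF g] by (auto simp: contra_hom_def)
qed

lemma free_contramodule: "contramodule R T (free_contra R T X)"
  unfolding contramodule_def free_contra_def
  using cmult_FC cmult_unit cmult_assoc by auto

lemma act_hom:
  assumes C: "contramodule R T C"
  shows "act C \<in> chom (free_contra R T (carrier C)) C"
  using act_closed[OF C] act_assoc[OF C] by (auto simp: contra_hom_def free_contra_def)

lemma map_hom:
  assumes f: "f \<in> X \<rightarrow> Y"
  shows "cmap X Y f \<in> chom (free_contra R T X) (free_contra R T Y)"
  using cmap_FC[OF _ f] cmult_natural[OF _ f] by (auto simp: contra_hom_def free_contra_def)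

lemma surj_epi: "p \<in> chom B (C :: ('d, 'a) contra) \<Longrightarrow> p ` carrier B = carrier C \<Longrightarrow> contra_epi R T B C p"
proof -
  assume p: "p \<in> chom B C" and s: "p ` carrier B = carrier C"
  have "u c = v c" if "\<forall>b\<in>carrier B. u (p b) = v (p b)" and "c \<in> carrier C" for u v :: "'d \<Rightarrow> 'd" and c
    using that s by (metis imageE)
  then show ?thesis unfolding contra_epi_def using p by blast
qed

lemma contramodule_retract:
  fixes B :: "('b, 'a) contra" and D :: "'d set"
  assumes B: "contramodule R T B" and q: "q \<in> carrier B \<rightarrow> D" and s: "s \<in> D \<rightarrow> carrier B"
    and qs: "\<And>d. d \<in> D \<Longrightarrow> q (s d) = d"
    and compat: "\<And>t. t \<in> FC (carrier B) \<Longrightarrow>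
      q (act B t) = q (act B (cmap (carrier B) (carrier B) (\<lambda>b. s (q b)) t))"
  defines "DD \<equiv> \<lparr>carrier = D, act = \<lambda>t. q (act B (cmap D (carrier B) s t))\<rparr>"
  shows "contramodule R T DD" "q \<in> chom B DD"
proof -
  let ?B = "carrier B"
  let ?M = "cmap D ?B s" and ?N = "cmap ?B D q"
  have [simp]: "carrier DD = D" by (simp add: DD_def)
  have a: "act DD t = q (act B (?M t))" for t by (simp add: DD_def)
  have M: "?M \<in> FC D \<rightarrow> FC ?B" using cmap_FC[OF _ s] by blast
  have N: "?N \<in> FC ?B \<rightarrow> FC D" using cmap_FC[OF _ q] by blast
  have ac: "act B \<in> FC ?B \<rightarrow> ?B" using act_closed[OF B] by blast
  have adc: "act DD \<in> FC D \<rightarrow> D" unfolding a using M ac q by fastforce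
  have h: "q (act B t) = act DD (?N t)" if t: "t \<in> FC ?B" for t
    unfolding a cmap_comp[OF t q s] by (rule compat[OF t])
  then show "q \<in> chom B DD" using q by (auto simp: contra_hom_def)
  have u: "act DD (cunit D d) = d" if d: "d \<in> D" for d
    unfolding a cmap_unit[OF d s] using act_unit[OF B funcset_mem[OF s d]] qs[OF d] by simp
  have "act DD (cmult D t) = act DD (cmap (FC D) D (act DD) t)" if t: "t \<in> FC (FC D)" for t
  proof -
    define t' where "t' = cmap (FC D) (FC ?B) ?M t"
    have t': "t' \<in> FC (FC ?B)" unfolding t'_def by (rule cmap_FC[OF t M])
    have NM: "?N (?M r) = r" if r: "r \<in> FC D" for r
      unfolding cmap_comp[OF r s q] by (rule cmap_id[OF r qs])
    have tt: "t = cmap (FC ?B) (FC D) ?N t'"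
      unfolding t'_def cmap_comp[OF t M N] using cmap_id[OF t NM] by simp
    have qa: "(\<lambda>r. q (act B r)) \<in> FC ?B \<rightarrow> D" using q ac by auto
    have "act DD (cmult D t) = act DD (?N (cmult ?B t'))"
      by (subst tt) (simp add: cmult_natural[OF t' q])
    also have "\<dots> = q (act B (cmult ?B t'))" by (rule h[OF cmult_FC[OF t'], symmetric])
    also have "\<dots> = q (act B (cmap (FC ?B) ?B (act B) t'))" by (simp add: act_assoc[OF B t'])
    also have "\<dots> = act DD (?N (cmap (FC ?B) ?B (act B) t'))" by (rule h[OF cmap_FC[OF t' ac]])
    also have "?N (cmap (FC ?B) ?B (act B) t') = cmap (FC ?B) D (\<lambda>r. q (act B r)) t'"
      by (rule cmap_comp[OF t' ac q])
    also have "\<dots> = cmap (FC ?B) D (\<lambda>r. act DD (?N r)) t'" by (rule cmap_cong) (rule h)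
    also have "\<dots> = cmap (FC D) D (act DD) (cmap (FC ?B) (FC D) ?N t')"
      by (rule cmap_comp[OF t' N adc, symmetric])
    also have "\<dots> = cmap (FC D) D (act DD) t" by (simp add: tt[symmetric])
    finally show ?thesis .
  qed
  then show "contramodule R T DD" using adc u by (simp add: contramodule_def)
qed

definition cdiff :: "'x set \<Rightarrow> ('x \<Rightarrow> 'a) \<Rightarrow> ('x \<Rightarrow> 'a) \<Rightarrow> 'x \<Rightarrow> 'a" where
  "cdiff X n m = (\<lambda>x\<in>X. n x \<ominus> m x)"

definition czero :: "'x set \<Rightarrow> 'x \<Rightarrow> 'a" where
  "czero X = (\<lambda>x\<in>X. \<zero>)"

lemma cdiff_FC: "n \<in> FC X \<Longrightarrow> m \<in> FC X \<Longrightarrow> cdiff X n m \<in> FC X"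
  unfolding cdiff_def by (intro restrict_FC nullfam_diff FC_nullfam)

lemma czero_FC: "czero X \<in> FC X"
  unfolding czero_def by (rule restrict_FC, rule tsum_zero(1)) auto

lemma cmap_diff:
  assumes n: "n \<in> FC X" and m: "m \<in> FC X" and f: "f \<in> X \<rightarrow> Y"
  shows "cmap X Y f (cdiff X n m) = cdiff Y (cmap X Y f n) (cmap X Y f m)"
proof (rule FC_eqI)
  show "cmap X Y f (cdiff X n m) \<in> FC Y" by (intro cmap_FC cdiff_FC n m f)
  show "cdiff Y (cmap X Y f n) (cmap X Y f m) \<in> FC Y" by (intro cmap_FC cdiff_FC n m f)
  fix y assume y: "y \<in> Y"
  let ?X = "{x \<in> X. f x = y}"
  have s: "nullfam n ?X" "nullfam m ?X"
    using nullfam_subset[OF FC_nullfam[OF n], of ?X] nullfam_subset[OF FC_nullfam[OF m], of ?X] by auto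
  have "tsum (cdiff X n m) ?X = tsum (\<lambda>x. n x \<ominus> m x) ?X"
    by (rule tsum_cong[OF refl _ nullfam_diff[OF s]]) (simp add: cdiff_def)
  also have "\<dots> = tsum n ?X \<ominus> tsum m ?X" by (rule tsum_diff[OF s])
  finally show "cmap X Y f (cdiff X n m) y = cdiff Y (cmap X Y f n) (cmap X Y f m) y"
    using y by (simp add: comb_map_def cdiff_def)
qed

lemma cmult_diff:
  assumes n: "n \<in> FC (FC X)" and m: "m \<in> FC (FC X)"
  shows "cmult X (cdiff (FC X) n m) = cdiff X (cmult X n) (cmult X m)"
proof (rule FC_eqI)
  show "cmult X (cdiff (FC X) n m) \<in> FC X" by (intro cmult_FC cdiff_FC n m)
  show "cdiff X (cmult X n) (cmult X m) \<in> FC X" by (intro cmult_FC cdiff_FC n m)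
  fix x assume x: "x \<in> X"
  have s: "nullfam (\<lambda>y. n y \<otimes> y x) (FC X)" "nullfam (\<lambda>y. m y \<otimes> y x) (FC X)"
    by (rule nullfam_rmult[OF FC_nullfam[OF n] FC_D[OF _ x]], simp)
       (rule nullfam_rmult[OF FC_nullfam[OF m] FC_D[OF _ x]], simp)
  have "tsum (\<lambda>y. cdiff (FC X) n m y \<otimes> y x) (FC X) = tsum (\<lambda>y. n y \<otimes> y x \<ominus> m y \<otimes> y x) (FC X)"
  proof (rule tsum_cong[OF refl _ nullfam_diff[OF s]])
    fix y assume y: "y \<in> FC X"
    show "cdiff (FC X) n m y \<otimes> y x = n y \<otimes> y x \<ominus> m y \<otimes> y x"
      using y FC_D[OF n y] FC_D[OF m y] FC_D[OF y x] by (simp add: cdiff_def a_minus_def l_distr l_minus)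
  qed
  also have "\<dots> = cmult X n x \<ominus> cmult X m x" unfolding cmult_apply[OF x] by (rule tsum_diff[OF s])
  finally show "cmult X (cdiff (FC X) n m) x = cdiff X (cmult X n) (cmult X m) x"
    using x by (simp add: cmult_apply cdiff_def[of X])
qed

lemma act_diff:
  assumes B: "contramodule R T B" and n: "n \<in> FC (carrier B)" and m: "m \<in> FC (carrier B)"
  shows "act B (cdiff (carrier B) n m)
    = act B (cdiff (carrier B) (cunit (carrier B) (act B n)) (cunit (carrier B) (act B m)))"
proof -
  let ?B = "carrier B"
  let ?u = "cdiff (FC ?B) (cunit (FC ?B) n) (cunit (FC ?B) m)"
  have u: "?u \<in> FC (FC ?B)" by (intro cdiff_FC unit_FC n m)
  have ac: "act B \<in> FC ?B \<rightarrow> ?B" using act_closed[OF B] by blast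
  show ?thesis
    using act_assoc[OF B u] cmult_diff[OF unit_FC[OF n] unit_FC[OF m]] cmult_unit[OF n] cmult_unit[OF m]
      cmap_diff[OF unit_FC[OF n] unit_FC[OF m] ac] cmap_unit[OF n ac] cmap_unit[OF m ac]
    by simp
qed

lemma cmult_cmap_unit:
  assumes t: "t \<in> FC X" and g: "g \<in> X \<rightarrow> Y" and y: "y \<in> Y"
  shows "tsum (\<lambda>x. t x \<otimes> cunit Y (g x) y) X = cmap X Y g t y"
proof -
  let ?c = "\<lambda>x. t x \<otimes> cunit Y (g x) y"
  have n: "nullfam ?c X"
    by (rule nullfam_rmult[OF FC_nullfam[OF t]]) (use y in \<open>auto simp: comb_unit_def\<close>)
  have tn: "nullfam t {x \<in> X. g x = y}" by (rule nullfam_subset[OF FC_nullfam[OF t]]) auto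
  have e: "tsum ?c {x \<in> X. g x = y} = tsum t {x \<in> X. g x = y}"
    by (rule tsum_cong[OF refl _ tn]) (use y FC_D[OF t] in \<open>auto simp: comb_unit_def\<close>)
  have "tsum ?c X = tsum (\<lambda>z. tsum ?c {x \<in> X. g x = z}) Y"
    by (rule tsum_fiber(2)[OF n g, symmetric])
  also have "\<dots> = tsum ?c {x \<in> X. g x = y}"
  proof (rule tsum_single(2)[OF y])
    show "tsum ?c {x \<in> X. g x = y} \<in> carrier R" unfolding e by (rule tsum_closed[OF tn])
    fix z assume "z \<in> Y" "z \<noteq> y"
    then show "tsum ?c {x \<in> X. g x = z} = \<zero>"
      by (intro tsum_zero(2)) (use y FC_D[OF t] in \<open>auto simp: comb_unit_def\<close>)
  qed
  finally show ?thesis using y e by (simp add: comb_map_def)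
qed

lemma cmult_cmap:
  assumes t: "t \<in> FC X" and w: "w \<in> X \<rightarrow> FC Y" and y: "y \<in> Y"
  shows "cmult Y (cmap X (FC Y) w t) y = tsum (\<lambda>x. t x \<otimes> w x y) X"
proof -
  have "cmult Y (cmap X (FC Y) w t) y = tsum (\<lambda>z. tsum t {x \<in> X. w x = z} \<otimes> z y) (FC Y)"
    unfolding cmult_apply[OF y]
    by (rule tsum_cong[OF refl, symmetric, THEN sym], simp add: comb_map_def[of R T X],
        rule nullfam_cong[THEN iffD1, OF refl _ nullfam_rmult[OF FC_nullfam[OF cmap_FC[OF t w]] FC_D[OF _ y]]])
       (auto simp: comb_map_def[of R T X])
  also have "\<dots> = tsum (\<lambda>x. t x \<otimes> w x y) X"
    by (rule tsum_push[OF FC_nullfam[OF t] w, where z = "\<lambda>z. z y"]) (rule FC_D[OF _ y])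
  finally show ?thesis .
qed

lemma cdiff_unit_act:
  assumes t: "t \<in> FC X" and g: "g \<in> X \<rightarrow> X"
  shows "cmult X (cmap X (FC X) (\<lambda>x. cdiff X (cunit X x) (cunit X (g x))) t) = cdiff X t (cmap X X g t)"
    (is "cmult X (cmap X (FC X) ?w t) = _")
proof (rule FC_eqI)
  have w: "?w \<in> X \<rightarrow> FC X" using g by (auto intro!: cdiff_FC unit_FC)
  show "cmult X (cmap X (FC X) ?w t) \<in> FC X" by (intro cmult_FC cmap_FC t w)
  show "cdiff X t (cmap X X g t) \<in> FC X" by (intro cdiff_FC cmap_FC t g)
  fix y assume y: "y \<in> X"
  have n: "nullfam (\<lambda>x. t x \<otimes> cunit X x y) X" "nullfam (\<lambda>x. t x \<otimes> cunit X (g x) y) X"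
    by (rule nullfam_rmult[OF FC_nullfam[OF t]], use y in \<open>simp add: comb_unit_def\<close>)+
  have "cmult X (cmap X (FC X) ?w t) y = tsum (\<lambda>x. t x \<otimes> ?w x y) X" by (rule cmult_cmap[OF t w y])
  also have "\<dots> = tsum (\<lambda>x. t x \<otimes> cunit X x y \<ominus> t x \<otimes> cunit X (g x) y) X"
  proof (rule tsum_cong[OF refl _ nullfam_diff[OF n]])
    fix x assume x: "x \<in> X"
    have "cunit X x y \<in> carrier R" "cunit X (g x) y \<in> carrier R" using y by (auto simp: comb_unit_def)
    then show "t x \<otimes> ?w x y = t x \<otimes> cunit X x y \<ominus> t x \<otimes> cunit X (g x) y"
      using y FC_D[OF t x] by (simp add: cdiff_def a_minus_def r_distr r_minus)
  qed
  also have "\<dots> = tsum (\<lambda>x. t x \<otimes> cunit X x y) X \<ominus> tsum (\<lambda>x. t x \<otimes> cunit X (g x) y) X"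
    by (rule tsum_diff[OF n])
  also have "tsum (\<lambda>x. t x \<otimes> cunit X x y) X = t y"
    using cmult_cmap_unit[OF t, of "\<lambda>x. x" X y] cmap_id[OF t, of "\<lambda>x. x"] y by simp
  also have "tsum (\<lambda>x. t x \<otimes> cunit X (g x) y) X = cmap X X g t y" by (rule cmult_cmap_unit[OF t g y])
  also have "t y \<ominus> cmap X X g t y = cdiff X t (cmap X X g t) y" using y by (simp add: cdiff_def)
  finally show "cmult X (cmap X (FC X) ?w t) y = cdiff X t (cmap X X g t) y" .
qed

lemma epi_surj:
  fixes A :: "('b, 'a) contra" and B :: "('c, 'a) contra"
  assumes A: "contramodule R T A" and B: "contramodule R T B" and epi: "contra_epi R T A B f"
  shows "f ` carrier A = carrier B"
proof -
  let ?A = "carrier A" and ?B = "carrier B"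
  let ?e = "cunit ?B"
  have f: "f \<in> chom A B" using epi by (simp add: contra_epi_def)
  have fm: "f \<in> ?A \<rightarrow> ?B" by (rule hom_map[OF f])
  define N where "N = {n \<in> FC ?B. act B n \<in> f ` ?A}"
  have eN: "?e (f a) \<in> N" if "a \<in> ?A" for a
  proof -
    have "f a \<in> ?B" using that fm by blast
    then show ?thesis using that act_unit[OF B] unit_FC by (simp add: N_def)
  qed
  have Nd: "cdiff ?B n m \<in> N" if "n \<in> N" "m \<in> N" for n m
  proof -
    have "act B n \<in> f ` ?A" "act B m \<in> f ` ?A" using that by (simp_all add: N_def)
    then obtain a a' where a: "a \<in> ?A" "a' \<in> ?A" "act B n = f a" "act B m = f a'" by (metis imageE)
    let ?t = "cdiff ?A (cunit ?A a) (cunit ?A a')"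
    have t: "?t \<in> FC ?A" by (intro cdiff_FC unit_FC a)
    have "act B (cdiff ?B n m) = act B (cdiff ?B (?e (f a)) (?e (f a')))"
      using act_diff[OF B, of n m] that a by (simp add: N_def)
    also have "\<dots> = f (act A ?t)"
      unfolding hom_act[OF f t] cmap_diff[OF unit_FC[OF a(1)] unit_FC[OF a(2)] fm]
        cmap_unit[OF a(1) fm] cmap_unit[OF a(2) fm] ..
    finally show ?thesis using act_closed[OF A t] that cdiff_FC by (auto simp: N_def)
  qed
  define a0 where "a0 = act A (czero ?A)"
  have a0: "a0 \<in> ?A" unfolding a0_def by (rule act_closed[OF A czero_FC])
  define b0 where "b0 = f a0"
  have b0: "b0 \<in> ?B" using fm a0 by (auto simp: b0_def)
  have zz: "cdiff ?B n n = czero ?B" if "n \<in> FC ?B" for n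
    unfolding cdiff_def czero_def by (rule restrict_ext) (use FC_D[OF that] in \<open>simp add: a_minus_def r_neg\<close>)
  have zN: "czero ?B \<in> N" using Nd[OF eN[OF a0] eN[OF a0]] zz unit_FC[OF b0] by (simp add: b0_def)
  have dd: "cdiff ?B (cdiff ?B n k) (cdiff ?B m k) = cdiff ?B n m"
    if "n \<in> FC ?B" "m \<in> FC ?B" "k \<in> FC ?B" for n m k
    unfolding cdiff_def
    by (rule restrict_ext) (use FC_D[OF that(1)] FC_D[OF that(2)] FC_D[OF that(3)] in
        \<open>simp add: a_minus_def a_ac minus_add r_neg r_neg1 r_neg2\<close>)
  have z0: "cdiff ?B n (czero ?B) = n" if "n \<in> FC ?B" for n
    by (rule FC_eqI[OF cdiff_FC[OF that czero_FC] that])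
       (use FC_D[OF that] in \<open>simp add: cdiff_def czero_def a_minus_def\<close>)
  define rel where "rel b c \<longleftrightarrow> cdiff ?B (?e b) (?e c) \<in> N" for b c
  have rel_refl: "rel b b" if "b \<in> ?B" for b using zz[OF unit_FC[OF that]] zN by (simp add: rel_def)
  have rel_eu: "rel b d" if "b \<in> ?B" "c \<in> ?B" "d \<in> ?B" "rel b c" "rel d c" for b c d
    using Nd[OF that(4,5)[unfolded rel_def]] dd[OF unit_FC[OF that(1)] unit_FC[OF that(3)] unit_FC[OF that(2)]]
    by (simp add: rel_def)
  have rel_sym: "rel c b" if "b \<in> ?B" "c \<in> ?B" "rel b c" for b c
    using rel_eu[OF that(2,2,1) rel_refl[OF that(2)] that(3)] .
  define rep where "rep b = (SOME c. c \<in> ?B \<and> rel b c)" for b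
  have rep: "rep b \<in> ?B" "rel b (rep b)" if "b \<in> ?B" for b
    unfolding rep_def using someI_ex[of "\<lambda>c. c \<in> ?B \<and> rel b c"] rel_refl[OF that] that by blast+
  have rep_eq: "rep b = rep c" if "b \<in> ?B" "c \<in> ?B" "rel b c" for b c
  proof -
    have "rel b d \<longleftrightarrow> rel c d" if "d \<in> ?B" for d
      using rel_eu[of b d c] rel_eu[of b c d] rel_eu[of c b d] rel_sym \<open>b \<in> ?B\<close> \<open>c \<in> ?B\<close> \<open>rel b c\<close> that by meson
    then have "(\<lambda>d. d \<in> ?B \<and> rel b d) = (\<lambda>d. d \<in> ?B \<and> rel c d)" by blast
    then show ?thesis unfolding rep_def by simp
  qed
  have rel_act: "rel (act B t) (act B (cmap ?B ?B rep t))" if t: "t \<in> FC ?B" for t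
  proof -
    have rm: "rep \<in> ?B \<rightarrow> ?B" using rep by blast
    let ?w = "\<lambda>b. cdiff ?B (?e b) (?e (rep b))"
    have w: "?w \<in> ?B \<rightarrow> FC ?B" using rep by (auto intro!: cdiff_FC unit_FC)
    have "\<forall>b\<in>?B. \<exists>a\<in>?A. f a = act B (?w b)"
      using rep(2) by (force simp: rel_def N_def)
    then obtain h where h: "\<And>b. b \<in> ?B \<Longrightarrow> h b \<in> ?A \<and> f (h b) = act B (?w b)" by metis
    have hm: "h \<in> ?B \<rightarrow> ?A" using h by blast
    have am: "act B \<in> FC ?B \<rightarrow> ?B" using act_closed[OF B] by blast
    have "f (act A (cmap ?B ?A h t)) = act B (cmap ?A ?B f (cmap ?B ?A h t))"
      by (rule hom_act[OF f cmap_FC[OF t hm]])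
    also have "cmap ?A ?B f (cmap ?B ?A h t) = cmap ?B ?B (\<lambda>b. f (h b)) t" by (rule cmap_comp[OF t hm fm])
    also have "\<dots> = cmap ?B ?B (\<lambda>b. act B (?w b)) t" by (rule cmap_cong) (use h in simp)
    also have "\<dots> = cmap (FC ?B) ?B (act B) (cmap ?B (FC ?B) ?w t)" by (rule cmap_comp[OF t w am, symmetric])
    also have "act B \<dots> = act B (cmult ?B (cmap ?B (FC ?B) ?w t))"
      by (rule act_assoc[OF B cmap_FC[OF t w], symmetric])
    also have "\<dots> = act B (cdiff ?B t (cmap ?B ?B rep t))" by (simp add: cdiff_unit_act[OF t rm])
    also have "\<dots> = act B (cdiff ?B (?e (act B t)) (?e (act B (cmap ?B ?B rep t))))"
      by (rule act_diff[OF B t cmap_FC[OF t rm]])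
    finally have "act B (cdiff ?B (?e (act B t)) (?e (act B (cmap ?B ?B rep t)))) \<in> f ` ?A"
      using act_closed[OF A cmap_FC[OF t hm]] by (metis imageI)
    moreover have "cdiff ?B (?e (act B t)) (?e (act B (cmap ?B ?B rep t))) \<in> FC ?B"
      by (intro cdiff_FC unit_FC act_closed[OF B] t cmap_FC rm)
    ultimately show ?thesis by (simp add: rel_def N_def)
  qed
  have rr: "rep (rep b) = rep b" if "b \<in> ?B" for b
    using rep_eq[OF that rep(1)[OF that] rep(2)[OF that]] by simp
  define D where "D = \<lparr>carrier = rep ` ?B, act = \<lambda>t. rep (act B (cmap (rep ` ?B) ?B (\<lambda>x. x) t))\<rparr>"
  have rm: "rep \<in> ?B \<rightarrow> ?B" using rep by blast
  have DD: "contramodule R T D" "rep \<in> chom B D"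
    unfolding D_def
    by (rule contramodule_retract[OF B], use rep rr in auto,
        rule rep_eq[OF _ _ rel_act], use act_closed[OF B] cmap_FC[OF _ rm] in auto)+
  have zero_hom: "(\<lambda>_. b0) \<in> chom B B"
  proof -
    have zB: "b0 = act B (czero ?B)"
    proof -
      have "cmap ?A ?B f (czero ?A) = czero ?B"
      proof (rule FC_eqI[OF cmap_FC[OF czero_FC fm] czero_FC])
        fix y assume y: "y \<in> ?B"
        have "tsum (czero ?A) {x \<in> ?A. f x = y} = \<zero>" by (rule tsum_zero(2)) (simp add: czero_def)
        then show "cmap ?A ?B f (czero ?A) y = czero ?B y" using y by (simp add: comb_map_def czero_def[of ?B])
      qed
      then show ?thesis unfolding b0_def a0_def hom_act[OF f czero_FC] by simp
    qed
    have am: "act B \<in> FC ?B \<rightarrow> ?B" using act_closed[OF B] by blast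
    have zm: "(\<lambda>_. czero ?B) \<in> ?B \<rightarrow> FC ?B" using czero_FC by blast
    have "act B (cmap ?B ?B (\<lambda>_. b0) t) = b0" if t: "t \<in> FC ?B" for t
    proof -
      have m: "cmult ?B (cmap ?B (FC ?B) (\<lambda>_. czero ?B) t) = czero ?B"
      proof (rule FC_eqI[OF cmult_FC[OF cmap_FC[OF t zm]] czero_FC])
        fix y assume y: "y \<in> ?B"
        show "cmult ?B (cmap ?B (FC ?B) (\<lambda>_. czero ?B) t) y = czero ?B y"
          unfolding cmult_cmap[OF t zm y]
          using y FC_D[OF t] by (subst tsum_zero(2)) (auto simp: czero_def)
      qed
      have "cmap ?B ?B (\<lambda>_. b0) t = cmap (FC ?B) ?B (act B) (cmap ?B (FC ?B) (\<lambda>_. czero ?B) t)"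
        unfolding zB by (rule cmap_comp[OF t zm am, symmetric])
      then show ?thesis using act_assoc[OF B cmap_FC[OF t zm]] m zB by simp
    qed
    then show ?thesis using b0 by (auto simp: contra_hom_def)
  qed
  have eq: "rep (f a) = rep b0" if a: "a \<in> ?A" for a
    using Nd[OF eN[OF a] eN[OF a0]] fm a b0 by (intro rep_eq) (auto simp: rel_def b0_def)
  have "rep b = rep b0" if b: "b \<in> ?B" for b
    using epi DD hom_comp[OF zero_hom DD(2)] eq b unfolding contra_epi_def by blast
  then have rel0: "rel b b0" if b: "b \<in> ?B" for b
    using rel_eu[OF b rep(1)[OF b0] b0] rep(2)[OF b] rep(2)[OF b0] b by simp
  have "b \<in> f ` ?A" if b: "b \<in> ?B" for b
  proof -
    have "cdiff ?B (cdiff ?B (?e b) (?e b0)) (cdiff ?B (czero ?B) (?e b0)) \<in> N"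
      using Nd[OF rel0[OF b, unfolded rel_def] Nd[OF zN eN[OF a0]]] by (simp add: b0_def)
    then have "?e b \<in> N"
      using dd[OF unit_FC[OF b] czero_FC unit_FC[OF b0]] z0[OF unit_FC[OF b]] by simp
    then show ?thesis using act_unit[OF B b] by (simp add: N_def)
  qed
  then show ?thesis using fm by blast
qed

lemma contra_epi_iff_surj:
  assumes "contramodule R T A" and "contramodule R T B"
  shows "contra_epi R T A B f \<longleftrightarrow> f \<in> contra_hom R T A B \<and> f ` carrier A = carrier B"
proof
  assume "contra_epi R T A B f"
  then show "f \<in> contra_hom R T A B \<and> f ` carrier A = carrier B"
    using epi_surj[OF assms] by (simp add: contra_epi_def)
qed (simp add: surj_epi)

lemma contra_projective_lift:
  fixes P :: "('p, 'a) contra" and A :: "('u, 'a) contra" and B :: "('v, 'a) contra"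
  assumes P: "contra_projective R T P" and A: "contramodule R T A" and B: "contramodule R T B"
    and g: "contra_epi R T A B g" and f: "f \<in> contra_hom R T P B"
  shows "\<exists>h\<in>contra_hom R T P A. \<forall>x\<in>carrier P. g (h x) = f x"
proof -
  let ?P = "carrier P" and ?F = "free_contra R T (carrier P)"
  have P': "contramodule R T P" using P by (simp add: contra_projective_def)
  have Fc: "carrier ?F = FC ?P" by (simp add: free_contra_def)
  have "act P ` carrier ?F = ?P"
  proof
    show "act P ` carrier ?F \<subseteq> ?P" using act_closed[OF P'] by (auto simp: Fc)
    show "?P \<subseteq> act P ` carrier ?F"
    proof
      fix x assume x: "x \<in> ?P"
      show "x \<in> act P ` carrier ?F"
        unfolding Fc using act_unit[OF P' x] unit_FC[OF x] by (metis image_eqI)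
    qed
  qed
  then have e: "contra_epi R T ?F P (act P)" by (rule surj_epi[OF act_hom[OF P']])
  have "(\<lambda>x. x) \<in> chom P P"
    using cmap_id[of _ ?P "\<lambda>x. x"] by (auto simp: contra_hom_def)
  then obtain s where s: "s \<in> chom P ?F" "\<forall>x\<in>?P. act P (s x) = x"
    using P free_contramodule[of ?P] P' e unfolding contra_projective_def by blast
  have fm: "f \<in> ?P \<rightarrow> carrier B" by (rule hom_map[OF f])
  have gh: "g \<in> chom A B" using g by (simp add: contra_epi_def)
  have "\<forall>x\<in>?P. \<exists>a\<in>carrier A. g a = f x" using epi_surj[OF A B g] fm by (metis PiE imageE)
  then obtain k where k: "\<And>x. x \<in> ?P \<Longrightarrow> k x \<in> carrier A \<and> g (k x) = f x" by metis
  have km: "k \<in> ?P \<rightarrow> carrier A" using k by blast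
  let ?h = "\<lambda>x. act A (cmap ?P (carrier A) k (s x))"
  have "?h \<in> chom P A" by (rule hom_comp[OF hom_comp[OF s(1) map_hom[OF km]] act_hom[OF A]])
  moreover have "g (?h x) = f x" if x: "x \<in> ?P" for x
  proof -
    have sx: "s x \<in> FC ?P" using hom_map[OF s(1)] x by (auto simp: Fc)
    have "g (?h x) = act B (cmap (carrier A) (carrier B) g (cmap ?P (carrier A) k (s x)))"
      by (rule hom_act[OF gh cmap_FC[OF sx km]])
    also have "\<dots> = act B (cmap ?P (carrier B) (\<lambda>x. g (k x)) (s x))"
      by (simp add: cmap_comp[OF sx km hom_map[OF gh]])
    also have "\<dots> = act B (cmap ?P (carrier B) f (s x))"
      using cmap_cong[of ?P "\<lambda>x. g (k x)" f] k by simp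
    also have "\<dots> = f (act P (s x))" by (rule hom_act[OF f sx, symmetric])
    finally show ?thesis using s(2) x by simp
  qed
  ultimately show ?thesis by (intro bexI[of _ ?h]) simp_all
qed

end

end

theory Submission
  imports Defs "HOL-Algebra.Module"
begin

text \<open>
  Let \<open>F = R[[X]]\<close> with \<open>X = C\<close>, mapping onto \<open>C\<close>, and let \<open>N\<close> be the preimage of \<open>HC\<close> in \<open>F\<close>.
  Modulo \<open>H\<close> the contramodule \<open>F\<close> is a product of semisimple modules over the simple Artinian rings \<open>S\<^sub>\<gamma>\<close>,
  so \<open>N/H[[X]]\<close> is a direct summand: there is an endomorphism \<open>a\<close> of \<open>F\<close> with \<open>x - a x \<in> N\<close> and
  \<open>a N \<subseteq> H[[X]]\<close>, whence \<open>a - a\<^sup>2\<close> has entries in \<open>H\<close>. Endomorphisms of \<open>F\<close> are matrices with rows in \<open>F\<close>, and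
  by T-nilpotency and Koenig's lemma the powers of a matrix with entries in \<open>H\<close> tend to zero.
  Therefore \<open>a\<close> can be replaced by an idempotent \<open>E\<close>, and \<open>1 - A\<close> is invertible for each \<open>A\<close> with entries
  in \<open>H\<close>. The second fact makes the image \<open>P\<close> of \<open>E\<close> surject onto \<open>C\<close> (a form of Nakayama's lemma), and
  shows that an endomorphism \<open>f\<close> of \<open>P\<close> over \<open>C\<close> is invertible, as \<open>E - f E\<close> has entries in \<open>H\<close>.
\<close>

section \<open>Sequentially complete rings\<close>

text \<open>\<open>H\<close> need not be open, so the splitting is made modulo each kernel
  \<open>K \<gamma>\<close> of the map from \<open>R\<close> to a simple factor, which is open.
  Modulo an open ideal only finitely many coefficients of a row matter. A complement found by Zorn's
  lemma is a priori only an algebraic submodule, but it is then stable under infinite combinations.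
  The pieces are glued by a null family \<open>r\<close> that lifts the coordinate idempotents of
  the product. Strong closedness provides \<open>r\<close>, and nullity makes the glued sum
  converge.

  Since the base consists of right ideals, a right factor may vary freely in an estimate while a
  left factor has to be fixed. This is why rows belong to the free contramodule, why matrices act
  from the right, and why products of elements of \<open>H\<close> grow to the right. Convergence of
  matrices is uniform along each row but not across rows, so Koenig's lemma is applied to one row at
  a time.

  The element a - a^2 need not be nilpotent: only its powers tend to zero. An idempotent is
  therefore obtained as a limit, for which Newton's iteration supplies the sequence.\<close>

lemma (in abelian_group) add_minus_cancel:
  "\<lbrakk>x \<in> carrier G; y \<in> carrier G\<rbrakk> \<Longrightarrow> x \<oplus> y \<ominus> y = x"
  "\<lbrakk>x \<in> carrier G; y \<in> carrier G\<rbrakk> \<Longrightarrow> x \<ominus> y \<oplus> y = x"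
  by (simp_all add: a_minus_def a_assoc r_neg l_neg)

lemma (in abelian_group) diff_diff_cancel:
  assumes "x \<in> carrier G" "y \<in> carrier G" "z \<in> carrier G"
  shows "(x \<ominus> z) \<ominus> (y \<ominus> z) = x \<ominus> y"
proof -
  have "(x \<ominus> z) \<ominus> (y \<ominus> z) = x \<oplus> (\<ominus> z \<oplus> (z \<oplus> \<ominus> y))"
    using assms a_comm[of "\<ominus> y" z] by (simp add: a_minus_def minus_add a_assoc)
  then show ?thesis using assms by (simp add: a_minus_def r_neg1)
qed

lemma (in abelian_group) diff_diff_self:
  "\<lbrakk>x \<in> carrier G; y \<in> carrier G\<rbrakk> \<Longrightarrow> x \<ominus> (x \<ominus> y) = y"
  by (simp add: a_minus_def minus_add r_neg2)

text \<open>Every condition tests one member of \<open>B\<close> at a time, and only on sequences.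
  Hence \<open>B\<close> may be a mere subbase of the neighbourhoods of zero, and
  \<open>base_complete\<close> concerns only series with null terms. The asymmetry between
  \<open>base_right\<close> and \<open>base_left\<close> is that of a topology given by right
  ideals.\<close>

locale seq_complete_ring = ring M for M :: "('m, 'k) ring_scheme" (structure) +
  fixes B :: "'m set set"
  assumes base_right: "U \<in> B \<Longrightarrow> right_ideal M U"
    and base_left: "\<lbrakk>l \<in> carrier M; \<And>n. s n \<in> carrier M; \<And>U. U \<in> B \<Longrightarrow> \<forall>\<^sub>F n in sequentially. s n \<in> U; U \<in> B\<rbrakk>
      \<Longrightarrow> \<forall>\<^sub>F n in sequentially. l \<otimes> s n \<in> U"
    and base_sep: "\<lbrakk>x \<in> carrier M; \<And>U. U \<in> B \<Longrightarrow> x \<in> U\<rbrakk> \<Longrightarrow> x = \<zero>"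
    and base_complete: "\<lbrakk>\<And>n :: nat. D n \<in> carrier M; \<And>U. U \<in> B \<Longrightarrow> \<forall>\<^sub>F n in sequentially. D n \<in> U\<rbrakk>
      \<Longrightarrow> \<exists>l\<in>carrier M. \<forall>U\<in>B. \<forall>\<^sub>F n in sequentially. finsum M D {..<n} \<ominus> l \<in> U"
begin

lemma add_neg_cancel:
  assumes "x \<in> carrier M" "y \<in> carrier M"
  shows "x \<oplus> (y \<oplus> \<ominus> x) = y" "\<ominus> x \<oplus> (y \<oplus> x) = y"
  using assms a_lcomm[of x y "\<ominus> x"] a_lcomm[of "\<ominus> x" y x] by (simp_all add: r_neg l_neg)

lemma eq_of_diff:
  assumes "x \<in> carrier M" "y \<in> carrier M" "x \<ominus> y = \<zero>" shows "x = y"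
  by (metis assms a_inv_closed a_minus_def minus_equality minus_minus r_neg)

lemma minus_telescope:
  "\<lbrakk>x \<in> carrier M; y \<in> carrier M; z \<in> carrier M\<rbrakk> \<Longrightarrow> (x \<ominus> y) \<oplus> (y \<ominus> z) = x \<ominus> z"
  by (simp add: a_minus_def a_assoc r_neg1 r_neg2)

lemma base_zero: "U \<in> B \<Longrightarrow> \<zero> \<in> U"
  using base_right by (simp add: right_ideal_def additive_subgroup.zero_closed)

lemma base_add: "U \<in> B \<Longrightarrow> x \<in> U \<Longrightarrow> y \<in> U \<Longrightarrow> x \<oplus> y \<in> U"
  using base_right by (simp add: right_ideal_def additive_subgroup.a_closed)

lemma base_neg: "U \<in> B \<Longrightarrow> x \<in> U \<Longrightarrow> \<ominus> x \<in> U"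
  using base_right
  by (metis a_inv_def additive_subgroup.a_subgroup right_ideal_def subgroup.m_inv_closed)

lemma base_mult: "U \<in> B \<Longrightarrow> x \<in> U \<Longrightarrow> r \<in> carrier M \<Longrightarrow> x \<otimes> r \<in> U"
  using base_right by (simp add: right_ideal_def)

section \<open>Null sequences and limits\<close>

definition null :: "(nat \<Rightarrow> 'm) \<Rightarrow> bool" where
  "null s \<longleftrightarrow> (\<forall>n. s n \<in> carrier M) \<and> (\<forall>U\<in>B. \<forall>\<^sub>F n in sequentially. s n \<in> U)"

lemma null_add: "null s \<Longrightarrow> null t \<Longrightarrow> null (\<lambda>n. s n \<oplus> t n)"
  unfolding null_def
  by (fastforce intro: base_add elim: eventually_elim2)

lemma null_neg: "null s \<Longrightarrow> null (\<lambda>n. \<ominus> s n)"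
  unfolding null_def by (fastforce intro: base_neg elim: eventually_mono)

lemma null_mult_right: "null s \<Longrightarrow> (\<And>n. r n \<in> carrier M) \<Longrightarrow> null (\<lambda>n. s n \<otimes> r n)"
  unfolding null_def by (fastforce intro: base_mult elim: eventually_mono)

lemma null_mult_left: "null s \<Longrightarrow> l \<in> carrier M \<Longrightarrow> null (\<lambda>n. l \<otimes> s n)"
  unfolding null_def using base_left by blast

lemma null_const: "null (\<lambda>_. x) \<Longrightarrow> x = \<zero>"
  unfolding null_def using base_sep by (simp add: eventually_const_iff)

lemma null_Suc: "null s \<Longrightarrow> null (\<lambda>n. s (Suc n))"
  using eventually_sequentially_Suc[of "\<lambda>n. s n \<in> _"] unfolding null_def by simp

definition tends :: "(nat \<Rightarrow> 'm) \<Rightarrow> 'm \<Rightarrow> bool" where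
  "tends s l \<longleftrightarrow> (\<forall>n. s n \<in> carrier M) \<and> l \<in> carrier M \<and> null (\<lambda>n. s n \<ominus> l)"

lemma tends_unique:
  assumes "tends s l" "tends s k" shows "l = k"
proof -
  have c: "\<And>n. s n \<in> carrier M" "l \<in> carrier M" "k \<in> carrier M" using assms by (auto simp: tends_def)
  have "null (\<lambda>n. (s n \<ominus> k) \<oplus> (\<ominus> (s n \<ominus> l)))"
    using assms by (intro null_add null_neg) (auto simp: tends_def)
  moreover have "(s n \<ominus> k) \<oplus> (\<ominus> (s n \<ominus> l)) = l \<ominus> k" for n
    using c[of] by (simp add: a_minus_def minus_add a_ac add_neg_cancel r_neg)
  ultimately have "l \<ominus> k = \<zero>" using null_const by simp
  then show ?thesis using c eq_of_diff by blast
qed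

lemma tends_const: "l \<in> carrier M \<Longrightarrow> tends (\<lambda>_. l) l"
  unfolding tends_def null_def by (simp add: r_neg a_minus_def base_zero)

lemma tends_diff:
  assumes "tends s l" "tends t k" shows "tends (\<lambda>n. s n \<ominus> t n) (l \<ominus> k)"
proof -
  have c: "\<And>n. s n \<in> carrier M" "l \<in> carrier M" "k \<in> carrier M" "\<And>n. t n \<in> carrier M"
    using assms by (auto simp: tends_def)
  have "null (\<lambda>n. (s n \<ominus> l) \<oplus> (\<ominus> (t n \<ominus> k)))"
    using assms by (intro null_add null_neg) (auto simp: tends_def)
  moreover have "(s n \<ominus> l) \<oplus> (\<ominus> (t n \<ominus> k)) = (s n \<ominus> t n) \<ominus> (l \<ominus> k)" for n
    using c by (simp add: a_minus_def minus_add a_ac)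
  ultimately show ?thesis using c by (simp add: tends_def)
qed

text \<open>The error is split as (s n - l) t n + l (t n - k). The varying factor \<open>t n\<close>
  stands on the right, where right ideals absorb it, and the left factor \<open>l\<close> is
  constant.\<close>

lemma tends_mult:
  assumes "tends s l" "tends t k" shows "tends (\<lambda>n. s n \<otimes> t n) (l \<otimes> k)"
proof -
  have c: "\<And>n. s n \<in> carrier M" "l \<in> carrier M" "k \<in> carrier M" "\<And>n. t n \<in> carrier M"
    using assms by (auto simp: tends_def)
  have "null (\<lambda>n. (s n \<ominus> l) \<otimes> t n \<oplus> l \<otimes> (t n \<ominus> k))"
    using assms by (intro null_add null_mult_right null_mult_left) (auto simp: tends_def)
  moreover have "(s n \<ominus> l) \<otimes> t n \<oplus> l \<otimes> (t n \<ominus> k) = s n \<otimes> t n \<ominus> l \<otimes> k" for n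
    using c by (simp add: a_minus_def l_distr r_distr l_minus r_minus a_ac add_neg_cancel)
  ultimately show ?thesis using c by (simp add: tends_def)
qed

lemma tends_null: "null s \<Longrightarrow> tends s \<zero>"
  by (simp add: tends_def null_def a_minus_def)

lemma null_series_tends: "null D \<Longrightarrow> \<exists>l. tends (\<lambda>n. finsum M D {..<n}) l"
proof -
  assume D: "null D"
  then have c: "D n \<in> carrier M" for n by (simp add: null_def)
  obtain l where "l \<in> carrier M" "\<forall>U\<in>B. \<forall>\<^sub>F n in sequentially. finsum M D {..<n} \<ominus> l \<in> U"
    using base_complete[of D] D unfolding null_def by blast
  then show ?thesis unfolding tends_def null_def using c by (auto intro!: exI[of _ l] finsum_closed)
qed

text \<open>The inverse is the geometric series. Null terms suffice for its convergence here, and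
  its partial sums telescope against 1 - a on both sides.\<close>

lemma one_minus_invertible:
  assumes a: "a \<in> carrier M" and n: "null (\<lambda>n. a [^] n)"
  shows "\<exists>b\<in>carrier M. b \<otimes> (\<one> \<ominus> a) = \<one> \<and> (\<one> \<ominus> a) \<otimes> b = \<one>"
proof -
  obtain b where b: "tends (\<lambda>n. \<Oplus>k\<in>{..<n}. a [^] k) b" using null_series_tends[OF n] by blast
  have c: "(\<Oplus>k\<in>{..<n}. a [^] k) \<in> carrier M" for n :: nat using a by (auto intro: finsum_closed)
  have 1: "(\<Oplus>k\<in>{..<n}. a [^] k) \<otimes> (\<one> \<ominus> a) = \<one> \<ominus> a [^] n
    \<and> (\<one> \<ominus> a) \<otimes> (\<Oplus>k\<in>{..<n}. a [^] k) = \<one> \<ominus> a [^] n" for n :: nat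
  proof (induction n)
    case 0
    show ?case using a by (simp add: a_minus_def r_neg)
  next
    case (Suc n)
    have s: "(\<Oplus>k\<in>{..<Suc n}. a [^] k) = a [^] n \<oplus> (\<Oplus>k\<in>{..<n}. a [^] k)"
      unfolding lessThan_Suc by (rule finsum_insert) (use a in auto)
    have p: "a \<otimes> a [^] n = a [^] Suc n" using a nat_pow_Suc2 by simp
    have q: "a [^] n \<otimes> a = a [^] Suc n" by simp
    have "a [^] n \<otimes> (\<one> \<ominus> a) = a [^] n \<ominus> a [^] Suc n" "(\<one> \<ominus> a) \<otimes> a [^] n = a [^] n \<ominus> a [^] Suc n"
      using a p q by (simp_all only: a_minus_def r_distr l_distr r_minus l_minus a_inv_closed one_closed nat_pow_closed r_one l_one)
    moreover have "x \<ominus> y \<oplus> (\<one> \<ominus> x) = \<one> \<ominus> y" if "x \<in> carrier M" "y \<in> carrier M" for x y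
      using that by (simp add: a_minus_def a_ac r_neg1 r_neg2)
    ultimately show ?case unfolding s using Suc c a
      by (simp add: l_distr r_distr del: nat_pow_Suc)
  qed
  have l: "tends (\<lambda>n. \<one> \<ominus> a [^] n) \<one>"
    using tends_diff[OF tends_const[OF one_closed] tends_null[OF n]] by (simp add: a_minus_def)
  have t: "tends (\<lambda>_. \<one> \<ominus> a) (\<one> \<ominus> a)" using a by (intro tends_const) simp
  have "b \<otimes> (\<one> \<ominus> a) = \<one>" "(\<one> \<ominus> a) \<otimes> b = \<one>"
    using tends_unique[OF tends_mult[OF b t]] tends_unique[OF tends_mult[OF t b]] l 1 by simp_all
  then show ?thesis using b unfolding tends_def by blast
qed

section \<open>Lifting idempotents by Newton's iteration\<close>

definition closed_under_limits :: "'m set \<Rightarrow> bool" where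
  "closed_under_limits J \<longleftrightarrow> (\<forall>s l. (\<forall>n. s n \<in> J) \<and> tends s l \<longrightarrow> l \<in> J)"

text \<open>
  Newton's iteration \<open>a \<mapsto> 3a\<^sup>2 - 2a\<^sup>3\<close> for the equation \<open>x\<^sup>2 = x\<close>, in the form \<open>a\<^sup>2(1 + 2(1 - a))\<close> that
  shows the symmetry under \<open>a \<mapsto> 1 - a\<close>.
\<close>

definition newton :: "'m \<Rightarrow> 'm" where
  "newton a = a \<otimes> (a \<otimes> (\<one> \<oplus> ((\<one> \<ominus> a) \<oplus> (\<one> \<ominus> a))))"

text \<open>The right side is the Newton step applied to 1 - a. Thus a and 1 - a both acquire a
  square, and so will their product.\<close>

lemma newton_one_minus:
  assumes a: "a \<in> carrier M"
  shows "\<one> \<ominus> newton a = (\<one> \<ominus> a) \<otimes> ((\<one> \<ominus> a) \<otimes> (\<one> \<oplus> (a \<oplus> a)))"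
  unfolding newton_def using a
  by (simp add: a_minus_def l_distr r_distr l_minus r_minus minus_add a_ac m_assoc r_neg1 r_neg2 r_neg l_neg)

text \<open>The correction is a multiple of the defect a(1 - a), so the increments of the iteration
  inherit from the defects both the convergence to zero and the membership in the ideal.\<close>

lemma newton_diff:
  assumes a: "a \<in> carrier M"
  shows "newton a \<ominus> a = (a \<otimes> (\<one> \<ominus> a)) \<otimes> (a \<oplus> a \<ominus> \<one>)"
  unfolding newton_def using a
  by (simp add: a_minus_def l_distr r_distr l_minus r_minus minus_add a_ac m_assoc r_neg1 r_neg2 r_neg l_neg)

text \<open>One step squares the defect a(1 - a) up to a factor, which is the quadratic convergence
  of Newton's method.\<close>

lemma newton_mult:
  assumes a: "a \<in> carrier M"
  shows "newton a \<otimes> (\<one> \<ominus> newton a)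
    = (a \<otimes> (\<one> \<ominus> a)) \<otimes> ((a \<otimes> (\<one> \<ominus> a)) \<otimes> ((\<one> \<oplus> ((\<one> \<ominus> a) \<oplus> (\<one> \<ominus> a))) \<otimes> (\<one> \<oplus> (a \<oplus> a))))"
proof -
  \<comment> \<open>Abbreviating the factors keeps them from being multiplied out: it is enough to
    move \<open>v\<close> past \<open>a\<close> and \<open>u\<close> past \<open>v\<close>.\<close>
  define v u w where "v = \<one> \<ominus> a" and "u = \<one> \<oplus> (v \<oplus> v)" and "w = \<one> \<oplus> (a \<oplus> a)"
  have c: "v \<in> carrier M" "u \<in> carrier M" "w \<in> carrier M" using a by (auto simp: v_def u_def w_def)
  have va: "v \<otimes> (a \<otimes> z) = a \<otimes> (v \<otimes> z)" if "z \<in> carrier M" for z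
    using a that by (simp add: v_def a_minus_def l_distr r_distr l_minus r_minus)
  have uv: "u \<otimes> (v \<otimes> z) = v \<otimes> (u \<otimes> z)" if "z \<in> carrier M" for z
    using c that by (simp add: u_def l_distr r_distr)
  show ?thesis
    unfolding newton_one_minus[OF a] unfolding newton_def v_def[symmetric] u_def[symmetric] w_def[symmetric]
    using a c by (simp add: m_assoc va uv)
qed

lemma idempotent_lift:
  assumes J: "ideal J M" and cl: "closed_under_limits J" and a: "a \<in> carrier M"
    and aJ: "a \<otimes> (\<one> \<ominus> a) \<in> J" and nil: "null (\<lambda>n. (a \<otimes> (\<one> \<ominus> a)) [^] n)"
  shows "\<exists>e\<in>carrier M. e \<otimes> e = e \<and> e \<ominus> a \<in> J"
proof -
  interpret J: ideal J M by (rule J)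
  define y where "y = a \<otimes> (\<one> \<ominus> a)"
  \<comment> \<open>The iterates are polynomials in \<open>a\<close>. The centralizer of
    \<open>a\<close> stands in for the ring of these polynomials, since it is enough that its
    elements commute with the powers of \<open>y\<close>.\<close>
  define Z where "Z = {z \<in> carrier M. z \<otimes> a = a \<otimes> z}"
  have y: "y \<in> carrier M" using a by (simp add: y_def)
  have Zc: "z \<in> carrier M" if "z \<in> Z" for z using that by (simp add: Z_def)
  have Zm: "z \<otimes> t \<in> Z" if "z \<in> Z" "t \<in> Z" for z t
  proof -
    have "z \<otimes> t \<otimes> a = z \<otimes> (a \<otimes> t)" using that a by (simp add: Z_def m_assoc)
    also have "\<dots> = a \<otimes> (z \<otimes> t)" using that a by (simp add: Z_def m_assoc[symmetric])
    finally show ?thesis using that by (simp add: Z_def)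
  qed
  have Za: "z \<oplus> t \<in> Z" if "z \<in> Z" "t \<in> Z" for z t using that a by (simp add: Z_def l_distr r_distr)
  have Zn: "z \<ominus> t \<in> Z" if "z \<in> Z" "t \<in> Z" for z t
    using that a by (simp add: Z_def l_distr r_distr a_minus_def l_minus r_minus)
  have Z1: "\<one> \<in> Z" "a \<in> Z" using a by (simp_all add: Z_def)
  have Zy: "y \<in> Z" unfolding y_def by (intro Zm Zn Z1)
  have Zp: "y [^] n \<in> Z" for n :: nat by (induction n) (auto intro: Z1 Zm Zy)
  have yZ: "z \<otimes> y [^] n = y [^] n \<otimes> z" if z: "z \<in> Z" for z and n :: nat
  proof -
    have za: "z \<otimes> a = a \<otimes> z" using z by (simp add: Z_def)
    have "y \<otimes> z = a \<otimes> (z \<otimes> (\<one> \<ominus> a))"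
      using a Zc[OF z] za by (simp add: y_def m_assoc l_distr r_distr a_minus_def l_minus r_minus)
    also have "\<dots> = z \<otimes> y" using a Zc[OF z] za by (simp add: y_def m_assoc[symmetric])
    finally show ?thesis using group_commutes_pow[of y z n] y Zc[OF z] by simp
  qed
  define s where "s n = (newton ^^ n) a" for n
  define x where "x n = s n \<otimes> (\<one> \<ominus> s n)" for n
  have s0: "s 0 = a" and sS: "s (Suc n) = newton (s n)" for n by (simp_all add: s_def)
  have sZ: "s n \<in> Z" for n
    by (induction n) (auto simp: s0 sS newton_def intro!: Z1 Zm Za Zn)
  have sc: "s n \<in> carrier M" for n using sZ Zc by blast
  \<comment> \<open>The defect is even divisible by y^(2^n). The exponent n + 1 already makes the
    defects null, and the surplus power of \<open>y\<close> is moved into the cofactor.\<close>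
  have x: "\<exists>d\<in>Z. x n = y [^] Suc n \<otimes> d" for n
  proof (induction n)
    case 0
    show ?case by (rule bexI[of _ \<one>]) (use y Z1 in \<open>simp_all add: x_def s0 y_def[symmetric]\<close>)
  next
    case (Suc n)
    then obtain d where d: "d \<in> Z" "x n = y [^] Suc n \<otimes> d" by blast
    define c where "c = (\<one> \<oplus> ((\<one> \<ominus> s n) \<oplus> (\<one> \<ominus> s n))) \<otimes> (\<one> \<oplus> (s n \<oplus> s n))"
    have cZ: "c \<in> Z" unfolding c_def by (intro Zm Za Zn Z1 sZ)
    note cc = Zc[OF cZ] Zc[OF d(1)] nat_pow_closed[OF y, of "Suc n"]  nat_pow_closed[OF y, of n] nat_pow_closed[OF y, of "Suc (Suc n)"]
    have "x (Suc n) = x n \<otimes> (x n \<otimes> c)"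
      unfolding x_def sS c_def by (rule newton_mult[OF sc])
    also have "\<dots> = y [^] Suc n \<otimes> ((d \<otimes> y [^] Suc n) \<otimes> (d \<otimes> c))"
      unfolding d(2) using cc by (simp only: m_assoc m_closed)
    also have "\<dots> = (y [^] Suc n \<otimes> y [^] Suc n) \<otimes> (d \<otimes> (d \<otimes> c))"
      unfolding yZ[OF d(1)] using cc by (simp only: m_assoc m_closed)
    also have "y [^] Suc n \<otimes> y [^] Suc n = y [^] Suc (Suc n) \<otimes> y [^] n"
      unfolding nat_pow_mult[OF y] by (simp only: add_Suc add_Suc_right)
    finally have "x (Suc n) = y [^] Suc (Suc n) \<otimes> (y [^] n \<otimes> (d \<otimes> (d \<otimes> c)))"
      using cc by (simp only: m_assoc m_closed)
    moreover have "y [^] n \<otimes> (d \<otimes> (d \<otimes> c)) \<in> Z" by (intro Zm Zp d(1) cZ)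
    ultimately show ?case by blast
  qed
  then obtain d where d: "\<And>n. d n \<in> Z" "\<And>n. x n = y [^] Suc n \<otimes> d n" by metis
  have nx: "null x"
    unfolding d(2) by (rule null_mult_right[OF null_Suc[OF nil[folded y_def]] Zc[OF d(1)]])
  have xJ: "x n \<in> J" for n
  proof -
    have "y [^] Suc n \<in> J" unfolding nat_pow_Suc using aJ[folded y_def] nat_pow_closed[OF y] by (rule J.I_l_closed)
    then show ?thesis unfolding d(2) using Zc[OF d(1)] by (rule J.I_r_closed)
  qed
  define D where "D n = x n \<otimes> (s n \<oplus> s n \<ominus> \<one>)" for n
  have Ds: "D n = s (Suc n) \<ominus> s n" for n using newton_diff[OF sc] by (simp add: D_def x_def sS)
  have nD: "null D" unfolding D_def by (rule null_mult_right[OF nx]) (use sc in simp)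
  have DJ: "D n \<in> J" for n unfolding D_def using xJ sc by (simp add: J.I_r_closed)
  have Dc: "D n \<in> carrier M" for n using DJ J.a_Hcarr by blast
  \<comment> \<open>The iterates differ from \<open>a\<close> by the partial sums of a null series,
    so completeness gives their limit.\<close>
  have sum: "finsum M D {..<n} = s n \<ominus> a" for n
  proof (induction n)
    case 0
    show ?case using a by (simp add: s0 a_minus_def r_neg)
  next
    case (Suc n)
    have "finsum M D {..<Suc n} = D n \<oplus> finsum M D {..<n}"
      unfolding lessThan_Suc by (rule finsum_insert) (use Dc in auto)
    then show ?case unfolding Suc Ds using minus_telescope[OF sc sc a] by simp
  qed
  obtain l where l: "tends (\<lambda>n. s n \<ominus> a) l" using null_series_tends[OF nD] unfolding sum by blast
  have lc: "l \<in> carrier M" using l by (simp add: tends_def)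
  have sJ: "s n \<ominus> a \<in> J" for n
  proof (induction n)
    case (Suc n)
    have "s (Suc n) \<ominus> a = D n \<oplus> (s n \<ominus> a)" unfolding Ds by (rule minus_telescope[OF sc sc a, symmetric])
    then show ?case using J.a_closed[OF DJ Suc.IH] by metis
  next
    case 0
    show ?case using r_neg[OF a] J.zero_closed unfolding s0 a_minus_def by simp
  qed
  have "(\<forall>n. s n \<ominus> a \<in> J) \<and> tends (\<lambda>n. s n \<ominus> a) l" using sJ l by (intro conjI allI)
  then have lJ: "l \<in> J" by (rule cl[unfolded closed_under_limits_def, THEN spec, THEN spec, THEN mp])
  define e where "e = l \<oplus> a"
  have e: "e \<in> carrier M" using lc a by (simp add: e_def)
  have sa: "s n \<ominus> a \<ominus> \<ominus> a = s n" for n using sc[of n] a unfolding a_minus_def by (simp add: a_assoc l_neg)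
  have la: "l \<ominus> \<ominus> a = e" using a by (simp add: a_minus_def e_def)
  have se: "tends s e"
    using tends_diff[OF l tends_const[OF a_inv_closed[OF a]]] unfolding sa la .
  have "tends x (e \<otimes> (\<one> \<ominus> e))"
    unfolding x_def by (rule tends_mult[OF se tends_diff[OF tends_const[OF one_closed] se]])
  then have z: "e \<otimes> (\<one> \<ominus> e) = \<zero>" by (rule tends_unique[OF _ tends_null[OF nx]])
  have zz: "e \<otimes> (\<one> \<ominus> e) = e \<ominus> e \<otimes> e" using e by (simp add: a_minus_def r_distr r_minus)
  from z have "e \<ominus> e \<otimes> e = \<zero>" unfolding zz .
  then have ee: "e \<otimes> e = e" by (rule eq_of_diff[OF e m_closed[OF e e], symmetric])
  have "e \<ominus> a = l" unfolding e_def a_minus_def using a_assoc[OF lc a a_inv_closed[OF a]] r_neg[OF a] lc by simp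
  then have "e \<ominus> a \<in> J" using lJ by (rule ssubst)
  with e ee show ?thesis by (intro bexI[of _ e] conjI)
qed

end

section \<open>Complements of submodules\<close>

locale left_module = ring R + V: abelian_group V
  for R :: "('a, 'm) ring_scheme" (structure) and V :: "('a, 'v, 'k) module_scheme" +
  assumes smult_closed: "\<lbrakk>r \<in> carrier R; v \<in> carrier V\<rbrakk> \<Longrightarrow> r \<odot>\<^bsub>V\<^esub> v \<in> carrier V"
    and smult_l_distr: "\<lbrakk>r \<in> carrier R; s \<in> carrier R; v \<in> carrier V\<rbrakk>
      \<Longrightarrow> (r \<oplus> s) \<odot>\<^bsub>V\<^esub> v = r \<odot>\<^bsub>V\<^esub> v \<oplus>\<^bsub>V\<^esub> s \<odot>\<^bsub>V\<^esub> v"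
    and smult_r_distr: "\<lbrakk>r \<in> carrier R; v \<in> carrier V; w \<in> carrier V\<rbrakk>
      \<Longrightarrow> r \<odot>\<^bsub>V\<^esub> (v \<oplus>\<^bsub>V\<^esub> w) = r \<odot>\<^bsub>V\<^esub> v \<oplus>\<^bsub>V\<^esub> r \<odot>\<^bsub>V\<^esub> w"
    and smult_assoc: "\<lbrakk>r \<in> carrier R; s \<in> carrier R; v \<in> carrier V\<rbrakk>
      \<Longrightarrow> (r \<otimes> s) \<odot>\<^bsub>V\<^esub> v = r \<odot>\<^bsub>V\<^esub> (s \<odot>\<^bsub>V\<^esub> v)"
    and smult_one: "v \<in> carrier V \<Longrightarrow> \<one> \<odot>\<^bsub>V\<^esub> v = v"
begin

lemma smult_zero: "v \<in> carrier V \<Longrightarrow> \<zero> \<odot>\<^bsub>V\<^esub> v = \<zero>\<^bsub>V\<^esub>"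
  by (metis V.add.r_cancel_one' r_zero smult_closed smult_l_distr zero_closed)

lemma smult_diff:
  assumes "r \<in> carrier R" "s \<in> carrier R" "v \<in> carrier V"
  shows "(r \<ominus> s) \<odot>\<^bsub>V\<^esub> v = r \<odot>\<^bsub>V\<^esub> v \<ominus>\<^bsub>V\<^esub> s \<odot>\<^bsub>V\<^esub> v"
proof -
  have "(\<ominus> s) \<odot>\<^bsub>V\<^esub> v \<oplus>\<^bsub>V\<^esub> s \<odot>\<^bsub>V\<^esub> v = \<zero>\<^bsub>V\<^esub>"
    using assms smult_zero by (simp add: smult_l_distr[symmetric] l_neg)
  then have "(\<ominus> s) \<odot>\<^bsub>V\<^esub> v = \<ominus>\<^bsub>V\<^esub> (s \<odot>\<^bsub>V\<^esub> v)"
    using assms by (intro V.minus_equality[symmetric]) (auto simp: smult_closed)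
  then show ?thesis using assms by (simp add: a_minus_def smult_l_distr)
qed

definition submod :: "'v set \<Rightarrow> bool" where
  "submod W \<longleftrightarrow> W \<subseteq> carrier V \<and> \<zero>\<^bsub>V\<^esub> \<in> W \<and> (\<forall>v\<in>W. \<forall>w\<in>W. v \<ominus>\<^bsub>V\<^esub> w \<in> W)
    \<and> (\<forall>r\<in>carrier R. \<forall>w\<in>W. r \<odot>\<^bsub>V\<^esub> w \<in> W)"

lemma submodD:
  assumes "submod W"
  shows "w \<in> W \<Longrightarrow> w \<in> carrier V" "\<zero>\<^bsub>V\<^esub> \<in> W" "v \<in> W \<Longrightarrow> w \<in> W \<Longrightarrow> v \<ominus>\<^bsub>V\<^esub> w \<in> W"
    "r \<in> carrier R \<Longrightarrow> w \<in> W \<Longrightarrow> r \<odot>\<^bsub>V\<^esub> w \<in> W" "v \<in> W \<Longrightarrow> w \<in> W \<Longrightarrow> v \<oplus>\<^bsub>V\<^esub> w \<in> W"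
proof -
  show 1: "w \<in> W \<Longrightarrow> w \<in> carrier V" "\<zero>\<^bsub>V\<^esub> \<in> W" "r \<in> carrier R \<Longrightarrow> w \<in> W \<Longrightarrow> r \<odot>\<^bsub>V\<^esub> w \<in> W" for w r
    using assms by (auto simp: submod_def)
  show d: "v \<in> W \<Longrightarrow> w \<in> W \<Longrightarrow> v \<ominus>\<^bsub>V\<^esub> w \<in> W" for v w using assms by (auto simp: submod_def)
  assume v: "v \<in> W" "w \<in> W"
  have "v \<ominus>\<^bsub>V\<^esub> (\<zero>\<^bsub>V\<^esub> \<ominus>\<^bsub>V\<^esub> w) = v \<oplus>\<^bsub>V\<^esub> w" using 1 v by (simp add: V.minus_eq V.l_zero)
  then show "v \<oplus>\<^bsub>V\<^esub> w \<in> W" using d[OF v(1) d[OF 1(2) v(2)]] by simp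
qed

lemma submod_add_cyclic:
  assumes W: "submod W" and I: "left_ideal R I" and w: "w \<in> carrier V"
  shows "submod {v \<oplus>\<^bsub>V\<^esub> l \<odot>\<^bsub>V\<^esub> w |v l. v \<in> W \<and> l \<in> I}"
proof -
  have Is: "additive_subgroup I R" and Im: "\<And>r l. r \<in> carrier R \<Longrightarrow> l \<in> I \<Longrightarrow> r \<otimes> l \<in> I"
    using I by (auto simp: left_ideal_def)
  interpret I: additive_subgroup I R by (rule Is)
  have Ic: "l \<in> carrier R" if "l \<in> I" for l using that by (rule I.a_Hcarr)
  have Id: "l \<ominus> k \<in> I" if "l \<in> I" "k \<in> I" for l k
    using that I.a_closed I.a_inv_closed unfolding a_minus_def by blast
  let ?S = "{v \<oplus>\<^bsub>V\<^esub> l \<odot>\<^bsub>V\<^esub> w |v l. v \<in> W \<and> l \<in> I}"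
  note c = submodD[OF W]
  show ?thesis
    unfolding submod_def
  proof (intro conjI ballI subsetI)
    fix x assume "x \<in> ?S"
    then show "x \<in> carrier V" using c(1) smult_closed Ic w by auto
  next
    have "\<zero>\<^bsub>V\<^esub> = \<zero>\<^bsub>V\<^esub> \<oplus>\<^bsub>V\<^esub> \<zero> \<odot>\<^bsub>V\<^esub> w" using smult_zero[OF w] by simp
    then show "\<zero>\<^bsub>V\<^esub> \<in> ?S" using c(2) I.zero_closed by blast
  next
    fix x y assume "x \<in> ?S" "y \<in> ?S"
    then obtain v l v' l' where e: "v \<in> W" "l \<in> I" "x = v \<oplus>\<^bsub>V\<^esub> l \<odot>\<^bsub>V\<^esub> w"
      "v' \<in> W" "l' \<in> I" "y = v' \<oplus>\<^bsub>V\<^esub> l' \<odot>\<^bsub>V\<^esub> w" by blast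
    have "x \<ominus>\<^bsub>V\<^esub> y = (v \<ominus>\<^bsub>V\<^esub> v') \<oplus>\<^bsub>V\<^esub> (l \<ominus> l') \<odot>\<^bsub>V\<^esub> w"
      using e c(1) smult_closed Ic w by (simp add: smult_diff V.minus_eq V.minus_add V.a_ac)
    then show "x \<ominus>\<^bsub>V\<^esub> y \<in> ?S" using e c(3) Id by blast
  next
    fix r x assume r: "r \<in> carrier R" and "x \<in> ?S"
    then obtain v l where e: "v \<in> W" "l \<in> I" "x = v \<oplus>\<^bsub>V\<^esub> l \<odot>\<^bsub>V\<^esub> w" by blast
    have "r \<odot>\<^bsub>V\<^esub> x = r \<odot>\<^bsub>V\<^esub> v \<oplus>\<^bsub>V\<^esub> (r \<otimes> l) \<odot>\<^bsub>V\<^esub> w"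
      using r e c(1) smult_closed Ic w by (simp add: smult_r_distr smult_assoc)
    then show "r \<odot>\<^bsub>V\<^esub> x \<in> ?S" using e r c(4) Im by blast
  qed
qed

lemma submod_sum:
  assumes W: "submod W" and W': "submod W'"
  shows "submod {v \<oplus>\<^bsub>V\<^esub> w |v w. v \<in> W \<and> w \<in> W'}" (is "submod ?S")
proof -
  note c = submodD[OF W] and c' = submodD[OF W']
  show ?thesis
    unfolding submod_def
  proof (intro conjI ballI subsetI)
    fix x assume "x \<in> ?S"
    then show "x \<in> carrier V" using c(1) c'(1) by auto
  next
    have "\<zero>\<^bsub>V\<^esub> = \<zero>\<^bsub>V\<^esub> \<oplus>\<^bsub>V\<^esub> \<zero>\<^bsub>V\<^esub>" by simp
    then show "\<zero>\<^bsub>V\<^esub> \<in> ?S" using c(2) c'(2) by blast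
  next
    fix x y assume "x \<in> ?S" "y \<in> ?S"
    then obtain v l v' l' where e: "v \<in> W" "l \<in> W'" "x = v \<oplus>\<^bsub>V\<^esub> l" "v' \<in> W" "l' \<in> W'" "y = v' \<oplus>\<^bsub>V\<^esub> l'"
      by blast
    have "x \<ominus>\<^bsub>V\<^esub> y = (v \<ominus>\<^bsub>V\<^esub> v') \<oplus>\<^bsub>V\<^esub> (l \<ominus>\<^bsub>V\<^esub> l')"
      using e c(1) c'(1) by (simp add: V.minus_eq V.minus_add V.a_ac)
    then show "x \<ominus>\<^bsub>V\<^esub> y \<in> ?S" using e c(3) c'(3) by blast
  next
    fix r x assume r: "r \<in> carrier R" and "x \<in> ?S"
    then obtain v l where e: "v \<in> W" "l \<in> W'" "x = v \<oplus>\<^bsub>V\<^esub> l" by blast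
    have "r \<odot>\<^bsub>V\<^esub> x = r \<odot>\<^bsub>V\<^esub> v \<oplus>\<^bsub>V\<^esub> r \<odot>\<^bsub>V\<^esub> l"
      using r e c(1) c'(1) by (simp add: smult_r_distr)
    then show "r \<odot>\<^bsub>V\<^esub> x \<in> ?S" using e r c(4) c'(4) by blast
  qed
qed

text \<open>
  Modulo \<open>Z\<close>, the module is a module over \<open>R/K\<close>, and \<open>L/K\<close> is a minimal left ideal of that simple
  ring. Any \<open>W\<close> with \<open>L V \<subseteq> W\<close> is everything, as its conductor is a two-sided ideal.
\<close>

lemma complement_exists:
  assumes K: "ideal K R" and maxl: "\<And>I. ideal I R \<Longrightarrow> K \<subseteq> I \<Longrightarrow> I = K \<or> I = carrier R"
    and L: "left_ideal R L" "K \<subset> L"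
      "\<And>I. left_ideal R I \<Longrightarrow> K \<subseteq> I \<Longrightarrow> I \<subseteq> L \<Longrightarrow> I = K \<or> I = L"
    and Z: "submod Z" "\<And>k v. k \<in> K \<Longrightarrow> v \<in> carrier V \<Longrightarrow> k \<odot>\<^bsub>V\<^esub> v \<in> Z"
    and N: "submod N" "Z \<subseteq> N"
  shows "\<exists>W. submod W \<and> Z \<subseteq> W \<and> N \<inter> W \<subseteq> Z \<and> (\<forall>v\<in>carrier V. \<exists>n\<in>N. \<exists>w\<in>W. v = n \<oplus>\<^bsub>V\<^esub> w)"
proof -
  define \<A> where "\<A> = {W. submod W \<and> Z \<subseteq> W \<and> N \<inter> W \<subseteq> Z}"
  \<comment> \<open>The complement is chosen maximal among the submodules that contain
    \<open>Z\<close> and meet \<open>N\<close> only inside \<open>Z\<close>. It remains to see that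
    its sum with \<open>N\<close> is everything.\<close>
  have "\<exists>M\<in>\<A>. \<forall>X\<in>\<A>. M \<subseteq> X \<longrightarrow> X = M"
  proof (rule subset_Zorn_nonempty)
    show "\<A> \<noteq> {}" using Z N by (auto simp: \<A>_def)
    fix \<C> assume ne: "\<C> \<noteq> {}" and ch: "subset.chain \<A> \<C>"
    have CA: "C \<in> \<A>" if "C \<in> \<C>" for C using ch that by (auto simp: subset.chain_def)
    have sm: "submod C" if "C \<in> \<C>" for C using CA[OF that] by (simp add: \<A>_def)
    have "submod (\<Union>\<C>)"
      unfolding submod_def
    proof (intro conjI ballI subsetI)
      show "\<zero>\<^bsub>V\<^esub> \<in> \<Union>\<C>" using ne submodD(2)[OF sm] by blast
      show "x \<in> carrier V" if "x \<in> \<Union>\<C>" for x using that submodD(1)[OF sm] by blast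
      show "r \<odot>\<^bsub>V\<^esub> x \<in> \<Union>\<C>" if "r \<in> carrier R" "x \<in> \<Union>\<C>" for r x using that submodD(4)[OF sm] by blast
      fix x y assume "x \<in> \<Union>\<C>" "y \<in> \<Union>\<C>"
      then obtain X Y where "X \<in> \<C>" "x \<in> X" "Y \<in> \<C>" "y \<in> Y" by blast
      moreover then have "X \<subseteq> Y \<or> Y \<subseteq> X" using ch by (auto simp: subset.chain_def)
      ultimately show "x \<ominus>\<^bsub>V\<^esub> y \<in> \<Union>\<C>" using submodD(3)[OF sm] by blast
    qed
    then show "\<Union>\<C> \<in> \<A>" using ne CA by (auto simp: \<A>_def)
  qed
  then obtain M where M: "submod M" "Z \<subseteq> M" "N \<inter> M \<subseteq> Z" and max: "\<And>X. X \<in> \<A> \<Longrightarrow> M \<subseteq> X \<Longrightarrow> X = M"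
    by (auto simp: \<A>_def)
  define W where "W = {n \<oplus>\<^bsub>V\<^esub> w |n w. n \<in> N \<and> w \<in> M}"
  have W: "submod W" unfolding W_def by (rule submod_sum[OF N(1) M(1)])
  note n = submodD[OF N(1)] and m = submodD[OF M(1)] and wd = submodD[OF W]
  have MW: "M \<subseteq> W"
  proof
    fix x assume x: "x \<in> M"
    then have "x = \<zero>\<^bsub>V\<^esub> \<oplus>\<^bsub>V\<^esub> x" using m by (simp add: V.l_zero)
    then show "x \<in> W" unfolding W_def using x n(2) by blast
  qed
  have "W = carrier V"
  proof (rule ccontr)
    assume neq: "W \<noteq> carrier V"
    \<comment> \<open>If \<open>W\<close> were proper, this conductor would have to be
      \<open>K\<close>. The strictly larger \<open>L\<close> would then move some vector
      \<open>v\<close> outside \<open>W\<close>.\<close>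
    define I where "I = {r \<in> carrier R. \<forall>v\<in>carrier V. r \<odot>\<^bsub>V\<^esub> v \<in> W}"
    have "ideal I R"
    proof (rule idealI[OF ring_axioms])
      show "subgroup I (add_monoid R)"
      proof (rule add.subgroupI)
        show "I \<subseteq> carrier R" "I \<noteq> {}" using smult_zero wd(2) by (auto simp: I_def)
        have d: "a \<ominus> b \<in> I" if "a \<in> I" "b \<in> I" for a b
          using that wd(3) by (auto simp: I_def smult_diff)
        have z: "\<zero> \<in> I" using smult_zero wd(2) by (auto simp: I_def)
        have c: "a \<in> carrier R" if "a \<in> I" for a using that by (simp add: I_def)
        show neg: "\<ominus> a \<in> I" if "a \<in> I" for a using d[OF z that] c[OF that] by (simp add: a_minus_def)
        show "a \<oplus> b \<in> I" if "a \<in> I" "b \<in> I" for a b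
          using d[OF that(1) neg[OF that(2)]] c that by (simp add: a_minus_def)
      qed
      show "x \<otimes> a \<in> I" if "a \<in> I" "x \<in> carrier R" for a x
        using that wd(4) by (auto simp: I_def smult_assoc)
      show "a \<otimes> x \<in> I" if "a \<in> I" "x \<in> carrier R" for a x
        using that by (auto simp: I_def smult_assoc smult_closed)
    qed
    moreover have "K \<subseteq> I"
      using Z(2) M(2) MW ideal.Icarr[OF K] by (auto simp: I_def)
    moreover have "I \<noteq> carrier R"
    proof
      assume "I = carrier R"
      then have "\<one> \<in> I" by simp
      then have "carrier V \<subseteq> W" using smult_one by (auto simp: I_def)
      then show False using neq wd(1) by blast
    qed
    ultimately have IK: "I = K" using maxl by blast
    have Lc: "l \<in> carrier R" if "l \<in> L" for l
      using L(1) that additive_subgroup.a_Hcarr by (fastforce simp: left_ideal_def)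
    obtain l v where l: "l \<in> L" "v \<in> carrier V" "l \<odot>\<^bsub>V\<^esub> v \<notin> W"
      using L(2) Lc unfolding IK[symmetric] I_def by blast
    have Ls: "additive_subgroup L R" and Lm: "\<And>r l. r \<in> carrier R \<Longrightarrow> l \<in> L \<Longrightarrow> r \<otimes> l \<in> L"
      using L(1) by (auto simp: left_ideal_def)
    interpret L: additive_subgroup L R by (rule Ls)
    \<comment> \<open>Minimality of \<open>L\<close> forces \<open>L' = K\<close>, so L v meets
      \<open>W\<close> only inside \<open>Z\<close>. Adding L v to \<open>M\<close> therefore keeps
      the intersection with \<open>N\<close> inside \<open>Z\<close>, against the maximality of
      \<open>M\<close>.\<close>
    define L' where "L' = {l \<in> L. l \<odot>\<^bsub>V\<^esub> v \<in> W}"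
    have "left_ideal R L'"
      unfolding left_ideal_def
    proof (intro conjI ballI)
      show "additive_subgroup L' R"
      proof (rule additive_subgroup.intro, rule add.subgroupI)
        show "L' \<subseteq> carrier R" using Lc by (auto simp: L'_def)
        have z: "\<zero> \<in> L'" using smult_zero l(2) wd(2) by (auto simp: L'_def)
        then show "L' \<noteq> {}" by blast
        have d: "a \<ominus> b \<in> L'" if "a \<in> L'" "b \<in> L'" for a b
        proof -
          have "a \<ominus> b \<in> L"
            unfolding a_minus_def by (rule L.a_closed[OF _ L.a_inv_closed]) (use that in \<open>auto simp: L'_def\<close>)
          then show ?thesis using that wd(3) l(2) Lc by (simp add: L'_def smult_diff)
        qed
        have c: "a \<in> carrier R" if "a \<in> L'" for a using that Lc by (simp add: L'_def)
        show neg: "\<ominus> a \<in> L'" if "a \<in> L'" for a using d[OF z that] c[OF that] by (simp add: a_minus_def)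
        show "a \<oplus> b \<in> L'" if "a \<in> L'" "b \<in> L'" for a b
          using d[OF that(1) neg[OF that(2)]] c that by (simp add: a_minus_def)
      qed
      show "r \<otimes> a \<in> L'" if "a \<in> L'" "r \<in> carrier R" for a r
        using that wd(4) Lm Lc l(2) by (auto simp: L'_def smult_assoc)
    qed
    moreover have "K \<subseteq> L'" using L(2) Z(2)[OF _ l(2)] M(2) MW by (auto simp: L'_def)
    moreover have "L' \<subseteq> L" "L' \<noteq> L" using l by (auto simp: L'_def)
    ultimately have LK: "L' = K" using L(3) by blast
    let ?X = "{x \<oplus>\<^bsub>V\<^esub> l \<odot>\<^bsub>V\<^esub> v |x l. x \<in> M \<and> l \<in> L}"
    have MX: "M \<subseteq> ?X"
    proof
      fix x assume x: "x \<in> M"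
      then have "x = x \<oplus>\<^bsub>V\<^esub> \<zero> \<odot>\<^bsub>V\<^esub> v" using m smult_zero[OF l(2)] by (simp add: V.r_zero)
      then show "x \<in> ?X" using x L.zero_closed by blast
    qed
    have "N \<inter> ?X \<subseteq> Z"
    proof
      fix y assume "y \<in> N \<inter> ?X"
      then obtain x k where y: "y \<in> N" "y = x \<oplus>\<^bsub>V\<^esub> k \<odot>\<^bsub>V\<^esub> v" "x \<in> M" "k \<in> L" by blast
      have kc: "k \<odot>\<^bsub>V\<^esub> v \<in> carrier V" using y Lc l smult_closed by blast
      have "k \<odot>\<^bsub>V\<^esub> v = y \<oplus>\<^bsub>V\<^esub> (\<zero>\<^bsub>V\<^esub> \<ominus>\<^bsub>V\<^esub> x)"
        using m(1)[OF y(3)] kc unfolding y(2) by (simp add: V.minus_eq V.a_ac V.l_zero V.r_neg1 V.r_neg2)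
      moreover have "\<zero>\<^bsub>V\<^esub> \<ominus>\<^bsub>V\<^esub> x \<in> M" by (rule m(3)[OF m(2) y(3)])
      ultimately have "k \<odot>\<^bsub>V\<^esub> v \<in> W" unfolding W_def using y(1) by blast
      then have "k \<in> K" using y(4) unfolding LK[symmetric] L'_def by blast
      then have "k \<odot>\<^bsub>V\<^esub> v \<in> M" using Z(2)[OF _ l(2)] M(2) by blast
      then have "y \<in> M" unfolding y(2) by (rule m(5)[OF y(3)])
      then show "y \<in> Z" using y(1) M(3) by blast
    qed
    moreover have "submod ?X" by (rule submod_add_cyclic[OF M(1) L(1) l(2)])
    ultimately have XA: "?X \<in> \<A>" using MX M(2) unfolding \<A>_def mem_Collect_eq by (meson subset_trans)
    have "?X = M" by (rule max[OF XA MX])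
    moreover have "l \<odot>\<^bsub>V\<^esub> v \<in> ?X"
    proof -
      have "l \<odot>\<^bsub>V\<^esub> v = \<zero>\<^bsub>V\<^esub> \<oplus>\<^bsub>V\<^esub> l \<odot>\<^bsub>V\<^esub> v" using l Lc smult_closed by (simp add: V.l_zero)
      then show ?thesis using m(2) l(1) by blast
    qed
    ultimately show False using MW l(3) by blast
  qed
  then have "\<forall>v\<in>carrier V. \<exists>n\<in>N. \<exists>w\<in>M. v = n \<oplus>\<^bsub>V\<^esub> w" unfolding W_def by blast
  with M show ?thesis by (intro exI[of _ M] conjI)
qed

end

section \<open>Rows and matrices over a topological ring\<close>

context complete_lin_ring
begin

section \<open>Sums of null families and closed subgroups\<close>

lemma nullfam_zero: "nullfam (\<lambda>_. \<zero>) I"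
  by (rule tsum_zero(1)) simp

lemma nullfam_add:
  assumes a: "nullfam a I" and b: "nullfam b I"
  shows "nullfam (\<lambda>i. a i \<oplus> b i) I"
proof -
  have "nullfam (\<lambda>i. a i \<ominus> (\<zero> \<ominus> b i)) I" by (intro nullfam_diff a b nullfam_zero)
  moreover have "nullfam (\<lambda>i. a i \<ominus> (\<zero> \<ominus> b i)) I = nullfam (\<lambda>i. a i \<oplus> b i) I"
    by (rule nullfam_cong[OF refl]) (use nullfamD[OF a] nullfamD[OF b] in \<open>simp add: a_minus_def\<close>)
  ultimately show ?thesis by simp
qed

lemma tsum_add:
  assumes a: "nullfam a I" and b: "nullfam b I"
  shows "tsum (\<lambda>i. a i \<oplus> b i) I = tsum a I \<oplus> tsum b I"
proof -
  have z: "nullfam (\<lambda>i. \<zero> \<ominus> b i) I" by (intro nullfam_diff nullfam_zero b)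
  have "tsum (\<lambda>i. a i \<oplus> b i) I = tsum (\<lambda>i. a i \<ominus> (\<zero> \<ominus> b i)) I"
    by (rule tsum_cong[OF refl _ nullfam_diff[OF a z]])
       (use nullfamD[OF a] nullfamD[OF b] in \<open>simp add: a_minus_def\<close>)
  also have "\<dots> = tsum a I \<ominus> (\<zero> \<ominus> tsum b I)"
    using tsum_diff[OF a z] tsum_diff[OF nullfam_zero b] tsum_zero(2)[of I "\<lambda>_. \<zero>"] by simp
  also have "\<dots> = tsum a I \<oplus> tsum b I" using tsum_closed[OF a] tsum_closed[OF b] by (simp add: a_minus_def)
  finally show ?thesis .
qed

lemma closedin_limit:
  assumes H: "closedin T H" and x: "x \<in> carrier R" and h: "\<And>U. U \<in> ORI \<Longrightarrow> \<exists>h\<in>H. x \<ominus> h \<in> U"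
  shows "x \<in> H"
proof (rule ccontr)
  assume n: "x \<notin> H"
  have Hc: "H \<subseteq> carrier R" using closedin_subset[OF H] by simp
  have "openin T {y \<in> topspace T. x \<oplus> y \<in> topspace T - H}"
    by (rule openin_continuous_map_preimage[OF cont_add_left[OF x]]) (rule openin_diff[OF openin_topspace H])
  then have "\<exists>U\<in>ORI. U \<subseteq> {y \<in> topspace T. x \<oplus> y \<in> topspace T - H}"
    by (rule ORI_refine) (use x n in simp)
  then obtain U where U: "U \<in> ORI" "\<And>u. u \<in> U \<Longrightarrow> x \<oplus> u \<notin> H" by blast
  obtain k where k: "k \<in> H" "x \<ominus> k \<in> U" using h[OF U(1)] by blast
  have kc: "k \<in> carrier R" using k Hc by blast
  have "k \<ominus> x \<in> U" by (rule diff_sym[OF ORI_OS[OF U(1)] k(2) x kc])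
  then have "x \<oplus> (k \<ominus> x) \<notin> H" by (rule U(2))
  then show False using add_diff[OF x kc] k(1) by simp
qed

lemma tsum_closedin:
  assumes H: "closedin T H" and s: "additive_subgroup H R"
    and a: "nullfam a I" "\<And>i. i \<in> I \<Longrightarrow> a i \<in> H"
  shows "tsum a I \<in> H"
proof (rule closedin_limit[OF H tsum_closed[OF a(1)]])
  interpret H: additive_subgroup H R by (rule s)
  fix U assume U: "U \<in> ORI"
  let ?F = "{i \<in> I. a i \<notin> U}"
  have s: "finsum R a F \<in> H" if "F \<subseteq> I" for F
    using that
  proof (induction F rule: infinite_finite_induct)
    case (insert x F)
    then have "finsum R a (insert x F) = a x \<oplus> finsum R a F"
      by (intro finsum_insert) (use nullfamD[OF a(1)] in auto)
    then show ?case using insert a(2) H.a_closed by auto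
  qed (simp_all add: finsum_infinite H.zero_closed)
  have "tsum a I \<ominus> finsum R a ?F \<in> U"
    by (rule tsum_mod[OF a(1) ORI_OS[OF U] nullfam_fin[OF a(1) ORI_OS[OF U]]]) auto
  then show "\<exists>h\<in>H. tsum a I \<ominus> h \<in> U" by (rule bexI[OF _ s]) blast
qed

text \<open>The row vector \<open>t\<close> times the matrix with rows \<open>w\<close>.\<close>

definition lincomb :: "'y set \<Rightarrow> 'x set \<Rightarrow> ('y \<Rightarrow> 'x \<Rightarrow> 'a) \<Rightarrow> ('y \<Rightarrow> 'a) \<Rightarrow> 'x \<Rightarrow> 'a" where
  "lincomb Y X w t = (\<lambda>j\<in>X. tsum (\<lambda>y. t y \<otimes> w y j) Y)"

lemma nullfam_lincomb:
  assumes t: "t \<in> FC Y" and w: "\<And>y. y \<in> Y \<Longrightarrow> w y \<in> FC X" and j: "j \<in> X"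
  shows "nullfam (\<lambda>y. t y \<otimes> w y j) Y"
  by (rule nullfam_rmult[OF FC_nullfam[OF t]]) (use FC_D[OF w j] in auto)

lemma lincomb_FC:
  assumes t: "t \<in> FC Y" and w: "\<And>y. y \<in> Y \<Longrightarrow> w y \<in> FC X"
  shows "lincomb Y X w t \<in> FC X"
  unfolding lincomb_def
  by (rule restrict_FC, rule tsum_swap(2), rule nullfam_prod) (use FC_nullfam[OF t] FC_nullfam[OF w] in auto)

lemma lincomb_cong: "(\<And>y. y \<in> Y \<Longrightarrow> w y = v y) \<Longrightarrow> t \<in> FC Y \<Longrightarrow> (\<And>y. y \<in> Y \<Longrightarrow> v y \<in> FC X)
    \<Longrightarrow> lincomb Y X w t = lincomb Y X v t"
  unfolding lincomb_def by (rule restrict_ext, rule tsum_cong[OF refl]) (auto intro: nullfam_lincomb)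

text \<open>The bridge from the monad to matrices: opening the parentheses in a combination of rows
  is the multiplication of a row by a matrix.\<close>

lemma cmult_cmap_eq:
  assumes t: "t \<in> FC Y" and w: "w \<in> Y \<rightarrow> FC X"
  shows "cmult X (cmap Y (FC X) w t) = lincomb Y X w t"
proof (rule FC_eqI)
  show "cmult X (cmap Y (FC X) w t) \<in> FC X" by (intro cmult_FC cmap_FC t w)
  show "lincomb Y X w t \<in> FC X" by (rule lincomb_FC[OF t]) (use w in auto)
qed (simp add: cmult_cmap[OF t w] lincomb_def)

text \<open>Associativity of the matrix product amounts to interchanging two infinite sums. This is
  legitimate because the terms form a null family over the pairs of indices.\<close>

lemma lincomb_assoc:
  assumes t: "t \<in> FC Z" and v: "\<And>z. z \<in> Z \<Longrightarrow> v z \<in> FC Y" and w: "\<And>y. y \<in> Y \<Longrightarrow> w y \<in> FC X"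
  shows "lincomb Y X w (lincomb Z Y v t) = lincomb Z X (\<lambda>z. lincomb Y X w (v z)) t"
proof (rule FC_eqI)
  show "lincomb Y X w (lincomb Z Y v t) \<in> FC X" by (intro lincomb_FC t v w)
  show "lincomb Z X (\<lambda>z. lincomb Y X w (v z)) t \<in> FC X" by (intro lincomb_FC t v w)
  fix j assume j: "j \<in> X"
  have vw: "nullfam (\<lambda>y. v z y \<otimes> w y j) Y" if "z \<in> Z" for z
    by (rule nullfam_lincomb[OF v[OF that] w j])
  have n: "nullfam (\<lambda>(z, y). t z \<otimes> (v z y \<otimes> w y j)) (Z \<times> Y)"
    by (rule nullfam_prod[OF FC_nullfam[OF t] vw])
  have "tsum (\<lambda>y. lincomb Z Y v t y \<otimes> w y j) Y = tsum (\<lambda>y. tsum (\<lambda>z. t z \<otimes> (v z y \<otimes> w y j)) Z) Y"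
  proof (rule tsum_cong[OF refl _ tsum_swap(2)[OF n]])
    fix y assume y: "y \<in> Y"
    have "lincomb Z Y v t y \<otimes> w y j = tsum (\<lambda>z. t z \<otimes> v z y \<otimes> w y j) Z"
      using tsum_rmult[OF nullfam_lincomb[OF t v y] FC_D[OF w[OF y] j]] y by (simp add: lincomb_def)
    also have "\<dots> = tsum (\<lambda>z. t z \<otimes> (v z y \<otimes> w y j)) Z"
      by (rule tsum_cong[OF refl], use FC_D[OF t] FC_D[OF v y] FC_D[OF w[OF y] j] in \<open>simp add: m_assoc\<close>)
         (rule nullfam_rmult[OF FC_nullfam[OF t]], use FC_D[OF v y] FC_D[OF w[OF y] j] in simp)
    finally show "lincomb Z Y v t y \<otimes> w y j = tsum (\<lambda>z. t z \<otimes> (v z y \<otimes> w y j)) Z" .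
  qed
  also have "\<dots> = tsum (\<lambda>z. tsum (\<lambda>y. t z \<otimes> (v z y \<otimes> w y j)) Y) Z" by (rule tsum_swap(1)[OF n, symmetric])
  also have "\<dots> = tsum (\<lambda>z. t z \<otimes> lincomb Y X w (v z) j) Z"
  proof (rule tsum_cong[OF refl])
    show "tsum (\<lambda>y. t z \<otimes> (v z y \<otimes> w y j)) Y = t z \<otimes> lincomb Y X w (v z) j" if "z \<in> Z" for z
      using tsum_lmult[OF vw[OF that] FC_D[OF t that]] j by (simp add: lincomb_def)
    show "nullfam (\<lambda>z. t z \<otimes> lincomb Y X w (v z) j) Z"
      by (rule nullfam_lincomb[OF t _ j]) (intro lincomb_FC v w)
  qed
  finally show "lincomb Y X w (lincomb Z Y v t) j = lincomb Z X (\<lambda>z. lincomb Y X w (v z)) t j"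
    using j by (simp add: lincomb_def)
qed

lemma lincomb_unit_left:
  assumes y: "y \<in> Y" and w: "\<And>y. y \<in> Y \<Longrightarrow> w y \<in> FC X"
  shows "lincomb Y X w (cunit Y y) = w y"
proof (rule FC_eqI[OF lincomb_FC[OF unit_FC[OF y] w] w[OF y]])
  fix j assume j: "j \<in> X"
  have "tsum (\<lambda>z. cunit Y y z \<otimes> w z j) Y = cunit Y y y \<otimes> w y j"
    by (rule tsum_single(2)) (use y FC_D[OF w j] in \<open>auto simp: comb_unit_def\<close>)
  then show "lincomb Y X w (cunit Y y) j = w y j"
    using y j FC_D[OF w[OF y] j] by (simp add: lincomb_def comb_unit_def)
qed

lemma lincomb_unit_right:
  assumes t: "t \<in> FC X"
  shows "lincomb X X (cunit X) t = t"
proof (rule FC_eqI[OF lincomb_FC[OF t unit_FC] t])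
  fix j assume j: "j \<in> X"
  show "lincomb X X (cunit X) t j = t j"
    using cmult_cmap_unit[OF t, of "\<lambda>x. x" X j] cmap_id[OF t, of "\<lambda>x. x"] j by (simp add: lincomb_def)
qed

text \<open>Only the module structure is meant, so \<open>mult\<close> and \<open>one\<close> are
  left undefined. Infinite combinations are forgotten here to allow purely algebraic constructions
  of submodules; \<open>lincomb_submod\<close> recovers them.\<close>

definition free_mod :: "'x set \<Rightarrow> ('a, 'x \<Rightarrow> 'a) module" where
  "free_mod X = \<lparr>carrier = FC X, mult = undefined, one = undefined, zero = czero X,
     add = (\<lambda>t u. \<lambda>x\<in>X. t x \<oplus> u x), smult = (\<lambda>r t. \<lambda>x\<in>X. r \<otimes> t x)\<rparr>"

lemma free_mod_simps [simp]:
  "carrier (free_mod X) = FC X" "\<zero>\<^bsub>free_mod X\<^esub> = czero X"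
  by (simp_all add: free_mod_def)

lemma free_mod_add: "t \<oplus>\<^bsub>free_mod X\<^esub> u = (\<lambda>x\<in>X. t x \<oplus> u x)"
  and free_mod_smult: "r \<odot>\<^bsub>free_mod X\<^esub> t = (\<lambda>x\<in>X. r \<otimes> t x)"
  by (simp_all add: free_mod_def)

lemma cadd_FC: "t \<in> FC X \<Longrightarrow> u \<in> FC X \<Longrightarrow> t \<oplus>\<^bsub>free_mod X\<^esub> u \<in> FC X"
  unfolding free_mod_add by (intro restrict_FC nullfam_add FC_nullfam)

lemma csmult_FC: "r \<in> carrier R \<Longrightarrow> t \<in> FC X \<Longrightarrow> r \<odot>\<^bsub>free_mod X\<^esub> t \<in> FC X"
  unfolding free_mod_smult by (intro restrict_FC nullfam_lmult FC_nullfam)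

lemma left_module_free_mod: "left_module R (free_mod X)"
proof -
  have g: "abelian_group (free_mod X)"
  proof (rule abelian_groupI)
    fix t u v assume "t \<in> carrier (free_mod X)" "u \<in> carrier (free_mod X)" "v \<in> carrier (free_mod X)"
    then have c: "t \<in> FC X" "u \<in> FC X" "v \<in> FC X" by simp_all
    show "t \<oplus>\<^bsub>free_mod X\<^esub> u \<oplus>\<^bsub>free_mod X\<^esub> v = t \<oplus>\<^bsub>free_mod X\<^esub> (u \<oplus>\<^bsub>free_mod X\<^esub> v)"
      unfolding free_mod_add
      by (rule restrict_ext) (use FC_D[OF c(1)] FC_D[OF c(2)] FC_D[OF c(3)] in \<open>simp add: a_assoc\<close>)
  next
    fix t u assume "t \<in> carrier (free_mod X)" "u \<in> carrier (free_mod X)"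
    then have c: "t \<in> FC X" "u \<in> FC X" by simp_all
    show "t \<oplus>\<^bsub>free_mod X\<^esub> u \<in> carrier (free_mod X)" using cadd_FC[OF c] by simp
    show "t \<oplus>\<^bsub>free_mod X\<^esub> u = u \<oplus>\<^bsub>free_mod X\<^esub> t"
      unfolding free_mod_add by (rule restrict_ext) (use FC_D[OF c(1)] FC_D[OF c(2)] in \<open>simp add: a_comm\<close>)
  next
    fix t assume "t \<in> carrier (free_mod X)"
    then have t: "t \<in> FC X" by simp
    show "\<zero>\<^bsub>free_mod X\<^esub> \<oplus>\<^bsub>free_mod X\<^esub> t = t"
      by (rule FC_eqI[OF _ t]) (use t FC_D[OF t] cadd_FC[OF czero_FC] in \<open>auto simp: free_mod_add czero_def\<close>)
    have "cdiff X (czero X) t \<oplus>\<^bsub>free_mod X\<^esub> t = czero X"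
      unfolding free_mod_add czero_def[of X] cdiff_def
      by (rule restrict_ext) (use FC_D[OF t] in \<open>simp add: a_minus_def l_neg\<close>)
    then show "\<exists>u\<in>carrier (free_mod X). u \<oplus>\<^bsub>free_mod X\<^esub> t = \<zero>\<^bsub>free_mod X\<^esub>"
      using cdiff_FC[OF czero_FC t] by auto
  qed (simp add: czero_FC)
  show ?thesis
  proof (intro left_module.intro ring_axioms g left_module_axioms.intro)
    fix r t assume r: "r \<in> carrier R" and t': "t \<in> carrier (free_mod X)"
    then have t: "t \<in> FC X" by simp
    show "r \<odot>\<^bsub>free_mod X\<^esub> t \<in> carrier (free_mod X)" using csmult_FC[OF r t] by simp
    { fix s assume s: "s \<in> carrier R"
      show "(r \<oplus> s) \<odot>\<^bsub>free_mod X\<^esub> t = r \<odot>\<^bsub>free_mod X\<^esub> t \<oplus>\<^bsub>free_mod X\<^esub> s \<odot>\<^bsub>free_mod X\<^esub> t"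
        unfolding free_mod_add free_mod_smult
        by (rule restrict_ext) (use FC_D[OF t] r s in \<open>simp add: l_distr\<close>)
      show "(r \<otimes> s) \<odot>\<^bsub>free_mod X\<^esub> t = r \<odot>\<^bsub>free_mod X\<^esub> (s \<odot>\<^bsub>free_mod X\<^esub> t)"
        unfolding free_mod_smult
        by (rule restrict_ext) (use FC_D[OF t] r s in \<open>simp add: m_assoc\<close>) }
    fix u assume "u \<in> carrier (free_mod X)"
    then have u: "u \<in> FC X" by simp
    show "r \<odot>\<^bsub>free_mod X\<^esub> (t \<oplus>\<^bsub>free_mod X\<^esub> u) = r \<odot>\<^bsub>free_mod X\<^esub> t \<oplus>\<^bsub>free_mod X\<^esub> r \<odot>\<^bsub>free_mod X\<^esub> u"
      unfolding free_mod_add free_mod_smult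
      by (rule restrict_ext) (use FC_D[OF t] FC_D[OF u] r in \<open>simp add: r_distr\<close>)
  next
    fix t assume "t \<in> carrier (free_mod X)"
    then have t: "t \<in> FC X" by simp
    show "\<one> \<odot>\<^bsub>free_mod X\<^esub> t = t"
      by (rule FC_eqI[OF csmult_FC[OF one_closed t] t]) (use FC_D[OF t] in \<open>simp add: free_mod_smult\<close>)
  qed
qed

lemma abelian_group_free_mod: "abelian_group (free_mod X)"
  using left_module_free_mod by (rule left_module.axioms)

lemma free_mod_minus:
  assumes t: "t \<in> FC X" and u: "u \<in> FC X"
  shows "t \<ominus>\<^bsub>free_mod X\<^esub> u = cdiff X t u"
proof -
  interpret F: abelian_group "free_mod X" by (rule abelian_group_free_mod)
  have "cdiff X t u \<oplus>\<^bsub>free_mod X\<^esub> u = t"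
    by (rule FC_eqI[OF cadd_FC[OF cdiff_FC[OF t u] u] t])
       (use FC_D[OF t] FC_D[OF u] in \<open>simp add: free_mod_add cdiff_def a_minus_def a_assoc l_neg\<close>)
  then have "t \<ominus>\<^bsub>free_mod X\<^esub> u = cdiff X t u \<oplus>\<^bsub>free_mod X\<^esub> u \<ominus>\<^bsub>free_mod X\<^esub> u" by simp
  also have "\<dots> = cdiff X t u"
    by (rule F.add_minus_cancel(1)) (simp_all add: cdiff_FC t u)
  finally show ?thesis .
qed

lemma lincomb_add_left:
  assumes t: "t \<in> FC Y" and u: "u \<in> FC Y" and w: "\<And>y. y \<in> Y \<Longrightarrow> w y \<in> FC X"
  shows "lincomb Y X w (t \<oplus>\<^bsub>free_mod Y\<^esub> u) = lincomb Y X w t \<oplus>\<^bsub>free_mod X\<^esub> lincomb Y X w u"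
proof (rule FC_eqI)
  show "lincomb Y X w (t \<oplus>\<^bsub>free_mod Y\<^esub> u) \<in> FC X" by (intro lincomb_FC cadd_FC t u w)
  show "lincomb Y X w t \<oplus>\<^bsub>free_mod X\<^esub> lincomb Y X w u \<in> FC X" by (intro lincomb_FC cadd_FC t u w)
  fix j assume j: "j \<in> X"
  note n = nullfam_lincomb[OF t w j] nullfam_lincomb[OF u w j]
  have "tsum (\<lambda>y. (t \<oplus>\<^bsub>free_mod Y\<^esub> u) y \<otimes> w y j) Y = tsum (\<lambda>y. t y \<otimes> w y j \<oplus> u y \<otimes> w y j) Y"
    by (rule tsum_cong[OF refl _ nullfam_add[OF n]])
       (use FC_D[OF t] FC_D[OF u] FC_D[OF w j] in \<open>auto simp: free_mod_add l_distr\<close>)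
  then show "lincomb Y X w (t \<oplus>\<^bsub>free_mod Y\<^esub> u) j = (lincomb Y X w t \<oplus>\<^bsub>free_mod X\<^esub> lincomb Y X w u) j"
    using j tsum_add[OF n] by (simp add: lincomb_def free_mod_add)
qed

lemma lincomb_add_right:
  assumes t: "t \<in> FC Y" and v: "\<And>y. y \<in> Y \<Longrightarrow> v y \<in> FC X" and w: "\<And>y. y \<in> Y \<Longrightarrow> w y \<in> FC X"
  shows "lincomb Y X (\<lambda>y. v y \<oplus>\<^bsub>free_mod X\<^esub> w y) t = lincomb Y X v t \<oplus>\<^bsub>free_mod X\<^esub> lincomb Y X w t"
proof (rule FC_eqI)
  show "lincomb Y X (\<lambda>y. v y \<oplus>\<^bsub>free_mod X\<^esub> w y) t \<in> FC X" by (intro lincomb_FC cadd_FC t v w)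
  show "lincomb Y X v t \<oplus>\<^bsub>free_mod X\<^esub> lincomb Y X w t \<in> FC X" by (intro lincomb_FC cadd_FC t v w)
  fix j assume j: "j \<in> X"
  note n = nullfam_lincomb[OF t v j] nullfam_lincomb[OF t w j]
  have "tsum (\<lambda>y. t y \<otimes> (v y \<oplus>\<^bsub>free_mod X\<^esub> w y) j) Y = tsum (\<lambda>y. t y \<otimes> v y j \<oplus> t y \<otimes> w y j) Y"
    by (rule tsum_cong[OF refl _ nullfam_add[OF n]])
       (use FC_D[OF t] FC_D[OF v j] FC_D[OF w j] j in \<open>auto simp: free_mod_add r_distr\<close>)
  then show "lincomb Y X (\<lambda>y. v y \<oplus>\<^bsub>free_mod X\<^esub> w y) t j = (lincomb Y X v t \<oplus>\<^bsub>free_mod X\<^esub> lincomb Y X w t) j"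
    using j tsum_add[OF n] by (simp add: lincomb_def free_mod_add)
qed

lemma lincomb_diff_right:
  assumes t: "t \<in> FC Y" and v: "\<And>y. y \<in> Y \<Longrightarrow> v y \<in> FC X" and w: "\<And>y. y \<in> Y \<Longrightarrow> w y \<in> FC X"
  shows "lincomb Y X (\<lambda>y. cdiff X (v y) (w y)) t = cdiff X (lincomb Y X v t) (lincomb Y X w t)"
proof -
  interpret F: abelian_group "free_mod X" by (rule abelian_group_free_mod)
  have e: "cdiff X (v y) (w y) \<oplus>\<^bsub>free_mod X\<^esub> w y = v y" if "y \<in> Y" for y
    unfolding free_mod_minus[OF v[OF that] w[OF that], symmetric]
    by (rule F.add_minus_cancel(2)) (simp_all add: v w that)
  have "lincomb Y X v t = lincomb Y X (\<lambda>y. cdiff X (v y) (w y) \<oplus>\<^bsub>free_mod X\<^esub> w y) t"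
    by (rule lincomb_cong[symmetric]) (use e t v in auto)
  also have "\<dots> = lincomb Y X (\<lambda>y. cdiff X (v y) (w y)) t \<oplus>\<^bsub>free_mod X\<^esub> lincomb Y X w t"
    by (rule lincomb_add_right[OF t _ w]) (intro cdiff_FC v w)
  finally have "lincomb Y X v t \<ominus>\<^bsub>free_mod X\<^esub> lincomb Y X w t = lincomb Y X (\<lambda>y. cdiff X (v y) (w y)) t"
    using F.add_minus_cancel(1)[of "lincomb Y X (\<lambda>y. cdiff X (v y) (w y)) t" "lincomb Y X w t"]
      lincomb_FC[OF t cdiff_FC[OF v w]] lincomb_FC[OF t w] by simp
  moreover have "lincomb Y X v t \<in> FC X" "lincomb Y X w t \<in> FC X" by (intro lincomb_FC t v w; assumption)+
  ultimately show ?thesis by (simp add: free_mod_minus)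
qed

text \<open>Row \<open>i\<close> is the image of the basis element \<open>i\<close> under an
  endomorphism of the free contramodule. Rows are multiplied from the right, so a product A B stands
  for the composite in which A is applied first.\<close>

definition mat_ring :: "'x set \<Rightarrow> ('x \<Rightarrow> 'x \<Rightarrow> 'a) ring" where
  "mat_ring X = \<lparr>carrier = X \<rightarrow>\<^sub>E FC X, mult = (\<lambda>A B. \<lambda>i\<in>X. lincomb X X B (A i)), one = (\<lambda>i\<in>X. cunit X i),
     zero = (\<lambda>i\<in>X. czero X), add = (\<lambda>A B. \<lambda>i\<in>X. A i \<oplus>\<^bsub>free_mod X\<^esub> B i)\<rparr>"

lemma mat_ring_simps [simp]:
  "carrier (mat_ring X) = X \<rightarrow>\<^sub>E FC X" "\<one>\<^bsub>mat_ring X\<^esub> = (\<lambda>i\<in>X. cunit X i)" "\<zero>\<^bsub>mat_ring X\<^esub> = (\<lambda>i\<in>X. czero X)"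
  "A \<otimes>\<^bsub>mat_ring X\<^esub> B = (\<lambda>i\<in>X. lincomb X X B (A i))"
  "A \<oplus>\<^bsub>mat_ring X\<^esub> B = (\<lambda>i\<in>X. A i \<oplus>\<^bsub>free_mod X\<^esub> B i)"
  by (simp_all add: mat_ring_def)

lemma ring_mat_ring: "ring (mat_ring X)"
proof -
  interpret F: abelian_group "free_mod X" by (rule abelian_group_free_mod)
  let ?M = "mat_ring X"
  have row: "A i \<in> FC X" if "A \<in> X \<rightarrow>\<^sub>E FC X" "i \<in> X" for A i using that by (rule PiE_mem)
  show ?thesis
  proof (rule ringI)
    show "abelian_group ?M"
    proof (rule abelian_groupI)
      fix A B C assume "A \<in> carrier ?M" "B \<in> carrier ?M" "C \<in> carrier ?M"
      then have c: "A \<in> X \<rightarrow>\<^sub>E FC X" "B \<in> X \<rightarrow>\<^sub>E FC X" "C \<in> X \<rightarrow>\<^sub>E FC X" by simp_all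
      show "A \<oplus>\<^bsub>?M\<^esub> B \<oplus>\<^bsub>?M\<^esub> C = A \<oplus>\<^bsub>?M\<^esub> (B \<oplus>\<^bsub>?M\<^esub> C)"
        unfolding mat_ring_simps
        by (rule restrict_ext) (use row[OF c(1)] row[OF c(2)] row[OF c(3)] F.a_assoc in simp)
    next
      fix A B assume "A \<in> carrier ?M" "B \<in> carrier ?M"
      then have c: "A \<in> X \<rightarrow>\<^sub>E FC X" "B \<in> X \<rightarrow>\<^sub>E FC X" by simp_all
      show "A \<oplus>\<^bsub>?M\<^esub> B \<in> carrier ?M" using cadd_FC[OF row[OF c(1)] row[OF c(2)]] by simp
      show "A \<oplus>\<^bsub>?M\<^esub> B = B \<oplus>\<^bsub>?M\<^esub> A"
        unfolding mat_ring_simps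
        by (rule restrict_ext) (use row[OF c(1)] row[OF c(2)] F.a_comm in simp)
    next
      fix A assume "A \<in> carrier ?M"
      then have c: "A \<in> X \<rightarrow>\<^sub>E FC X" by simp
      show "\<zero>\<^bsub>?M\<^esub> \<oplus>\<^bsub>?M\<^esub> A = A"
        by (rule PiE_ext[OF _ c])
           (use row[OF c] cadd_FC[OF czero_FC row[OF c]] F.l_zero in auto)
      have "(\<lambda>i\<in>X. \<ominus>\<^bsub>free_mod X\<^esub> A i) \<oplus>\<^bsub>?M\<^esub> A = \<zero>\<^bsub>?M\<^esub>"
        unfolding mat_ring_simps
        by (rule restrict_ext) (use row[OF c] F.l_neg in simp)
      moreover have "(\<lambda>i\<in>X. \<ominus>\<^bsub>free_mod X\<^esub> A i) \<in> carrier ?M"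
        using row[OF c] F.a_inv_closed by simp
      ultimately show "\<exists>B\<in>carrier ?M. B \<oplus>\<^bsub>?M\<^esub> A = \<zero>\<^bsub>?M\<^esub>" by blast
    qed (simp add: czero_FC)
    show "Group.monoid ?M"
    proof (rule monoidI)
      fix A B C assume "A \<in> carrier ?M" "B \<in> carrier ?M" "C \<in> carrier ?M"
      then have c: "A \<in> X \<rightarrow>\<^sub>E FC X" "B \<in> X \<rightarrow>\<^sub>E FC X" "C \<in> X \<rightarrow>\<^sub>E FC X" by simp_all
      show "A \<otimes>\<^bsub>?M\<^esub> B \<otimes>\<^bsub>?M\<^esub> C = A \<otimes>\<^bsub>?M\<^esub> (B \<otimes>\<^bsub>?M\<^esub> C)"
        unfolding mat_ring_simps
      proof (rule restrict_ext)
        fix i assume i: "i \<in> X"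
        have "lincomb X X C (lincomb X X B (A i)) = lincomb X X (\<lambda>j. lincomb X X C (B j)) (A i)"
          by (rule lincomb_assoc) (use row[OF c(1) i] row[OF c(2)] row[OF c(3)] in auto)
        also have "\<dots> = lincomb X X (\<lambda>j\<in>X. lincomb X X C (B j)) (A i)"
          by (rule lincomb_cong) (use row[OF c(1) i] lincomb_FC[OF row[OF c(2)] row[OF c(3)]] in auto)
        finally show "lincomb X X C ((\<lambda>i\<in>X. lincomb X X B (A i)) i) =
            lincomb X X (\<lambda>j\<in>X. lincomb X X C (B j)) (A i)" using i by simp
      qed
    next
      fix A B assume "A \<in> carrier ?M" "B \<in> carrier ?M"
      then have c: "A \<in> X \<rightarrow>\<^sub>E FC X" "B \<in> X \<rightarrow>\<^sub>E FC X" by simp_all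
      show "A \<otimes>\<^bsub>?M\<^esub> B \<in> carrier ?M" using lincomb_FC[OF row[OF c(1)] row[OF c(2)]] by simp
    next
      fix A assume "A \<in> carrier ?M"
      then have c: "A \<in> X \<rightarrow>\<^sub>E FC X" by simp
      show "\<one>\<^bsub>?M\<^esub> \<otimes>\<^bsub>?M\<^esub> A = A"
        by (rule PiE_ext[OF _ c])
           (use lincomb_FC[OF unit_FC row[OF c]] lincomb_unit_left[OF _ row[OF c]] in auto)
      have "lincomb X X (\<lambda>i\<in>X. cunit X i) (A i) = A i" if i: "i \<in> X" for i
      proof -
        have "lincomb X X (\<lambda>i\<in>X. cunit X i) (A i) = lincomb X X (cunit X) (A i)"
          by (rule lincomb_cong) (use row[OF c i] unit_FC in auto)
        then show ?thesis using lincomb_unit_right[OF row[OF c i]] by simp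
      qed
      then show "A \<otimes>\<^bsub>?M\<^esub> \<one>\<^bsub>?M\<^esub> = A"
        by (intro PiE_ext[OF _ c]) (use row[OF c] in auto)
    qed (simp add: unit_FC)
  next
    fix A B C assume "A \<in> carrier ?M" "B \<in> carrier ?M" "C \<in> carrier ?M"
    then have c: "A \<in> X \<rightarrow>\<^sub>E FC X" "B \<in> X \<rightarrow>\<^sub>E FC X" "C \<in> X \<rightarrow>\<^sub>E FC X" by simp_all
    show "(A \<oplus>\<^bsub>?M\<^esub> B) \<otimes>\<^bsub>?M\<^esub> C = A \<otimes>\<^bsub>?M\<^esub> C \<oplus>\<^bsub>?M\<^esub> B \<otimes>\<^bsub>?M\<^esub> C"
      unfolding mat_ring_simps
      by (rule restrict_ext) (use lincomb_add_left[OF row[OF c(1)] row[OF c(2)] row[OF c(3)]] in simp)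
    show "C \<otimes>\<^bsub>?M\<^esub> (A \<oplus>\<^bsub>?M\<^esub> B) = C \<otimes>\<^bsub>?M\<^esub> A \<oplus>\<^bsub>?M\<^esub> C \<otimes>\<^bsub>?M\<^esub> B"
      unfolding mat_ring_simps
    proof (rule restrict_ext)
      fix i assume i: "i \<in> X"
      have "lincomb X X (\<lambda>j\<in>X. A j \<oplus>\<^bsub>free_mod X\<^esub> B j) (C i) = lincomb X X (\<lambda>j. A j \<oplus>\<^bsub>free_mod X\<^esub> B j) (C i)"
        by (rule lincomb_cong) (use row[OF c(3) i] cadd_FC[OF row[OF c(1)] row[OF c(2)]] in auto)
      also have "\<dots> = lincomb X X A (C i) \<oplus>\<^bsub>free_mod X\<^esub> lincomb X X B (C i)"
        by (rule lincomb_add_right[OF row[OF c(3) i] row[OF c(1)] row[OF c(2)]])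
      finally show "lincomb X X (\<lambda>j\<in>X. A j \<oplus>\<^bsub>free_mod X\<^esub> B j) (C i)
        = (\<lambda>i\<in>X. lincomb X X A (C i)) i \<oplus>\<^bsub>free_mod X\<^esub> (\<lambda>i\<in>X. lincomb X X B (C i)) i" using i by simp
    qed
  qed
qed

section \<open>Entries of matrices\<close>

lemma mat_row: "A \<in> carrier (mat_ring X) \<Longrightarrow> i \<in> X \<Longrightarrow> A i \<in> FC X"
  by (auto dest: PiE_mem)

lemma mat_entry: "A \<in> carrier (mat_ring X) \<Longrightarrow> i \<in> X \<Longrightarrow> j \<in> X \<Longrightarrow> A i j \<in> carrier R"
  by (rule FC_D[OF mat_row])

lemma mat_minus:
  assumes A: "A \<in> carrier (mat_ring X)" and B: "B \<in> carrier (mat_ring X)"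
  shows "A \<ominus>\<^bsub>mat_ring X\<^esub> B = (\<lambda>i\<in>X. cdiff X (A i) (B i))"
proof -
  interpret M: ring "mat_ring X" by (rule ring_mat_ring)
  let ?D = "\<lambda>i\<in>X. cdiff X (A i) (B i)"
  have D: "?D \<in> carrier (mat_ring X)" using cdiff_FC[OF mat_row[OF A] mat_row[OF B]] by simp
  have "?D \<oplus>\<^bsub>mat_ring X\<^esub> B = A"
  proof (rule PiE_ext[of _ X "\<lambda>_. FC X"])
    show "?D \<oplus>\<^bsub>mat_ring X\<^esub> B \<in> X \<rightarrow>\<^sub>E FC X" using M.a_closed[OF D B] by simp
    show "A \<in> X \<rightarrow>\<^sub>E FC X" using A by simp
    fix i assume i: "i \<in> X"
    have "cdiff X (A i) (B i) \<oplus>\<^bsub>free_mod X\<^esub> B i = A i"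
      using abelian_group.add_minus_cancel(2)[OF abelian_group_free_mod, of "A i" X "B i"]
        mat_row[OF A i] mat_row[OF B i] free_mod_minus[OF mat_row[OF A i] mat_row[OF B i]] by simp
    then show "(?D \<oplus>\<^bsub>mat_ring X\<^esub> B) i = A i" using i by simp
  qed
  then show ?thesis using M.add_minus_cancel(1)[OF D B] by simp
qed

lemma mat_minus_entry:
  assumes "A \<in> carrier (mat_ring X)" "B \<in> carrier (mat_ring X)" "i \<in> X" "j \<in> X"
  shows "(A \<ominus>\<^bsub>mat_ring X\<^esub> B) i j = A i j \<ominus> B i j"
  using assms(3,4) unfolding mat_minus[OF assms(1,2)] by (simp add: cdiff_def)

lemma mat_add_entry:
  assumes "i \<in> X" "j \<in> X"
  shows "(A \<oplus>\<^bsub>mat_ring X\<^esub> B) i j = A i j \<oplus> B i j"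
  using assms by (simp add: free_mod_add)

lemma mat_zero_entry: "i \<in> X \<Longrightarrow> j \<in> X \<Longrightarrow> \<zero>\<^bsub>mat_ring X\<^esub> i j = \<zero>"
  by (simp add: czero_def)

lemma mat_mult_entry: "i \<in> X \<Longrightarrow> j \<in> X \<Longrightarrow> (A \<otimes>\<^bsub>mat_ring X\<^esub> B) i j = tsum (\<lambda>l. A i l \<otimes> B l j) X"
  by (simp add: lincomb_def)

lemma nullfam_mat_mult:
  assumes "A \<in> carrier (mat_ring X)" "B \<in> carrier (mat_ring X)" "i \<in> X" "j \<in> X"
  shows "nullfam (\<lambda>l. A i l \<otimes> B l j) X"
  by (rule nullfam_lincomb[OF mat_row[OF assms(1,3)] mat_row[OF assms(2)] assms(4)])

lemma mat_eqI:
  assumes "A \<in> carrier (mat_ring X)" "B \<in> carrier (mat_ring X)"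
    "\<And>i j. i \<in> X \<Longrightarrow> j \<in> X \<Longrightarrow> A i j = B i j"
  shows "A = B"
proof (rule PiE_ext[of _ X "\<lambda>_. FC X"])
  show "A i = B i" if "i \<in> X" for i
    by (rule FC_eqI[OF mat_row[OF assms(1) that] mat_row[OF assms(2) that]]) (rule assms(3)[OF that])
qed (use assms in simp_all)

lemma mat_additive_subgroupI:
  assumes S: "S \<subseteq> carrier (mat_ring X)" and z: "\<zero>\<^bsub>mat_ring X\<^esub> \<in> S"
    and d: "\<And>A B. A \<in> S \<Longrightarrow> B \<in> S \<Longrightarrow> A \<ominus>\<^bsub>mat_ring X\<^esub> B \<in> S"
  shows "additive_subgroup S (mat_ring X)"
proof -
  interpret M: ring "mat_ring X" by (rule ring_mat_ring)
  have neg: "\<ominus>\<^bsub>mat_ring X\<^esub> A \<in> S" if "A \<in> S" for A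
    using d[OF z that] M.l_zero[OF M.a_inv_closed] that S unfolding M.minus_eq by (metis subsetD)
  show ?thesis
  proof (rule additive_subgroup.intro, rule M.add.subgroupI)
    show "S \<noteq> {}" using z by blast
    show "A \<oplus>\<^bsub>mat_ring X\<^esub> B \<in> S" if "A \<in> S" "B \<in> S" for A B
      using d[OF that(1) neg[OF that(2)]] M.minus_minus that S unfolding M.minus_eq by (metis subsetD)
  qed (use S neg in auto)
qed

definition mat_base :: "'x set \<Rightarrow> ('x \<Rightarrow> 'x \<Rightarrow> 'a) set set" where
  "mat_base X = {{A \<in> carrier (mat_ring X). \<forall>j\<in>X. A i j \<in> U} |i U. i \<in> X \<and> U \<in> ORI}"

lemma mat_baseI: "i \<in> X \<Longrightarrow> U \<in> ORI \<Longrightarrow> {A \<in> carrier (mat_ring X). \<forall>j\<in>X. A i j \<in> U} \<in> mat_base X"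
  unfolding mat_base_def by blast

lemma mat_baseE:
  assumes "W \<in> mat_base X"
  obtains i U where "i \<in> X" "U \<in> ORI" "W = {A \<in> carrier (mat_ring X). \<forall>j\<in>X. A i j \<in> U}"
  using assms unfolding mat_base_def by blast

lemma finsum_mat_entry:
  assumes D: "\<And>n. n \<in> F \<Longrightarrow> D n \<in> carrier (mat_ring X)" and F: "finite F" and i: "i \<in> X" and j: "j \<in> X"
  shows "finsum (mat_ring X) D F i j = finsum R (\<lambda>n. D n i j) F"
proof -
  interpret M: ring "mat_ring X" by (rule ring_mat_ring)
  show ?thesis
    using F D
  proof (induction F rule: finite_induct)
    case empty
    show ?case using mat_zero_entry[OF i j] by simp
  next
    case (insert n F)
    have "finsum (mat_ring X) D (insert n F) = D n \<oplus>\<^bsub>mat_ring X\<^esub> finsum (mat_ring X) D F"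
      by (rule M.finsum_insert) (use insert in auto)
    moreover have "finsum R (\<lambda>n. D n i j) (insert n F) = D n i j \<oplus> finsum R (\<lambda>n. D n i j) F"
      by (rule finsum_insert) (use insert mat_entry[OF _ i j] in auto)
    moreover have "finsum (mat_ring X) D F i j = finsum R (\<lambda>n. D n i j) F" using insert by blast
    ultimately show ?case by (simp only: mat_add_entry[OF i j])
  qed
qed

text \<open>A row with entries in a right ideal \<open>U\<close> keeps this property under right
  multiplication. In a product A s(n), only the finitely many entries of row \<open>i\<close> of A
  outside \<open>U\<close> impose a condition on the rows of s(n). Series are summed entry by
  entry.\<close>

lemma seq_complete_mat_ring: "seq_complete_ring (mat_ring X) (mat_base X)"
proof -
  let ?M = "mat_ring X"
  interpret M: ring ?M by (rule ring_mat_ring)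
  show ?thesis
  proof (intro seq_complete_ring.intro seq_complete_ring_axioms.intro ring_mat_ring)
    fix W assume "W \<in> mat_base X"
    then obtain i U where iU: "i \<in> X" "U \<in> ORI" "W = {A \<in> carrier ?M. \<forall>j\<in>X. A i j \<in> U}" by (rule mat_baseE)
    have W: "A \<in> W \<longleftrightarrow> A \<in> carrier ?M \<and> (\<forall>j\<in>X. A i j \<in> U)" for A unfolding iU(3) by blast
    note U = ORI_OS[OF iU(2)]
    show "right_ideal ?M W"
      unfolding right_ideal_def
    proof (intro conjI ballI)
      show "additive_subgroup W ?M"
      proof (rule mat_additive_subgroupI)
        show "\<zero>\<^bsub>?M\<^esub> \<in> W" unfolding W using mat_zero_entry[OF iU(1)] OS_zero[OF U] M.zero_closed by simp
        fix A B assume "A \<in> W" "B \<in> W"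
        then show "A \<ominus>\<^bsub>?M\<^esub> B \<in> W"
          unfolding W using mat_minus_entry[of A X B i] iU(1) OS_diff[OF U] M.minus_closed by metis
      qed (use W in blast)
      fix A B assume A: "A \<in> W" and B: "B \<in> carrier ?M"
      have Ac: "A \<in> carrier ?M" and AU: "\<And>j. j \<in> X \<Longrightarrow> A i j \<in> U" using A unfolding W by blast+
      have "(A \<otimes>\<^bsub>?M\<^esub> B) i j \<in> U" if j: "j \<in> X" for j
        unfolding mat_mult_entry[OF iU(1) j]
        by (rule tsum_OS[OF nullfam_mat_mult[OF Ac B iU(1) j] U ORI_mult[OF iU(2) AU mat_entry[OF B _ j]]])
      then show "A \<otimes>\<^bsub>?M\<^esub> B \<in> W" unfolding W using M.m_closed[OF Ac B] by blast
    qed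
    { fix A and s :: "nat \<Rightarrow> _"
      assume A: "A \<in> carrier ?M" and s: "\<And>n. s n \<in> carrier ?M"
        and ev: "\<And>W. W \<in> mat_base X \<Longrightarrow> \<forall>\<^sub>F n in sequentially. s n \<in> W"
      let ?F = "{l \<in> X. A i l \<notin> U}"
      have F: "finite ?F" by (rule nullfam_fin[OF FC_nullfam[OF mat_row[OF A iU(1)]] U])
      have "\<forall>l\<in>?F. \<forall>\<^sub>F n in sequentially. \<forall>j\<in>X. A i l \<otimes> s n l j \<in> U"
      proof
        fix l assume l: "l \<in> ?F"
        then obtain V where V: "V \<in> ORI" "\<And>v. v \<in> V \<Longrightarrow> A i l \<otimes> v \<in> U"
          using ORI_mult_left[OF mat_entry[OF A iU(1)] U] by blast
        have "\<forall>\<^sub>F n in sequentially. s n \<in> {A \<in> carrier ?M. \<forall>j\<in>X. A l j \<in> V}"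
          by (rule ev, rule mat_baseI) (use l V in auto)
        then show "\<forall>\<^sub>F n in sequentially. \<forall>j\<in>X. A i l \<otimes> s n l j \<in> U"
          by (rule eventually_mono) (use V(2) in blast)
      qed
      then have "\<forall>\<^sub>F n in sequentially. \<forall>l\<in>?F. \<forall>j\<in>X. A i l \<otimes> s n l j \<in> U"
        by (rule eventually_ball_finite[OF F])
      then show "\<forall>\<^sub>F n in sequentially. A \<otimes>\<^bsub>?M\<^esub> s n \<in> W"
      proof (rule eventually_mono)
        fix n assume n: "\<forall>l\<in>?F. \<forall>j\<in>X. A i l \<otimes> s n l j \<in> U"
        have "(A \<otimes>\<^bsub>?M\<^esub> s n) i j \<in> U" if j: "j \<in> X" for j
          unfolding mat_mult_entry[OF iU(1) j]
        proof (rule tsum_OS[OF nullfam_mat_mult[OF A s iU(1) j] U])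
          fix l assume l: "l \<in> X"
          show "A i l \<otimes> s n l j \<in> U"
          proof (cases "A i l \<in> U")
            case True
            then show ?thesis by (rule ORI_mult[OF iU(2) _ mat_entry[OF s l j]])
          qed (use n l j in blast)
        qed
        then show "A \<otimes>\<^bsub>?M\<^esub> s n \<in> W" unfolding W using M.m_closed[OF A s] by blast
      qed }
  next
    fix A assume A: "A \<in> carrier ?M" and W: "\<And>W. W \<in> mat_base X \<Longrightarrow> A \<in> W"
    show "A = \<zero>\<^bsub>?M\<^esub>"
    proof (rule mat_eqI[OF A M.zero_closed])
      fix i j assume ij: "i \<in> X" "j \<in> X"
      show "A i j = \<zero>\<^bsub>?M\<^esub> i j"
        unfolding mat_zero_entry[OF ij]
      proof (rule eqI[OF mat_entry[OF A ij] zero_closed])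
        fix U assume "U \<in> ORI"
        from W[OF mat_baseI[OF ij(1) this]] show "A i j \<ominus> \<zero> \<in> U"
          using ij mat_entry[OF A ij] by (simp add: a_minus_def)
      qed
    qed
  next
    fix D :: "nat \<Rightarrow> _"
    assume D: "\<And>n. D n \<in> carrier ?M" and ev: "\<And>W. W \<in> mat_base X \<Longrightarrow> \<forall>\<^sub>F n in sequentially. D n \<in> W"
    have evD: "\<exists>N. \<forall>n\<ge>N. \<forall>j\<in>X. D n i j \<in> U" if "i \<in> X" "U \<in> ORI" for i U
      using ev[OF mat_baseI[OF that]] unfolding eventually_sequentially by blast
    \<comment> \<open>Nullity over the pairs (n, j), and not merely over n for each j, is what makes
      the entrywise sums form a row in \<open>FC X\<close>.\<close>
    have n: "nullfam (\<lambda>(n, j). D n i j) (UNIV \<times> X)" if i: "i \<in> X" for i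
    proof (rule nullfam_ORI)
      show "(\<lambda>(n, j). D n i j) \<in> UNIV \<times> X \<rightarrow> carrier R" using mat_entry[OF D i] by auto
      fix U assume U: "U \<in> ORI"
      obtain N where N: "\<And>n j. n \<ge> N \<Longrightarrow> j \<in> X \<Longrightarrow> D n i j \<in> U" using evD[OF i U] by blast
      have "finite (SIGMA n:{..<N}. {j \<in> X. D n i j \<notin> U})"
        using nullfam_fin[OF FC_nullfam[OF mat_row[OF D i]] ORI_OS[OF U]] by (intro finite_SigmaI) auto
      then show "finite {p \<in> UNIV \<times> X. (case p of (n, j) \<Rightarrow> D n i j) \<notin> U}"
        by (rule rev_finite_subset) (use N in \<open>force simp: not_less[symmetric]\<close>)
    qed
    have nn: "nullfam (\<lambda>n. D n i j) UNIV" if ij: "i \<in> X" "j \<in> X" for i j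
    proof -
      have "nullfam (\<lambda>(n, j). D n i j) (range (\<lambda>n. (n, j)))" by (rule nullfam_subset[OF n[OF ij(1)]]) (use ij in auto)
      from tsum_reindex(1)[OF this] show ?thesis by (simp add: inj_on_def)
    qed
    define l where "l = (\<lambda>i\<in>X. \<lambda>j\<in>X. tsum (\<lambda>n. D n i j) UNIV)"
    have l: "l \<in> carrier ?M" using restrict_FC[OF tsum_swap(2)[OF n]] by (simp add: l_def)
    show "\<exists>l\<in>carrier ?M. \<forall>W\<in>mat_base X. \<forall>\<^sub>F n in sequentially. finsum ?M D {..<n} \<ominus>\<^bsub>?M\<^esub> l \<in> W"
    proof (intro bexI[OF _ l] ballI)
      fix W assume "W \<in> mat_base X"
      then obtain i U where iU: "i \<in> X" "U \<in> ORI" "W = {A \<in> carrier ?M. \<forall>j\<in>X. A i j \<in> U}" by (rule mat_baseE)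
      obtain N where N: "\<And>n j. n \<ge> N \<Longrightarrow> j \<in> X \<Longrightarrow> D n i j \<in> U" using evD[OF iU(1,2)] by blast
      note U = ORI_OS[OF iU(2)]
      have c: "finsum ?M D {..<n} \<in> carrier ?M" for n by (rule M.finsum_closed) (use D in auto)
      have "(finsum ?M D {..<n} \<ominus>\<^bsub>?M\<^esub> l) i j \<in> U" if n: "n \<ge> N" and j: "j \<in> X" for n j
      proof -
        have e: "(finsum ?M D {..<n} \<ominus>\<^bsub>?M\<^esub> l) i j = finsum R (\<lambda>n. D n i j) {..<n} \<ominus> tsum (\<lambda>n. D n i j) UNIV"
          unfolding mat_minus_entry[OF c l iU(1) j] finsum_mat_entry[OF D finite_lessThan iU(1) j]
          using iU(1) j by (simp add: l_def)
        have "tsum (\<lambda>n. D n i j) UNIV \<ominus> finsum R (\<lambda>n. D n i j) {..<n} \<in> U"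
          by (rule tsum_mod[OF nn[OF iU(1) j] U]) (use N n j in auto)
        then show ?thesis unfolding e
          by (rule diff_sym[OF U _ tsum_closed[OF nn[OF iU(1) j]] finsum_closed]) (use mat_entry[OF D iU(1) j] in auto)
      qed
      then show "\<forall>\<^sub>F n in sequentially. finsum ?M D {..<n} \<ominus>\<^bsub>?M\<^esub> l \<in> W"
        unfolding eventually_sequentially iU(3) using M.minus_closed[OF c l] by blast
    qed
  qed
qed

section \<open>Matrices with entries in a closed ideal\<close>


definition mat_ideal :: "'x set \<Rightarrow> 'a set \<Rightarrow> ('x \<Rightarrow> 'x \<Rightarrow> 'a) set" where
  "mat_ideal X H = {A \<in> carrier (mat_ring X). \<forall>i\<in>X. \<forall>j\<in>X. A i j \<in> H}"

lemma ideal_diff: "ideal I R \<Longrightarrow> x \<in> I \<Longrightarrow> y \<in> I \<Longrightarrow> x \<ominus> y \<in> I"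
  unfolding a_minus_def using additive_subgroup.a_closed additive_subgroup.a_inv_closed
  by (metis ideal.axioms(1))

text \<open>The entries of a product are infinite sums of elements of \<open>H\<close>, and they
  stay in \<open>H\<close> because \<open>H\<close> is closed.\<close>

lemma ideal_mat_ideal:
  assumes H: "ideal H R" and cl: "closedin T H"
  shows "ideal (mat_ideal X H) (mat_ring X)"
proof -
  interpret M: ring "mat_ring X" by (rule ring_mat_ring)
  interpret H: ideal H R by (rule H)
  have s: "additive_subgroup H R" by (rule H.additive_subgroup_axioms)
  show ?thesis
  proof (rule idealI[OF ring_mat_ring])
    have "additive_subgroup (mat_ideal X H) (mat_ring X)"
    proof (rule mat_additive_subgroupI)
      show "mat_ideal X H \<subseteq> carrier (mat_ring X)" by (auto simp: mat_ideal_def)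
      show "\<zero>\<^bsub>mat_ring X\<^esub> \<in> mat_ideal X H"
        using M.zero_closed mat_zero_entry H.zero_closed by (auto simp: mat_ideal_def czero_def)
      fix A B assume "A \<in> mat_ideal X H" "B \<in> mat_ideal X H"
      then have c: "A \<in> carrier (mat_ring X)" "B \<in> carrier (mat_ring X)"
        and e: "\<And>i j. i \<in> X \<Longrightarrow> j \<in> X \<Longrightarrow> A i j \<in> H \<and> B i j \<in> H" unfolding mat_ideal_def by blast+
      have "(A \<ominus>\<^bsub>mat_ring X\<^esub> B) i j \<in> H" if "i \<in> X" "j \<in> X" for i j
        unfolding mat_minus_entry[OF c that] using e[OF that] ideal_diff[OF H] by blast
      then show "A \<ominus>\<^bsub>mat_ring X\<^esub> B \<in> mat_ideal X H"
        unfolding mat_ideal_def using M.minus_closed[OF c] by blast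
    qed
    then show "subgroup (mat_ideal X H) (add_monoid (mat_ring X))" by (rule additive_subgroup.a_subgroup)
    fix A B assume "A \<in> mat_ideal X H" and B: "B \<in> carrier (mat_ring X)"
    then have A: "A \<in> carrier (mat_ring X)" and e: "\<And>i j. i \<in> X \<Longrightarrow> j \<in> X \<Longrightarrow> A i j \<in> H"
      unfolding mat_ideal_def by blast+
    have "(B \<otimes>\<^bsub>mat_ring X\<^esub> A) i j \<in> H" if "i \<in> X" "j \<in> X" for i j
      unfolding mat_mult_entry[OF that]
      by (rule tsum_closedin[OF cl s nullfam_mat_mult[OF B A that]]) (rule H.I_l_closed[OF e[OF _ that(2)] mat_entry[OF B that(1)]])
    then show "B \<otimes>\<^bsub>mat_ring X\<^esub> A \<in> mat_ideal X H" unfolding mat_ideal_def using M.m_closed[OF B A] by blast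
    have "(A \<otimes>\<^bsub>mat_ring X\<^esub> B) i j \<in> H" if "i \<in> X" "j \<in> X" for i j
      unfolding mat_mult_entry[OF that]
      by (rule tsum_closedin[OF cl s nullfam_mat_mult[OF A B that]]) (rule H.I_r_closed[OF e[OF that(1)] mat_entry[OF B _ that(2)]])
    then show "A \<otimes>\<^bsub>mat_ring X\<^esub> B \<in> mat_ideal X H" unfolding mat_ideal_def using M.m_closed[OF A B] by blast
  qed
qed

lemma mat_ideal_closed_under_limits:
  assumes cl: "closedin T H"
  shows "seq_complete_ring.closed_under_limits (mat_ring X) (mat_base X) (mat_ideal X H)"
proof -
  interpret M: seq_complete_ring "mat_ring X" "mat_base X" by (rule seq_complete_mat_ring)
  show ?thesis
    unfolding M.closed_under_limits_def
  proof (intro allI impI)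
    fix s :: "nat \<Rightarrow> _" and l
    assume sl: "(\<forall>n. s n \<in> mat_ideal X H) \<and> M.tends s l"
    then have sc: "\<And>n. s n \<in> carrier (mat_ring X)" and l: "l \<in> carrier (mat_ring X)"
      and sH: "\<And>n i j. i \<in> X \<Longrightarrow> j \<in> X \<Longrightarrow> s n i j \<in> H" unfolding M.tends_def mat_ideal_def by blast+
    have "l i j \<in> H" if ij: "i \<in> X" "j \<in> X" for i j
    proof (rule closedin_limit[OF cl mat_entry[OF l ij]])
      fix U assume U: "U \<in> ORI"
      have "\<forall>\<^sub>F n in sequentially. s n \<ominus>\<^bsub>mat_ring X\<^esub> l \<in> {A \<in> carrier (mat_ring X). \<forall>j\<in>X. A i j \<in> U}"
        using sl mat_baseI[OF ij(1) U] unfolding M.tends_def M.null_def by blast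
      then obtain n where "s n \<ominus>\<^bsub>mat_ring X\<^esub> l \<in> {A \<in> carrier (mat_ring X). \<forall>j\<in>X. A i j \<in> U}"
        unfolding eventually_sequentially by blast
      then have "(s n \<ominus>\<^bsub>mat_ring X\<^esub> l) i j \<in> U" using ij(2) by blast
      then have "s n i j \<ominus> l i j \<in> U" unfolding mat_minus_entry[OF sc l ij] .
      from diff_sym[OF ORI_OS[OF U] this mat_entry[OF sc ij] mat_entry[OF l ij]]
      show "\<exists>h\<in>H. l i j \<ominus> h \<in> U" using sH[OF ij] by blast
    qed
    then show "l \<in> mat_ideal X H" unfolding mat_ideal_def using l by blast
  qed
qed

text \<open>
  Koenig's lemma: if no power of \<open>A\<close> had its \<open>i\<close>-th row in \<open>U\<close>, one could choose indices
  \<open>i = i\<^sub>0, i\<^sub>1, \<dots>\<close> such that no product of the entries \<open>A i\<^sub>k i\<^sub>k\<^sub>+\<^sub>1\<close> lies in \<open>U\<close>.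
\<close>

lemma mat_ideal_powers_null:
  assumes nil: "top_left_T_nilpotent R T H" and A: "A \<in> mat_ideal X H"
  shows "seq_complete_ring.null (mat_ring X) (mat_base X) (\<lambda>n. A [^]\<^bsub>mat_ring X\<^esub> n)"
proof -
  let ?M = "mat_ring X"
  interpret M: seq_complete_ring ?M "mat_base X" by (rule seq_complete_mat_ring)
  have Ac: "A \<in> carrier ?M" and AH: "\<And>i j. i \<in> X \<Longrightarrow> j \<in> X \<Longrightarrow> A i j \<in> H"
    using A unfolding mat_ideal_def by blast+
  have pc: "A [^]\<^bsub>?M\<^esub> n \<in> carrier ?M" for n :: nat using Ac by (rule M.nat_pow_closed)
  have row: "\<exists>n. \<forall>j\<in>X. (A [^]\<^bsub>?M\<^esub> (n :: nat)) i j \<in> U" if i: "i \<in> X" and U: "U \<in> ORI" for i U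
  proof (rule ccontr)
    assume no: "\<not> ?thesis"
    note U' = ORI_OS[OF U]
    \<comment> \<open>A pair records a path of indices starting at \<open>i\<close>:
      \<open>c\<close> is the product of the matrix entries along it and \<open>l\<close> is its
      end. It is bad if there is no exponent for which \<open>c\<close> times row \<open>l\<close>
      of that power of \<open>A\<close> lies in \<open>U\<close>.\<close>
    define bad where "bad p \<longleftrightarrow> (case p of (c, l) \<Rightarrow> c \<in> carrier R \<and> l \<in> X \<and>
        (\<forall>n :: nat. \<exists>j\<in>X. c \<otimes> (A [^]\<^bsub>?M\<^esub> n) l j \<notin> U))" for p
    define S where "S = (\<lambda>(c, l) (c', l'). l' \<in> X \<and> c' = c \<otimes> A l l')"
    have init: "bad (\<one>, i)"
      using no i mat_entry[OF pc i] by (auto simp: bad_def)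
    \<comment> \<open>Finite branching: all but finitely many continuations have their product in
      \<open>U\<close> and are harmless. If the remaining ones were all good, one exponent would
      serve them all, and one more factor \<open>A\<close> would make \<open>p\<close> good.\<close>
    have step: "\<exists>q. bad q \<and> S p q" if p: "bad p" for p
    proof (rule ccontr)
      assume none: "\<not> ?thesis"
      obtain c l where cl: "p = (c, l)" by (cases p)
      have c: "c \<in> carrier R" and l: "l \<in> X" and b: "\<And>n :: nat. \<exists>j\<in>X. c \<otimes> (A [^]\<^bsub>?M\<^esub> n) l j \<notin> U"
        using p unfolding bad_def cl by auto
      let ?c = "\<lambda>k. c \<otimes> A l k"
      have cc: "?c k \<in> carrier R" if "k \<in> X" for k using c mat_entry[OF Ac l that] by simp
      have "\<exists>n :: nat. \<forall>j\<in>X. ?c k \<otimes> (A [^]\<^bsub>?M\<^esub> n) k j \<in> U" if "k \<in> X" for k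
        using none that cc[OF that] unfolding bad_def S_def cl by auto
      then obtain N :: "'b \<Rightarrow> nat"
        where N: "\<And>k j. k \<in> X \<Longrightarrow> j \<in> X \<Longrightarrow> ?c k \<otimes> (A [^]\<^bsub>?M\<^esub> N k) k j \<in> U" by metis
      \<comment> \<open>\<open>U\<close> is a right ideal, so an exponent that works for
        \<open>k\<close> may be increased.\<close>
      have later: "?c k \<otimes> (A [^]\<^bsub>?M\<^esub> m) k j \<in> U" if k: "k \<in> X" and j: "j \<in> X" and m: "N k \<le> m" for k j m
      proof -
        have e: "A [^]\<^bsub>?M\<^esub> m = A [^]\<^bsub>?M\<^esub> N k \<otimes>\<^bsub>?M\<^esub> A [^]\<^bsub>?M\<^esub> (m - N k)"
          using m M.nat_pow_mult[OF Ac] by simp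
        note nf = nullfam_mat_mult[OF pc pc k j]
        have "?c k \<otimes> (A [^]\<^bsub>?M\<^esub> m) k j
          = tsum (\<lambda>h. ?c k \<otimes> ((A [^]\<^bsub>?M\<^esub> N k) k h \<otimes> (A [^]\<^bsub>?M\<^esub> (m - N k)) h j)) X"
          unfolding e mat_mult_entry[OF k j] by (rule tsum_lmult[OF nf cc[OF k], symmetric])
        also have "\<dots> \<in> U"
        proof (rule tsum_OS[OF nullfam_lmult[OF nf cc[OF k]] U'])
          fix h assume h: "h \<in> X"
          have "?c k \<otimes> ((A [^]\<^bsub>?M\<^esub> N k) k h \<otimes> (A [^]\<^bsub>?M\<^esub> (m - N k)) h j)
            = ?c k \<otimes> (A [^]\<^bsub>?M\<^esub> N k) k h \<otimes> (A [^]\<^bsub>?M\<^esub> (m - N k)) h j"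
            by (rule m_assoc[OF cc[OF k] mat_entry[OF pc k h] mat_entry[OF pc h j], symmetric])
          also have "\<dots> \<in> U" by (rule ORI_mult[OF U N[OF k h] mat_entry[OF pc h j]])
          finally show "?c k \<otimes> ((A [^]\<^bsub>?M\<^esub> N k) k h \<otimes> (A [^]\<^bsub>?M\<^esub> (m - N k)) h j) \<in> U" .
        qed
        finally show ?thesis .
      qed
      let ?F = "{k \<in> X. ?c k \<notin> U}"
      have F: "finite ?F" by (rule nullfam_fin[OF nullfam_lmult[OF FC_nullfam[OF mat_row[OF Ac l]] c] U'])
      \<comment> \<open>The inserted 0 covers the case that \<open>?F\<close> is empty.\<close>
      define m where "m = Max (insert 0 (N ` ?F))"
      have mN: "N k \<le> m" if "k \<in> ?F" for k unfolding m_def using F that by (intro Max_ge) auto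
      have "c \<otimes> (A [^]\<^bsub>?M\<^esub> Suc m) l j \<in> U" if j: "j \<in> X" for j
      proof -
        note nf = nullfam_mat_mult[OF Ac pc l j]
        have "c \<otimes> (A [^]\<^bsub>?M\<^esub> Suc m) l j = tsum (\<lambda>k. c \<otimes> (A l k \<otimes> (A [^]\<^bsub>?M\<^esub> m) k j)) X"
          unfolding M.nat_pow_Suc2[OF Ac] mat_mult_entry[OF l j] by (rule tsum_lmult[OF nf c, symmetric])
        also have "\<dots> \<in> U"
        proof (rule tsum_OS[OF nullfam_lmult[OF nf c] U'])
          fix k assume k: "k \<in> X"
          have e: "c \<otimes> (A l k \<otimes> (A [^]\<^bsub>?M\<^esub> m) k j) = ?c k \<otimes> (A [^]\<^bsub>?M\<^esub> m) k j"
            by (rule m_assoc[OF c mat_entry[OF Ac l k] mat_entry[OF pc k j], symmetric])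
          show "c \<otimes> (A l k \<otimes> (A [^]\<^bsub>?M\<^esub> m) k j) \<in> U"
          proof (cases "?c k \<in> U")
            case True
            then show ?thesis unfolding e by (rule ORI_mult[OF U _ mat_entry[OF pc k j]])
          next
            case False
            then show ?thesis unfolding e using later[OF k j mN] k by blast
          qed
        qed
        finally show ?thesis .
      qed
      then show False using b[of "Suc m"] by blast
    qed
    \<comment> \<open>The clause for n = 0 pins the first element of the chosen sequence.\<close>
    obtain f :: "nat \<Rightarrow> 'a \<times> 'b" where f: "f 0 = (\<one>, i)" "\<And>n. bad (f n)" "\<And>n. S (f n) (f (Suc n))"
      using dependent_nat_choice[of "\<lambda>n p. bad p \<and> (n = 0 \<longrightarrow> p = (\<one>, i))" "\<lambda>_. S"] init step by (metis nat.distinct(1))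
    define c where "c n = fst (f n)" for n
    define l where "l n = snd (f n)" for n
    define a where "a n = A (l n) (l (Suc n))" for n
    have lX: "l n \<in> X" for n using f(2)[of n] by (auto simp: bad_def l_def)
    have cS: "c (Suc n) = c n \<otimes> a n" for n using f(3)[of n] by (auto simp: S_def c_def l_def a_def split: prod.splits)
    have aH: "a n \<in> H" for n unfolding a_def by (rule AH[OF lX lX])
    have ac: "a n \<in> carrier R" for n unfolding a_def by (rule mat_entry[OF Ac lX lX])
    \<comment> \<open>The shift by one arises because \<open>c 0\<close> is the empty product,
      whereas \<open>seq_prod\<close> starts with \<open>a 0\<close>.\<close>
    have sp: "seq_prod R a n = c (Suc n)" for n
    proof (induction n)
      case 0
      show ?case using cS[of 0] ac[of 0] by (simp add: c_def f(1))
    qed (simp add: cS[symmetric])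
    \<comment> \<open>A pair whose product lies in \<open>U\<close> cannot be bad, since
      \<open>U\<close> absorbs every factor on the right; exponent 0 is just an instance.\<close>
    have cU: "c n \<notin> U" for n
    proof
      assume cn: "c n \<in> U"
      have "\<forall>m :: nat. \<exists>j\<in>X. c n \<otimes> (A [^]\<^bsub>?M\<^esub> m) (l n) j \<notin> U"
        using f(2)[of n] unfolding bad_def c_def l_def case_prod_beta by blast
      then obtain j where "j \<in> X" "c n \<otimes> (A [^]\<^bsub>?M\<^esub> (0 :: nat)) (l n) j \<notin> U" by blast
      then show False using ORI_mult[OF U cn mat_entry[OF pc lX]] by blast
    qed
    have "limitin T (seq_prod R a) \<zero> sequentially"
      using nil aH unfolding top_left_T_nilpotent_def by blast
    moreover have "openin T U" "\<zero> \<in> U" using U OS_zero[OF U'] by (auto simp: ORI_def)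
    ultimately have "\<forall>\<^sub>F n in sequentially. seq_prod R a n \<in> U" unfolding limitin_def by blast
    then show False using cU unfolding eventually_sequentially sp by blast
  qed
  show ?thesis
    unfolding M.null_def
  proof (intro conjI allI ballI pc)
    fix W assume W: "W \<in> mat_base X"
    then obtain i U where iU: "i \<in> X" "U \<in> ORI" "W = {A \<in> carrier ?M. \<forall>j\<in>X. A i j \<in> U}" by (rule mat_baseE)
    obtain N :: nat where "\<forall>j\<in>X. (A [^]\<^bsub>?M\<^esub> N) i j \<in> U" using row[OF iU(1,2)] by blast
    then have N: "A [^]\<^bsub>?M\<^esub> N \<in> W" unfolding iU(3) using pc by blast
    have "A [^]\<^bsub>?M\<^esub> n \<in> W" if "N \<le> n" for n
    proof -
      have "A [^]\<^bsub>?M\<^esub> N \<otimes>\<^bsub>?M\<^esub> A [^]\<^bsub>?M\<^esub> (n - N) \<in> W" by (rule M.base_mult[OF W N pc])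
      then show ?thesis using that M.nat_pow_mult[OF Ac] by simp
    qed
    then show "\<forall>\<^sub>F n in sequentially. A [^]\<^bsub>?M\<^esub> n \<in> W" unfolding eventually_sequentially by blast
  qed
qed

section \<open>Splitting a subcontramodule modulo the radical\<close>


lemma diff_cong:
  assumes U: "U \<in> OS" and x: "x \<ominus> x' \<in> U" "y \<ominus> y' \<in> U"
    and c: "x \<in> carrier R" "x' \<in> carrier R" "y \<in> carrier R" "y' \<in> carrier R"
  shows "(x \<ominus> y) \<ominus> (x' \<ominus> y') \<in> U"
proof -
  have "(x \<ominus> y) \<ominus> (x' \<ominus> y') = (x \<ominus> x') \<ominus> (y \<ominus> y')"
    using c by (simp add: a_minus_def minus_add a_ac)
  then show ?thesis using OS_diff[OF U x] by simp
qed

lemma ideal_OS: "ideal I R \<Longrightarrow> openin T I \<Longrightarrow> I \<in> OS"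
  unfolding open_subgroups_def using ideal.axioms(1) by blast

lemma rows_submod:
  assumes K: "ideal K R" and o: "openin T K"
  shows "left_module.submod R (free_mod X) {t \<in> FC X. \<forall>x\<in>X. t x \<in> K}"
proof -
  interpret F: left_module R "free_mod X" by (rule left_module_free_mod)
  interpret K: ideal K R by (rule K)
  note KO = ideal_OS[OF K o]
  show ?thesis
    unfolding F.submod_def free_mod_simps
  proof (intro conjI ballI subsetI)
    show "czero X \<in> {t \<in> FC X. \<forall>x\<in>X. t x \<in> K}" by (simp add: czero_FC) (simp add: czero_def K.zero_closed)
    fix t u assume "t \<in> {t \<in> FC X. \<forall>x\<in>X. t x \<in> K}" "u \<in> {t \<in> FC X. \<forall>x\<in>X. t x \<in> K}"
    then show "t \<ominus>\<^bsub>free_mod X\<^esub> u \<in> {t \<in> FC X. \<forall>x\<in>X. t x \<in> K}"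
      using OS_diff[OF KO] by (simp add: free_mod_minus cdiff_FC) (simp add: cdiff_def)
  next
    fix r t assume "r \<in> carrier R" "t \<in> {t \<in> FC X. \<forall>x\<in>X. t x \<in> K}"
    then show "r \<odot>\<^bsub>free_mod X\<^esub> t \<in> {t \<in> FC X. \<forall>x\<in>X. t x \<in> K}"
      using K.I_l_closed by (simp add: csmult_FC) (simp add: free_mod_smult)
  qed blast
qed

section \<open>Infinite combinations inside submodules\<close>

lemma lincomb_smult:
  assumes r: "r \<in> carrier R" and t: "t \<in> FC Y" and w: "\<And>y. y \<in> Y \<Longrightarrow> w y \<in> FC X"
  shows "lincomb Y X w (r \<odot>\<^bsub>free_mod Y\<^esub> t) = r \<odot>\<^bsub>free_mod X\<^esub> lincomb Y X w t"
  unfolding lincomb_def free_mod_smult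
proof (rule restrict_ext)
  fix j assume j: "j \<in> X"
  note n = nullfam_lincomb[OF t w j]
  have "tsum (\<lambda>y. (\<lambda>x\<in>Y. r \<otimes> t x) y \<otimes> w y j) Y = tsum (\<lambda>y. r \<otimes> (t y \<otimes> w y j)) Y"
    by (rule tsum_cong[OF refl _ nullfam_lmult[OF n r]])
       (use r FC_D[OF t] FC_D[OF w j] in \<open>simp add: m_assoc\<close>)
  also have "\<dots> = r \<otimes> tsum (\<lambda>y. t y \<otimes> w y j) Y" by (rule tsum_lmult[OF n r])
  finally show "tsum (\<lambda>y. (\<lambda>x\<in>Y. r \<otimes> t x) y \<otimes> w y j) Y = r \<otimes> (\<lambda>j\<in>X. tsum (\<lambda>y. t y \<otimes> w y j) Y) j"
    using j by simp
qed

lemma lincomb_finite_submod: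
  assumes W: "left_module.submod R (free_mod X) W" and w: "\<And>y. y \<in> Y \<Longrightarrow> w y \<in> W"
    and F: "finite F" and t: "t \<in> FC Y" "\<And>y. y \<in> Y - F \<Longrightarrow> t y = \<zero>"
  shows "lincomb Y X w t \<in> W"
proof -
  interpret F: left_module R "free_mod X" by (rule left_module_free_mod)
  note Wd = F.submodD[OF W]
  have wF: "w y \<in> FC X" if "y \<in> Y" for y using Wd(1)[OF w[OF that]] by simp
  show ?thesis using F t
  proof (induction F arbitrary: t rule: finite_induct)
    case (empty t)
    have "lincomb Y X w t = czero X"
      unfolding lincomb_def czero_def
      by (rule restrict_ext, rule tsum_zero(2)) (use empty.prems FC_D[OF wF] in auto)
    then show ?case using Wd(2) by simp
  next
    case (insert z F)
    show ?case
    proof (cases "z \<in> Y")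
      case False
      then show ?thesis using insert by auto
    next
      case True
      define u where "u = (\<lambda>y\<in>Y. if y = z then \<zero> else t y)"
      have tc: "t y \<in> carrier R" if "y \<in> Y" for y by (rule FC_D[OF insert.prems(1) that])
      have u: "u \<in> FC Y" unfolding u_def
      proof (rule restrict_FC, rule nullfam_ORI)
        fix U assume U: "U \<in> ORI"
        show "finite {y \<in> Y. (if y = z then \<zero> else t y) \<notin> U}"
          by (rule finite_subset[OF _ nullfam_fin[OF FC_nullfam[OF insert.prems(1)] ORI_OS[OF U]]])
             (use OS_zero[OF ORI_OS[OF U]] in auto)
      qed (use tc in auto)
      have z: "t z \<odot>\<^bsub>free_mod Y\<^esub> cunit Y z \<in> FC Y" by (rule csmult_FC[OF tc[OF True] unit_FC[OF True]])
      have "t = u \<oplus>\<^bsub>free_mod Y\<^esub> (t z \<odot>\<^bsub>free_mod Y\<^esub> cunit Y z)"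
        by (rule FC_eqI[OF insert.prems(1) cadd_FC[OF u z]])
           (use tc tc[OF True] in \<open>auto simp: free_mod_add free_mod_smult u_def comb_unit_def\<close>)
      then have "lincomb Y X w t = lincomb Y X w u \<oplus>\<^bsub>free_mod X\<^esub> t z \<odot>\<^bsub>free_mod X\<^esub> w z"
        using lincomb_add_left[OF u z wF] lincomb_smult[OF tc[OF True] unit_FC[OF True] wF]
          lincomb_unit_left[OF True wF] by simp
      moreover have "lincomb Y X w u \<in> W" by (rule insert.IH[OF u]) (use insert.prems in \<open>auto simp: u_def\<close>)
      ultimately show ?thesis using Wd(4)[OF tc[OF True] w[OF True]] Wd(5) by simp
    qed
  qed
qed

text \<open>Only finitely many coefficients of \<open>t\<close> lie outside the open ideal
  \<open>K\<close>, and the others contribute a row with entries in \<open>K\<close>, which belongs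
  to \<open>W\<close> by assumption. So an algebraic submodule of this kind admits infinite
  combinations.\<close>

lemma lincomb_submod:
  assumes K: "ideal K R" and o: "openin T K"
    and W: "left_module.submod R (free_mod X) W" and KW: "{t \<in> FC X. \<forall>x\<in>X. t x \<in> K} \<subseteq> W"
    and w: "\<And>y. y \<in> Y \<Longrightarrow> w y \<in> W" and t: "t \<in> FC Y"
  shows "lincomb Y X w t \<in> W"
proof -
  interpret F: left_module R "free_mod X" by (rule left_module_free_mod)
  interpret K: ideal K R by (rule K)
  note Wd = F.submodD[OF W]
  note KO = ideal_OS[OF K o]
  have wF: "w y \<in> FC X" if "y \<in> Y" for y using Wd(1)[OF w[OF that]] by simp
  have tc: "t y \<in> carrier R" if "y \<in> Y" for y by (rule FC_D[OF t that])
  define F where "F = {y \<in> Y. t y \<notin> K}"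
  have F: "finite F" unfolding F_def by (rule nullfam_fin[OF FC_nullfam[OF t] KO])
  define u where "u = (\<lambda>y\<in>Y. if y \<in> F then t y else \<zero>)"
  have u: "u \<in> FC Y" unfolding u_def
    by (rule restrict_FC, rule tsum_finite(1)[of F]) (use F tc in \<open>auto simp: F_def\<close>)
  have uW: "lincomb Y X w u \<in> W"
    by (rule lincomb_finite_submod[OF W w F u]) (auto simp: u_def)
  define v where "v = (\<lambda>y\<in>Y. if y \<in> F then \<zero> else t y)"
  have vK: "v y \<in> K" if "y \<in> Y" for y using that K.zero_closed by (simp add: v_def F_def)
  have v: "v \<in> FC Y" unfolding v_def
  proof (rule restrict_FC, rule nullfam_ORI)
    fix U assume U: "U \<in> ORI"
    show "finite {y \<in> Y. (if y \<in> F then \<zero> else t y) \<notin> U}"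
      by (rule finite_subset[OF _ nullfam_fin[OF FC_nullfam[OF t] ORI_OS[OF U]]])
         (use OS_zero[OF ORI_OS[OF U]] in auto)
  qed (use tc in auto)
  have "tsum (\<lambda>y. v y \<otimes> w y j) Y \<in> K" if j: "j \<in> X" for j
    by (rule tsum_OS[OF nullfam_lincomb[OF v wF j] KO K.I_r_closed[OF vK FC_D[OF wF j]]])
  then have "lincomb Y X w v \<in> W"
    using KW lincomb_FC[OF v wF] by (auto simp: lincomb_def)
  moreover have "t = u \<oplus>\<^bsub>free_mod Y\<^esub> v"
    by (rule FC_eqI[OF t cadd_FC[OF u v]]) (use tc in \<open>auto simp: free_mod_add u_def v_def\<close>)
  then have "lincomb Y X w t = lincomb Y X w u \<oplus>\<^bsub>free_mod X\<^esub> lincomb Y X w v"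
    using lincomb_add_left[OF u v wF] by simp
  ultimately show ?thesis using uW Wd(5) by simp
qed

text \<open>A minimal left ideal is all that is used of the Artinian condition on \<open>R/K\<close>.\<close>

definition simple_quotient :: "'a set \<Rightarrow> bool" where
  "simple_quotient K \<longleftrightarrow> ideal K R \<and> openin T K \<and>
     (\<forall>I. ideal I R \<and> K \<subseteq> I \<longrightarrow> I = K \<or> I = carrier R) \<and>
     (\<exists>L. left_ideal R L \<and> K \<subset> L \<and> (\<forall>I. left_ideal R I \<and> K \<subseteq> I \<and> I \<subseteq> L \<longrightarrow> I = K \<or> I = L))"

text \<open>The rows \<open>b x\<close> are the components of the basis elements in a complement
  \<open>W\<close> of \<open>N\<close> modulo \<open>K\<close>. For \<open>n\<close> in
  \<open>N\<close>, the row n b lies in \<open>W\<close> and n - n b lies in \<open>N'\<close>.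
  Hence n b lies in both, so its entries are in \<open>K\<close>.\<close>

lemma simple_splitting:
  assumes K: "simple_quotient K" and N: "left_module.submod R (free_mod X) N"
  shows "\<exists>b\<in>X \<rightarrow> FC X.
    (\<forall>x\<in>X. \<exists>n\<in>N. \<forall>j\<in>X. cunit X x j \<ominus> b x j \<ominus> n j \<in> K) \<and>
    (\<forall>n\<in>N. \<forall>j\<in>X. lincomb X X b n j \<in> K)"
proof -
  interpret F: left_module R "free_mod X" by (rule left_module_free_mod)
  have Ki: "ideal K R" and Ko: "openin T K"
    and max: "\<And>I. ideal I R \<Longrightarrow> K \<subseteq> I \<Longrightarrow> I = K \<or> I = carrier R"
    using K by (auto simp: simple_quotient_def)
  have "\<exists>L. left_ideal R L \<and> K \<subset> L \<and> (\<forall>I. left_ideal R I \<and> K \<subseteq> I \<and> I \<subseteq> L \<longrightarrow> I = K \<or> I = L)"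
    using K unfolding simple_quotient_def by (elim conjE)
  then obtain L where L0: "left_ideal R L \<and> K \<subset> L \<and> (\<forall>I. left_ideal R I \<and> K \<subseteq> I \<and> I \<subseteq> L \<longrightarrow> I = K \<or> I = L)" ..
  have L: "left_ideal R L" "K \<subset> L" using L0 by simp_all
  have Lmin: "I = K \<or> I = L" if "left_ideal R I" "K \<subseteq> I" "I \<subseteq> L" for I
    using L0 that by (elim conjE allE[of _ I] impE) auto
  interpret K: ideal K R by (rule Ki)
  note Nd = F.submodD[OF N]
  define Z where "Z = {t \<in> FC X. \<forall>x\<in>X. t x \<in> K}"
  have Z: "F.submod Z" unfolding Z_def by (rule rows_submod[OF Ki Ko])
  note Zd = F.submodD[OF Z]
  \<comment> \<open>\<open>complement_exists\<close> wants a submodule containing \<open>Z\<close>,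
    and \<open>N\<close> need not contain it.\<close>
  define N' where "N' = {n \<oplus>\<^bsub>free_mod X\<^esub> z |n z. n \<in> N \<and> z \<in> Z}"
  have N': "F.submod N'" unfolding N'_def by (rule F.submod_sum[OF N Z])
  note N'd = F.submodD[OF N']
  have ZN: "Z \<subseteq> N'"
  proof
    fix z assume z: "z \<in> Z"
    then have "z = \<zero>\<^bsub>free_mod X\<^esub> \<oplus>\<^bsub>free_mod X\<^esub> z" using F.V.l_zero[OF Zd(1)] by metis
    then show "z \<in> N'" unfolding N'_def using Nd(2) z by blast
  qed
  have NN: "n \<in> N'" if n: "n \<in> N" for n
  proof -
    have "n = n \<oplus>\<^bsub>free_mod X\<^esub> \<zero>\<^bsub>free_mod X\<^esub>" using F.V.r_zero[OF Nd(1)[OF n]] by metis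
    then show ?thesis unfolding N'_def using Zd(2) n by blast
  qed
  have KZ: "k \<odot>\<^bsub>free_mod X\<^esub> v \<in> Z" if "k \<in> K" "v \<in> carrier (free_mod X)" for k v
  proof -
    have v: "v \<in> FC X" using that by simp
    have "k \<otimes> v x \<in> K" if "x \<in> X" for x by (rule K.I_r_closed[OF \<open>k \<in> K\<close> FC_D[OF v that]])
    then show ?thesis unfolding Z_def using csmult_FC[OF K.a_Hcarr[OF that(1)] v] by (simp add: free_mod_smult)
  qed
  have "\<exists>W. F.submod W \<and> Z \<subseteq> W \<and> N' \<inter> W \<subseteq> Z
      \<and> (\<forall>v\<in>carrier (free_mod X). \<exists>n\<in>N'. \<exists>w\<in>W. v = n \<oplus>\<^bsub>free_mod X\<^esub> w)"
    by (rule F.complement_exists[OF Ki _ L _ Z _ N' ZN]) (fact max Lmin KZ)+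
  then obtain W where W: "F.submod W" "Z \<subseteq> W" "N' \<inter> W \<subseteq> Z"
      "\<forall>v\<in>carrier (free_mod X). \<exists>n\<in>N'. \<exists>w\<in>W. v = n \<oplus>\<^bsub>free_mod X\<^esub> w"
    by (elim exE conjE)
  note Wd = F.submodD[OF W(1)]
  have "\<exists>w. w \<in> W \<and> (\<exists>n\<in>N'. cunit X x = n \<oplus>\<^bsub>free_mod X\<^esub> w)" if "x \<in> X" for x
    using bspec[OF W(4), of "cunit X x"] unit_FC[OF that] by auto
  then obtain b where b: "\<And>x. x \<in> X \<Longrightarrow> b x \<in> W" "\<And>x. x \<in> X \<Longrightarrow> \<exists>n\<in>N'. cunit X x = n \<oplus>\<^bsub>free_mod X\<^esub> b x"
    by metis
  have bF: "b x \<in> FC X" if "x \<in> X" for x using Wd(1)[OF b(1)[OF that]] by simp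
  have d: "cdiff X (cunit X x) (b x) \<in> N'" if x: "x \<in> X" for x
  proof -
    obtain n where n: "n \<in> N'" "cunit X x = n \<oplus>\<^bsub>free_mod X\<^esub> b x" using b(2)[OF x] by blast
    have "n = cdiff X (cunit X x) (b x)"
      unfolding free_mod_minus[OF unit_FC[OF x] bF[OF x], symmetric] unfolding n(2)
      by (rule F.V.add_minus_cancel(1)[symmetric]) (use N'd(1)[OF n(1)] bF[OF x] in simp_all)
    then show ?thesis using n(1) by simp
  qed
  have 1: "\<exists>n\<in>N. \<forall>j\<in>X. cunit X x j \<ominus> b x j \<ominus> n j \<in> K" if x: "x \<in> X" for x
  proof -
    obtain n z where nz: "n \<in> N" "z \<in> Z" "cdiff X (cunit X x) (b x) = n \<oplus>\<^bsub>free_mod X\<^esub> z"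
      using d[OF x] unfolding N'_def by blast
    have n: "n \<in> FC X" using Nd(1)[OF nz(1)] by simp
    have z: "z \<in> FC X" using nz(2) by (simp add: Z_def)
    have "cunit X x j \<ominus> b x j \<ominus> n j \<in> K" if j: "j \<in> X" for j
    proof -
      have "cunit X x j \<ominus> b x j = n j \<oplus> z j" using fun_cong[OF nz(3), of j] j by (simp add: cdiff_def free_mod_add)
      then have "cunit X x j \<ominus> b x j \<ominus> n j = z j"
        using add_minus_cancel(1)[OF FC_D[OF z j] FC_D[OF n j]] a_comm[OF FC_D[OF n j] FC_D[OF z j]] by simp
      then show ?thesis using nz(2) j by (simp add: Z_def)
    qed
    then show ?thesis using nz(1) by blast
  qed
  have 2: "lincomb X X b n j \<in> K" if n: "n \<in> N" and j: "j \<in> X" for n j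
  proof -
    have nF: "n \<in> FC X" using Nd(1)[OF n] by simp
    let ?l = "lincomb X X b n"
    have l: "?l \<in> FC X" by (rule lincomb_FC[OF nF bF])
    have lW: "?l \<in> W" by (rule lincomb_submod[OF Ki Ko W(1) _ b(1) nF]) (use W(2) in \<open>simp add: Z_def\<close>)
    have "lincomb X X (\<lambda>x. cdiff X (cunit X x) (b x)) n \<in> N'"
      by (rule lincomb_submod[OF Ki Ko N' _ d nF]) (use ZN in \<open>simp add: Z_def\<close>)
    then have "cdiff X n ?l \<in> N'"
      using lincomb_diff_right[OF nF unit_FC bF] lincomb_unit_right[OF nF] by simp
    then have "n \<ominus>\<^bsub>free_mod X\<^esub> (n \<ominus>\<^bsub>free_mod X\<^esub> ?l) \<in> N'"
      unfolding free_mod_minus[OF nF l] by (rule N'd(3)[OF NN[OF n]])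
    moreover have "n \<ominus>\<^bsub>free_mod X\<^esub> (n \<ominus>\<^bsub>free_mod X\<^esub> ?l) = ?l"
      unfolding free_mod_minus[OF nF l] free_mod_minus[OF nF cdiff_FC[OF nF l]]
      by (rule FC_eqI[OF cdiff_FC[OF nF cdiff_FC[OF nF l]] l])
         (use FC_D[OF nF] FC_D[OF l] in \<open>simp add: cdiff_def a_minus_def minus_add r_neg2 a_assoc[symmetric] r_neg\<close>)
    ultimately have "?l \<in> N'" by simp
    then have "?l \<in> Z" using lW W(3) by blast
    then show ?thesis using j by (simp add: Z_def)
  qed
  show ?thesis using 1 2 bF by (intro bexI[of _ b]) auto
qed

text \<open>Modulo \<open>K\<close> the family \<open>r\<close> is the Kronecker delta at
  \<open>\<gamma>\<close>. As \<open>K\<close> is an open ideal, the infinite sum may be compared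
  with its one surviving term, term by term.\<close>

lemma approx_idempotent_sum:
  assumes K: "ideal K R" "openin T K" and r: "r \<in> FC \<Gamma>" and g: "\<gamma> \<in> \<Gamma>"
    and r1: "r \<gamma> \<ominus> \<one> \<in> K" and r0: "\<And>\<delta>. \<delta> \<in> \<Gamma> \<Longrightarrow> \<delta> \<noteq> \<gamma> \<Longrightarrow> r \<delta> \<in> K"
    and c: "\<And>\<delta>. \<delta> \<in> \<Gamma> \<Longrightarrow> c \<delta> \<in> carrier R"
  shows "tsum (\<lambda>\<delta>. r \<delta> \<otimes> c \<delta>) \<Gamma> \<ominus> c \<gamma> \<in> K"
proof -
  interpret K: ideal K R by (rule K)
  let ?e = "\<lambda>\<delta>. if \<delta> = \<gamma> then c \<gamma> else \<zero>"
  have n: "nullfam (\<lambda>\<delta>. r \<delta> \<otimes> c \<delta>) \<Gamma>" by (rule nullfam_rmult[OF FC_nullfam[OF r] c])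
  have e: "nullfam ?e \<Gamma>" "tsum ?e \<Gamma> = c \<gamma>" using tsum_single[of \<gamma> \<Gamma> ?e] g c by auto
  have "r \<delta> \<otimes> c \<delta> \<ominus> ?e \<delta> \<in> K" if d: "\<delta> \<in> \<Gamma>" for \<delta>
  proof (cases "\<delta> = \<gamma>")
    case True
    have "(r \<gamma> \<ominus> \<one>) \<otimes> c \<gamma> \<in> K" by (rule K.I_r_closed[OF r1 c[OF g]])
    moreover have "(r \<gamma> \<ominus> \<one>) \<otimes> c \<gamma> = r \<gamma> \<otimes> c \<gamma> \<ominus> c \<gamma>"
      using FC_D[OF r g] c[OF g] by (simp add: a_minus_def l_distr l_minus)
    ultimately show ?thesis using True by simp
  next
    case False
    then show ?thesis using K.I_r_closed[OF r0[OF d False] c[OF d]] FC_D[OF r d] c[OF d]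
      by (simp add: a_minus_def)
  qed
  then have "tsum (\<lambda>\<delta>. r \<delta> \<otimes> c \<delta> \<ominus> ?e \<delta>) \<Gamma> \<in> K"
    by (rule tsum_OS[OF nullfam_diff[OF n e(1)] ideal_OS[OF K]])
  then show ?thesis unfolding tsum_diff[OF n e(1)] e(2) .
qed

text \<open>The splittings \<open>b \<gamma>\<close> modulo the various \<open>K \<gamma>\<close>
  are unrelated. The combination of them with coefficients \<open>r\<close> converges because
  \<open>r\<close> is null, and it is congruent to \<open>b \<gamma>\<close> modulo every
  \<open>K \<gamma>\<close> at once. What holds modulo every \<open>K \<gamma>\<close> holds modulo
  their intersection \<open>H\<close>.\<close>

lemma semisimple_splitting:
  assumes K: "\<And>\<gamma>. \<gamma> \<in> \<Gamma> \<Longrightarrow> simple_quotient (K \<gamma>)" and H: "H = {x \<in> carrier R. \<forall>\<gamma>\<in>\<Gamma>. x \<in> K \<gamma>}"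
    and r: "r \<in> FC \<Gamma>" "\<And>\<gamma>. \<gamma> \<in> \<Gamma> \<Longrightarrow> r \<gamma> \<ominus> \<one> \<in> K \<gamma>"
      "\<And>\<gamma> \<delta>. \<gamma> \<in> \<Gamma> \<Longrightarrow> \<delta> \<in> \<Gamma> \<Longrightarrow> \<delta> \<noteq> \<gamma> \<Longrightarrow> r \<delta> \<in> K \<gamma>"
    and N: "left_module.submod R (free_mod X) N" and HN: "{t \<in> FC X. \<forall>x\<in>X. t x \<in> H} \<subseteq> N"
    and Nl: "\<And>n. (\<And>\<gamma>. \<gamma> \<in> \<Gamma> \<Longrightarrow> n \<gamma> \<in> N) \<Longrightarrow> lincomb \<Gamma> X n r \<in> N"
  shows "\<exists>a\<in>carrier (mat_ring X). (\<forall>x\<in>X. cdiff X (cunit X x) (a x) \<in> N) \<and>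
    (\<forall>n\<in>N. \<forall>j\<in>X. lincomb X X a n j \<in> H)"
proof -
  interpret F: left_module R "free_mod X" by (rule left_module_free_mod)
  note Nd = F.submodD[OF N]
  have "\<forall>\<gamma>\<in>\<Gamma>. \<exists>b. b \<in> X \<rightarrow> FC X \<and>
    (\<forall>x\<in>X. \<exists>n\<in>N. \<forall>j\<in>X. cunit X x j \<ominus> b x j \<ominus> n j \<in> K \<gamma>) \<and>
    (\<forall>n\<in>N. \<forall>j\<in>X. lincomb X X b n j \<in> K \<gamma>)"
    using simple_splitting[OF K N] by blast
  then obtain b where b: "\<And>\<gamma>. \<gamma> \<in> \<Gamma> \<Longrightarrow> b \<gamma> \<in> X \<rightarrow> FC X"
    "\<And>\<gamma>. \<gamma> \<in> \<Gamma> \<Longrightarrow> \<forall>x\<in>X. \<exists>n\<in>N. \<forall>j\<in>X. cunit X x j \<ominus> b \<gamma> x j \<ominus> n j \<in> K \<gamma>"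
    "\<And>\<gamma>. \<gamma> \<in> \<Gamma> \<Longrightarrow> \<forall>n\<in>N. \<forall>j\<in>X. lincomb X X (b \<gamma>) n j \<in> K \<gamma>" by metis
  have bF: "b \<gamma> x \<in> FC X" if "\<gamma> \<in> \<Gamma>" "x \<in> X" for \<gamma> x using b(1) that by blast
  have Ki: "ideal (K \<gamma>) R" "openin T (K \<gamma>)" if "\<gamma> \<in> \<Gamma>" for \<gamma>
    using K[OF that] by (auto simp: simple_quotient_def)
  have KO: "K \<gamma> \<in> OS" if "\<gamma> \<in> \<Gamma>" for \<gamma> by (rule ideal_OS[OF Ki[OF that]])
  define a where "a = (\<lambda>x\<in>X. lincomb \<Gamma> X (\<lambda>\<gamma>. b \<gamma> x) r)"
  have aF: "a x \<in> FC X" if "x \<in> X" for x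
    using lincomb_FC[OF r(1) bF[OF _ that]] that by (simp add: a_def)
  have a: "a \<in> carrier (mat_ring X)" using aF by (auto simp: a_def)
  have ab: "a x j \<ominus> b \<gamma> x j \<in> K \<gamma>" if "\<gamma> \<in> \<Gamma>" "x \<in> X" "j \<in> X" for \<gamma> x j
    using approx_idempotent_sum[OF Ki[OF that(1)] r(1) that(1) r(2)[OF that(1)] r(3)[OF that(1)], of "\<lambda>\<gamma>. b \<gamma> x j"]
      FC_D[OF bF] that by (simp add: a_def lincomb_def)
  have 1: "cdiff X (cunit X x) (a x) \<in> N" if x: "x \<in> X" for x
  proof -
    obtain n where n: "\<And>\<gamma>. \<gamma> \<in> \<Gamma> \<Longrightarrow> n \<gamma> \<in> N"
        "\<And>\<gamma> j. \<gamma> \<in> \<Gamma> \<Longrightarrow> j \<in> X \<Longrightarrow> cunit X x j \<ominus> b \<gamma> x j \<ominus> n \<gamma> j \<in> K \<gamma>"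
    proof -
      have "\<forall>\<gamma>\<in>\<Gamma>. \<exists>n. n \<in> N \<and> (\<forall>j\<in>X. cunit X x j \<ominus> b \<gamma> x j \<ominus> n j \<in> K \<gamma>)"
        using b(2) x by blast
      from bchoice[OF this] show ?thesis using that by blast
    qed
    have nF: "n \<gamma> \<in> FC X" if "\<gamma> \<in> \<Gamma>" for \<gamma> using Nd(1)[OF n(1)[OF that]] by simp
    \<comment> \<open>The witnesses in \<open>N\<close> are glued by the same coefficients as the
      splittings. The glued row agrees with \<open>?u\<close> modulo every
      \<open>K \<gamma>\<close>, and the remaining error, a row over \<open>H\<close>, belongs to
      \<open>N\<close> by \<open>HN\<close>.\<close>
    let ?m = "lincomb \<Gamma> X n r"
    have mN: "?m \<in> N" by (rule Nl[OF n(1)])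
    have m: "?m \<in> FC X" using Nd(1)[OF mN] by simp
    let ?u = "cdiff X (cunit X x) (a x)"
    have u: "?u \<in> FC X" by (rule cdiff_FC[OF unit_FC[OF x] aF[OF x]])
    have "cdiff X ?u ?m j \<in> H" if j: "j \<in> X" for j
    proof -
      have c: "cunit X x j \<in> carrier R" "a x j \<in> carrier R" "?m j \<in> carrier R"
        by (rule FC_D[OF _ j], rule unit_FC[OF x] aF[OF x] m)+
      have "cunit X x j \<ominus> a x j \<ominus> ?m j \<in> K \<gamma>" if g: "\<gamma> \<in> \<Gamma>" for \<gamma>
      proof (rule diff_mem[OF KO[OF g] _ n(2)[OF g j]])
        have c': "b \<gamma> x j \<in> carrier R" "n \<gamma> j \<in> carrier R"
          using FC_D[OF bF[OF g x] j] FC_D[OF nF[OF g] j] by auto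
        have "cunit X x j \<ominus> cunit X x j \<in> K \<gamma>" using c OS_zero[OF KO[OF g]] by (simp add: a_minus_def r_neg)
        from diff_cong[OF KO[OF g] this ab[OF g x j]]
        have 1: "(cunit X x j \<ominus> a x j) \<ominus> (cunit X x j \<ominus> b \<gamma> x j) \<in> K \<gamma>" using c c' by simp
        have 2: "?m j \<ominus> n \<gamma> j \<in> K \<gamma>"
          using approx_idempotent_sum[OF Ki[OF g] r(1) g r(2)[OF g] r(3)[OF g], of "\<lambda>\<gamma>. n \<gamma> j"]
            FC_D[OF nF j] j by (simp add: lincomb_def)
        show "cunit X x j \<ominus> a x j \<ominus> ?m j \<ominus> (cunit X x j \<ominus> b \<gamma> x j \<ominus> n \<gamma> j) \<in> K \<gamma>"
          by (rule diff_cong[OF KO[OF g] 1 2]) (use c c' in simp_all)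
      qed (use c in simp)
      then show ?thesis unfolding H using j c by (simp add: cdiff_def)
    qed
    then have hN: "?u \<ominus>\<^bsub>free_mod X\<^esub> ?m \<in> N"
      unfolding free_mod_minus[OF u m] using HN cdiff_FC[OF u m] by blast
    have "(?u \<ominus>\<^bsub>free_mod X\<^esub> ?m) \<oplus>\<^bsub>free_mod X\<^esub> ?m \<in> N" by (rule Nd(5)[OF hN mN])
    moreover have "(?u \<ominus>\<^bsub>free_mod X\<^esub> ?m) \<oplus>\<^bsub>free_mod X\<^esub> ?m = ?u"
      by (rule F.V.add_minus_cancel(2)) (simp_all add: u m)
    ultimately show ?thesis by simp
  qed
  have 2: "lincomb X X a n j \<in> H" if n: "n \<in> N" and j: "j \<in> X" for n j
  proof -
    have nF: "n \<in> FC X" using Nd(1)[OF n] by simp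
    have l: "lincomb X X a n \<in> FC X" by (rule lincomb_FC[OF nF aF])
    have "lincomb X X a n j \<in> K \<gamma>" if g: "\<gamma> \<in> \<Gamma>" for \<gamma>
    proof (rule diff_mem[OF KO[OF g]])
      show "lincomb X X (b \<gamma>) n j \<in> K \<gamma>" using b(3)[OF g] n j by blast
      show "lincomb X X a n j \<in> carrier R" by (rule FC_D[OF l j])
      have "tsum (\<lambda>x. n x \<otimes> cdiff X (a x) (b \<gamma> x) j) X \<in> K \<gamma>"
      proof (rule tsum_OS[OF nullfam_lincomb[OF nF cdiff_FC[OF aF bF[OF g]] j] KO[OF g]])
        fix x assume x: "x \<in> X"
        show "n x \<otimes> cdiff X (a x) (b \<gamma> x) j \<in> K \<gamma>"
          using ideal.I_l_closed[OF Ki(1)[OF g] ab[OF g x j] FC_D[OF nF x]] j by (simp add: cdiff_def)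
      qed
      then have "lincomb X X (\<lambda>x. cdiff X (a x) (b \<gamma> x)) n j \<in> K \<gamma>" using j by (simp add: lincomb_def)
      moreover have "lincomb X X (\<lambda>x. cdiff X (a x) (b \<gamma> x)) n = cdiff X (lincomb X X a n) (lincomb X X (b \<gamma>) n)"
        by (rule lincomb_diff_right[OF nF]) (fact aF bF[OF g])+
      ultimately have "cdiff X (lincomb X X a n) (lincomb X X (b \<gamma>) n) j \<in> K \<gamma>" by simp
      then show "lincomb X X a n j \<ominus> lincomb X X (b \<gamma>) n j \<in> K \<gamma>" using j by (simp add: cdiff_def)
    qed
    then show ?thesis unfolding H using FC_D[OF l j] by blast
  qed
  show ?thesis using 1 2 a by blast
qed

section \<open>Direct summands of free contramodules\<close>


text \<open>The associativity law of a contramodule, read in terms of rows and matrices.\<close>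

lemma act_lincomb:
  assumes C: "contramodule R T C" and t: "t \<in> FC Y" and w: "w \<in> Y \<rightarrow> FC (carrier C)"
  shows "act C (lincomb Y (carrier C) w t) = act C (cmap Y (carrier C) (\<lambda>y. act C (w y)) t)"
proof -
  have a: "act C \<in> FC (carrier C) \<rightarrow> carrier C" using act_closed[OF C] by blast
  show ?thesis
    unfolding cmult_cmap_eq[OF t w, symmetric] act_assoc[OF C cmap_FC[OF t w]] cmap_comp[OF t w a] ..
qed

text \<open>By \<open>act_lincomb\<close> both sides depend on the rows only through their images.
  Relations in \<open>C\<close> may thus be substituted inside infinite combinations.\<close>

lemma act_lincomb_cong:
  assumes C: "contramodule R T C" and t: "t \<in> FC Y"
    and w: "\<And>y. y \<in> Y \<Longrightarrow> w y \<in> FC (carrier C)" and v: "\<And>y. y \<in> Y \<Longrightarrow> v y \<in> FC (carrier C)"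
    and e: "\<And>y. y \<in> Y \<Longrightarrow> act C (w y) = act C (v y)"
  shows "act C (lincomb Y (carrier C) w t) = act C (lincomb Y (carrier C) v t)"
  using act_lincomb[OF C t, of w] act_lincomb[OF C t, of v] w v cmap_cong[of Y "\<lambda>y. act C (w y)" "\<lambda>y. act C (v y)"] e
  by simp

lemma act_diff_cong:
  assumes C: "contramodule R T C" and "t \<in> FC (carrier C)" "u \<in> FC (carrier C)" "t' \<in> FC (carrier C)" "u' \<in> FC (carrier C)"
    and "act C t = act C t'" "act C u = act C u'"
  shows "act C (cdiff (carrier C) t u) = act C (cdiff (carrier C) t' u')"
  using assms act_diff[OF C] by metis

lemma cdiff_cdiff:
  assumes u: "u \<in> FC X" and v: "v \<in> FC X"
  shows "cdiff X u (cdiff X u v) = v"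
  by (rule FC_eqI[OF cdiff_FC[OF u cdiff_FC[OF u v]] v])
     (use FC_D[OF u] FC_D[OF v] in \<open>simp add: cdiff_def a_minus_def minus_add r_neg2 a_assoc[symmetric] r_neg\<close>)

text \<open>This moves a term across an equation in \<open>C\<close>, as u - (u - v) = v. It serves
  to turn a relation between x - E x and a row h over \<open>H\<close> into one between x - h and E
  x.\<close>

lemma act_diff_swap:
  assumes C: "contramodule R T C" and u: "u \<in> FC (carrier C)" and v: "v \<in> FC (carrier C)" and w: "w \<in> FC (carrier C)"
    and e: "act C (cdiff (carrier C) u v) = act C w"
  shows "act C (cdiff (carrier C) u w) = act C v"
  using act_diff_cong[OF C u w u cdiff_FC[OF u v] refl e[symmetric]] cdiff_cdiff[OF u v] by simp

lemma free_contra_simps [simp]: "carrier (free_contra R T X) = FC X" "act (free_contra R T X) = cmult X"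
  by (simp_all add: free_contra_def)

section \<open>Morphisms out of free contramodules\<close>

lemma free_hom:
  assumes A: "contramodule R T A" and k: "k \<in> X \<rightarrow> carrier A"
  shows "(\<lambda>t. act A (cmap X (carrier A) k t)) \<in> chom (free_contra R T X) A"
  by (rule hom_comp[OF map_hom[OF k] act_hom[OF A]])

text \<open>An element is the combination of the basis elements with its own coefficients, so
  \<open>g\<close> is determined by its values on the basis.\<close>

lemma free_hom_apply:
  assumes g: "g \<in> chom (free_contra R T X) A" and t: "t \<in> FC X"
  shows "g t = act A (cmap X (carrier A) (\<lambda>x. g (cunit X x)) t)"
proof -
  have u: "cunit X \<in> X \<rightarrow> FC X" by (rule funcsetI) (rule unit_FC)
  have gm: "g \<in> FC X \<rightarrow> carrier A" using hom_map[OF g] by simp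
  have "g t = g (cmult X (cmap X (FC X) (cunit X) t))"
    unfolding cmult_cmap_eq[OF t u] lincomb_unit_right[OF t] ..
  also have "\<dots> = act A (cmap (FC X) (carrier A) g (cmap X (FC X) (cunit X) t))"
    using hom_act[OF g] cmap_FC[OF t u] by simp
  finally show ?thesis unfolding cmap_comp[OF t u gm] .
qed

lemma lincomb_hom:
  assumes w: "w \<in> X \<rightarrow> FC Y"
  shows "lincomb X Y w \<in> chom (free_contra R T X) (free_contra R T Y)"
proof -
  have h: "(\<lambda>t. cmult Y (cmap X (FC Y) w t)) \<in> chom (free_contra R T X) (free_contra R T Y)"
    using free_hom[OF free_contramodule[of Y], of w X] w by simp
  have "lincomb X Y w (cmult X r) = cmult Y (cmap (FC X) (FC Y) (lincomb X Y w) r)" if r: "r \<in> FC (FC X)" for r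
  proof -
    have "cmap (FC X) (FC Y) (lincomb X Y w) r = cmap (FC X) (FC Y) (\<lambda>t. cmult Y (cmap X (FC Y) w t)) r"
      by (rule cmap_cong) (simp add: cmult_cmap_eq[OF _ w])
    then show ?thesis
      using hom_act[OF h, of r] r cmult_cmap_eq[OF cmult_FC[OF r] w] by simp
  qed
  moreover have "lincomb X Y w t \<in> FC Y" if "t \<in> FC X" for t
    by (rule lincomb_FC[OF that]) (use w in auto)
  ultimately show ?thesis by (auto simp: contra_hom_def)
qed

lemma mat_map: "A \<in> carrier (mat_ring X) \<Longrightarrow> A \<in> X \<rightarrow> FC X"
  by (rule funcsetI) (rule mat_row)

lemma lincomb_mat_FC: "A \<in> carrier (mat_ring X) \<Longrightarrow> t \<in> FC X \<Longrightarrow> lincomb X X A t \<in> FC X"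
  by (rule lincomb_FC) (auto intro: mat_row)

lemma lincomb_mat_mult:
  assumes A: "A \<in> carrier (mat_ring X)" and B: "B \<in> carrier (mat_ring X)" and t: "t \<in> FC X"
  shows "lincomb X X B (lincomb X X A t) = lincomb X X (A \<otimes>\<^bsub>mat_ring X\<^esub> B) t"
proof -
  have "lincomb X X B (lincomb X X A t) = lincomb X X (\<lambda>i. lincomb X X B (A i)) t"
    by (rule lincomb_assoc[OF t mat_row[OF A] mat_row[OF B]])
  also have "\<dots> = lincomb X X (A \<otimes>\<^bsub>mat_ring X\<^esub> B) t"
    by (rule lincomb_cong[OF _ t]) (use lincomb_FC[OF mat_row[OF A] mat_row[OF B]] in auto)
  finally show ?thesis .
qed

lemma lincomb_mat_one:
  assumes t: "t \<in> FC X"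
  shows "lincomb X X (\<one>\<^bsub>mat_ring X\<^esub>) t = t"
proof -
  have "lincomb X X (\<one>\<^bsub>mat_ring X\<^esub>) t = lincomb X X (cunit X) t"
    by (rule lincomb_cong[OF _ t]) (simp_all add: unit_FC)
  then show ?thesis using lincomb_unit_right[OF t] by simp
qed

lemma mat_mult_row: "i \<in> X \<Longrightarrow> (A \<otimes>\<^bsub>mat_ring X\<^esub> B) i = lincomb X X B (A i)"
  by simp

text \<open>The operation has the shape required by \<open>contramodule_retract\<close>, with
  \<open>E\<close> as retraction and the inclusion as section. By \<open>incl_hom\<close> it is the
  restriction of the operation of the free contramodule.\<close>

definition summand :: "'x set \<Rightarrow> ('x \<Rightarrow> 'x \<Rightarrow> 'a) \<Rightarrow> ('x \<Rightarrow> 'a, 'a) contra" where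
  "summand X E = \<lparr>carrier = {t \<in> FC X. lincomb X X E t = t},
     act = (\<lambda>s. lincomb X X E (cmult X (cmap {t \<in> FC X. lincomb X X E t = t} (FC X) (\<lambda>t. t) s)))\<rparr>"

lemma summand_iff: "t \<in> carrier (summand X E) \<longleftrightarrow> t \<in> FC X \<and> lincomb X X E t = t"
  by (simp add: summand_def)

context
  fixes X :: "'x set" and E
  assumes E: "E \<in> carrier (mat_ring X)" and idem: "E \<otimes>\<^bsub>mat_ring X\<^esub> E = E"
begin

lemma lincomb_idem: "t \<in> FC X \<Longrightarrow> lincomb X X E t \<in> carrier (summand X E)"
  using lincomb_mat_mult[OF E E, unfolded idem] lincomb_mat_FC[OF E] by (simp add: summand_iff)

lemma idem_row: "x \<in> X \<Longrightarrow> E x \<in> carrier (summand X E)"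
  using mat_mult_row[of x X E E, unfolded idem] mat_row[OF E] by (simp add: summand_iff)

lemma contramodule_summand: "contramodule R T (summand X E)"
  and proj_hom: "lincomb X X E \<in> chom (free_contra R T X) (summand X E)"
proof -
  let ?D = "{t \<in> FC X. lincomb X X E t = t}" and ?F = "free_contra R T X" and ?q = "lincomb X X E"
  have q: "?q \<in> carrier ?F \<rightarrow> ?D" using lincomb_idem by (auto simp: summand_iff)
  have s: "(\<lambda>t. t) \<in> ?D \<rightarrow> carrier ?F" by auto
  have qF: "?q \<in> FC X \<rightarrow> FC X" using q by auto
  \<comment> \<open>\<open>E\<close> is an endomorphism of the free contramodule, so applying it to
    the members of a combination and again to the result is \<open>E\<close> twice, hence
    \<open>E\<close> once.\<close>
  have compat: "?q (act ?F t) = ?q (act ?F (cmap (carrier ?F) (carrier ?F) (\<lambda>b. ?q b) t))"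
    if t: "t \<in> FC (carrier ?F)" for t
  proof -
    have t': "t \<in> FC (FC X)" using t by simp
    have "cmult X (cmap (FC X) (FC X) ?q t) = ?q (cmult X t)"
      using hom_act[OF lincomb_hom[OF mat_map[OF E]], of t] t' by simp
    moreover have "?q (?q (cmult X t)) = ?q (cmult X t)"
      using lincomb_idem[OF cmult_FC[OF t']] by (simp add: summand_iff)
    ultimately show ?thesis by simp
  qed
  have qd: "\<And>d. d \<in> ?D \<Longrightarrow> ?q d = d" by simp
  note r = contramodule_retract[where q = ?q and s = "\<lambda>t. t", OF free_contramodule q s qd compat]
  show "contramodule R T (summand X E)" "?q \<in> chom ?F (summand X E)"
    using r by (simp_all add: summand_def)
qed

lemma incl_hom: "(\<lambda>t. t) \<in> chom (summand X E) (free_contra R T X)"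
proof -
  let ?D = "carrier (summand X E)"
  have s: "(\<lambda>t. t) \<in> ?D \<rightarrow> FC X" by (auto simp: summand_iff)
  have "act (summand X E) r = cmult X (cmap ?D (FC X) (\<lambda>t. t) r)" if r: "r \<in> FC ?D" for r
  proof -
    have c: "cmap ?D (FC X) (\<lambda>t. t) r \<in> FC (FC X)" by (rule cmap_FC[OF r s])
    have "act (summand X E) r = lincomb X X E (cmult X (cmap ?D (FC X) (\<lambda>t. t) r))"
      by (simp add: summand_def)
    also have "\<dots> = cmult X (cmap (FC X) (FC X) (lincomb X X E) (cmap ?D (FC X) (\<lambda>t. t) r))"
      using hom_act[OF lincomb_hom[OF mat_map[OF E]]] c by simp
    also have "cmap (FC X) (FC X) (lincomb X X E) (cmap ?D (FC X) (\<lambda>t. t) r) = cmap ?D (FC X) (\<lambda>t. lincomb X X E t) r"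
      by (rule cmap_comp[OF r s]) (use lincomb_mat_FC[OF E] in auto)
    also have "\<dots> = cmap ?D (FC X) (\<lambda>t. t) r" by (rule cmap_cong) (simp add: summand_iff)
    finally show ?thesis .
  qed
  then show ?thesis using s by (auto simp: contra_hom_def)
qed

text \<open>As t = t E, the rows \<open>E x\<close> generate the summand, and a morphism is
  determined by its values on them.\<close>

lemma summand_hom_apply:
  assumes f: "f \<in> chom (summand X E) A" and t: "t \<in> carrier (summand X E)"
  shows "f t = act A (cmap X (carrier A) (\<lambda>x. f (E x)) t)"
proof -
  have t': "t \<in> FC X" "lincomb X X E t = t" using t by (simp_all add: summand_iff)
  have "f (lincomb X X E t) = act A (cmap X (carrier A) (\<lambda>x. f (lincomb X X E (cunit X x))) t)"
    by (rule free_hom_apply[OF hom_comp[OF proj_hom f] t'(1)])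
  also have "cmap X (carrier A) (\<lambda>x. f (lincomb X X E (cunit X x))) t = cmap X (carrier A) (\<lambda>x. f (E x)) t"
    by (rule cmap_cong) (simp add: lincomb_unit_left[OF _ mat_row[OF E]])
  finally show ?thesis using t'(2) by simp
qed

text \<open>Preimages are chosen only for the elements \<open>f (E x)\<close>. The resulting map is
  extended to the free contramodule and restricted along the inclusion.\<close>

lemma contra_projective_summand: "contra_projective R T (summand X E)"
  unfolding contra_projective_def
proof (intro conjI contramodule_summand allI impI)
  fix A :: "(('x \<Rightarrow> 'a) \<Rightarrow> 'a, 'a) contra" and B :: "('x \<Rightarrow> 'a, 'a) contra" and g f
  assume asm: "contramodule R T A \<and> contramodule R T B \<and> contra_epi R T A B g \<and> f \<in> chom (summand X E) B"
  then have A: "contramodule R T A" and B: "contramodule R T B" and ge: "contra_epi R T A B g"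
    and f: "f \<in> chom (summand X E) B" by auto
  have g: "g \<in> chom A B" using ge by (simp add: contra_epi_def)
  have fm: "f (E x) \<in> carrier B" if "x \<in> X" for x using hom_map[OF f] idem_row[OF that] by blast
  have "\<forall>x\<in>X. \<exists>a. a \<in> carrier A \<and> g a = f (E x)" using epi_surj[OF A B ge] fm by (metis imageE)
  from bchoice[OF this] obtain k where k: "\<forall>x\<in>X. k x \<in> carrier A \<and> g (k x) = f (E x)" ..
  have km: "k \<in> X \<rightarrow> carrier A" using k by blast
  let ?h = "\<lambda>t. act A (cmap X (carrier A) k t)"
  have h: "?h \<in> chom (summand X E) A" using hom_comp[OF incl_hom free_hom[OF A km]] .
  have "g (?h t) = f t" if t: "t \<in> carrier (summand X E)" for t
  proof -
    have t': "t \<in> FC X" using t by (simp add: summand_iff)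
    have "g (?h t) = act B (cmap (carrier A) (carrier B) g (cmap X (carrier A) k t))"
      by (rule hom_act[OF g cmap_FC[OF t' km]])
    also have "cmap (carrier A) (carrier B) g (cmap X (carrier A) k t) = cmap X (carrier B) (\<lambda>x. g (k x)) t"
      by (rule cmap_comp[OF t' km hom_map[OF g]])
    also have "\<dots> = cmap X (carrier B) (\<lambda>x. f (E x)) t" by (rule cmap_cong) (use k in blast)
    finally show ?thesis using summand_hom_apply[OF f t] by simp
  qed
  then show "\<exists>h\<in>chom (summand X E) A. \<forall>x\<in>carrier (summand X E). g (h x) = f x" using h by (intro bexI[of _ ?h] ballI)
qed

lemma summand_endo_apply:
  assumes f: "f \<in> chom (summand X E) (summand X E)" and t: "t \<in> carrier (summand X E)"
  shows "f t = lincomb X X (\<lambda>x. f (E x)) t"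
proof -
  have fF: "f \<in> chom (summand X E) (free_contra R T X)" using hom_comp[OF f incl_hom] .
  have m: "(\<lambda>x. f (E x)) \<in> X \<rightarrow> FC X" using hom_map[OF fF] idem_row by auto
  have "t \<in> FC X" using t by (simp add: summand_iff)
  then show ?thesis using summand_hom_apply[OF fF t] cmult_cmap_eq[OF _ m] by simp
qed

end

section \<open>Existence of projective covers\<close>


lemma ideal_diff_mem:
  assumes H: "ideal H R" and "x \<ominus> y \<in> H" "y \<in> H" "x \<in> carrier R" shows "x \<in> H"
proof -
  have "(x \<ominus> y) \<oplus> y \<in> H" using assms by (intro additive_subgroup.a_closed[OF ideal.axioms(1)[OF H]])
  moreover have "(x \<ominus> y) \<oplus> y = x"
    using assms ideal.Icarr[OF H] by (intro add_minus_cancel(2)) auto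
  ultimately show ?thesis by simp
qed

text \<open>The product decomposition enters only through the kernels \<open>K\<close> and the null
  family \<open>r\<close> of approximate coordinate idempotents. The cover is \<open>act C\<close>
  restricted to the image of an idempotent matrix indexed by the carrier of
  \<open>C\<close>.\<close>

lemma projective_cover_exists:
  fixes C :: "('c, 'a) contra" and r :: "'i \<Rightarrow> 'a"
  assumes H: "ideal H R" and cl: "closedin T H" and nil: "top_left_T_nilpotent R T H"
    and K: "\<And>\<gamma>. \<gamma> \<in> \<Gamma> \<Longrightarrow> simple_quotient (K \<gamma>)" and HK: "H = {x \<in> carrier R. \<forall>\<gamma>\<in>\<Gamma>. x \<in> K \<gamma>}"
    and r: "r \<in> FC \<Gamma>" "\<And>\<gamma>. \<gamma> \<in> \<Gamma> \<Longrightarrow> r \<gamma> \<ominus> \<one> \<in> K \<gamma>"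
      "\<And>\<gamma> \<delta>. \<gamma> \<in> \<Gamma> \<Longrightarrow> \<delta> \<in> \<Gamma> \<Longrightarrow> \<delta> \<noteq> \<gamma> \<Longrightarrow> r \<delta> \<in> K \<gamma>"
    and C: "contramodule R T C"
  shows "\<exists>(P :: ('c \<Rightarrow> 'a, 'a) contra) p. projective_cover R T P C p"
proof -
  define X where "X = carrier C"
  let ?M = "mat_ring X"
  interpret M: seq_complete_ring ?M "mat_base X" by (rule seq_complete_mat_ring)
  interpret F: left_module R "free_mod X" by (rule left_module_free_mod)
  interpret H: ideal H R by (rule H)
  have Hs: "additive_subgroup H R" by (rule H.additive_subgroup_axioms)
  note C' = act_lincomb_cong[OF C, folded X_def] act_diff_cong[OF C, folded X_def] act_diff_swap[OF C, folded X_def]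
  define HF where "HF = {h \<in> FC X. \<forall>x\<in>X. h x \<in> H}"
  have HF: "h \<in> FC X" "x \<in> X \<Longrightarrow> h x \<in> H" if "h \<in> HF" for h x using that by (auto simp: HF_def)
  have HFI: "h \<in> HF" if "h \<in> FC X" "\<And>x. x \<in> X \<Longrightarrow> h x \<in> H" for h using that by (simp add: HF_def)
  have HF_lincomb: "lincomb Y X h t \<in> HF" if t: "t \<in> FC Y" and h: "\<And>y. y \<in> Y \<Longrightarrow> h y \<in> HF" for t h and Y :: "'y set"
  proof (rule HFI)
    show "lincomb Y X h t \<in> FC X" by (rule lincomb_FC[OF t HF(1)[OF h]])
    fix j assume j: "j \<in> X"
    have "tsum (\<lambda>y. t y \<otimes> h y j) Y \<in> H"
      by (rule tsum_closedin[OF cl Hs nullfam_lincomb[OF t HF(1)[OF h] j] H.I_l_closed[OF HF(2)[OF h j] FC_D[OF t]]])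
    then show "lincomb Y X h t j \<in> H" using j by (simp add: lincomb_def)
  qed
  have HF_diff: "cdiff X h k \<in> HF" if "h \<in> HF" "k \<in> HF" for h k
    by (rule HFI[OF cdiff_FC[OF HF(1)[OF that(1)] HF(1)[OF that(2)]]])
       (use HF(2)[OF that(1)] HF(2)[OF that(2)] ideal_diff[OF H] in \<open>simp add: cdiff_def\<close>)
  have HF0: "czero X \<in> HF" by (rule HFI[OF czero_FC]) (simp add: czero_def)
  \<comment> \<open>The image of \<open>HF\<close> under \<open>act C\<close> is the subcontramodule
    HC, so this is its full preimage.\<close>
  define N where "N = {t \<in> FC X. \<exists>h\<in>HF. act C t = act C h}"
  have N: "t \<in> FC X" "\<exists>h\<in>HF. act C t = act C h" if "t \<in> N" for t using that by (simp_all add: N_def)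
  have NI: "t \<in> N" if "t \<in> FC X" "h \<in> HF" "act C t = act C h" for t h using that by (auto simp: N_def)
  have HFN: "HF \<subseteq> N" using NI HF(1) by blast
  \<comment> \<open>Each \<open>n y\<close> is exchanged for a row over \<open>H\<close> with the
    same image. Combinations of such rows remain rows over \<open>H\<close>, as \<open>H\<close> is
    a closed ideal.\<close>
  have Nl: "lincomb Y X n t \<in> N" if t: "t \<in> FC Y" and n: "\<And>y. y \<in> Y \<Longrightarrow> n y \<in> N" for t n and Y :: "'y set"
  proof -
    have "\<forall>y\<in>Y. \<exists>h. h \<in> HF \<and> act C (n y) = act C h" using N(2)[OF n] by blast
    from bchoice[OF this] obtain h where h: "\<forall>y\<in>Y. h y \<in> HF \<and> act C (n y) = act C (h y)" ..
    have hF: "h y \<in> HF" if "y \<in> Y" for y using h that by blast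
    have e: "act C (lincomb Y X n t) = act C (lincomb Y X h t)"
      by (rule C'(1)[OF t N(1)[OF n] HF(1)[OF hF]]) (use h in auto)
    show ?thesis by (rule NI[OF _ _ e]) (intro lincomb_FC HF_lincomb t N(1) n hF; assumption)+
  qed
  have Nd: "cdiff X t u \<in> N" if tu: "t \<in> N" "u \<in> N" for t u
  proof -
    obtain h k where hk: "h \<in> HF" "act C t = act C h" "k \<in> HF" "act C u = act C k" using N(2)[OF tu(1)] N(2)[OF tu(2)] by blast
    show ?thesis
      by (rule NI[OF cdiff_FC[OF N(1)[OF tu(1)] N(1)[OF tu(2)]] HF_diff[OF hk(1,3)]
            C'(2)[OF N(1)[OF tu(1)] N(1)[OF tu(2)] HF(1)[OF hk(1)] HF(1)[OF hk(3)] hk(2,4)]])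
  qed
  have Nsub: "F.submod N"
    unfolding F.submod_def
  proof (intro conjI ballI)
    show "N \<subseteq> carrier (free_mod X)" using N(1) by auto
    show "\<zero>\<^bsub>free_mod X\<^esub> \<in> N" using HF0 HFN by auto
    show "t \<ominus>\<^bsub>free_mod X\<^esub> u \<in> N" if "t \<in> N" "u \<in> N" for t u
      unfolding free_mod_minus[OF N(1)[OF that(1)] N(1)[OF that(2)]] by (rule Nd[OF that])
    fix c t assume c: "c \<in> carrier R" and t: "t \<in> N"
    \<comment> \<open>A scalar multiple is a combination over a one-element index set, so stability
      under scalars is a case of \<open>Nl\<close>.\<close>
    have s: "(\<lambda>y\<in>{()}. c) \<in> FC {()}" by (rule restrict_FC, rule tsum_single(1)[of "()"]) (use c in auto)
    have "lincomb {()} X (\<lambda>_. t) (\<lambda>y\<in>{()}. c) = c \<odot>\<^bsub>free_mod X\<^esub> t"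
      unfolding lincomb_def free_mod_smult
      by (rule restrict_ext, subst tsum_single(2)[of "()"]) (use c FC_D[OF N(1)[OF t]] in auto)
    then show "c \<odot>\<^bsub>free_mod X\<^esub> t \<in> N" using Nl[OF s, of "\<lambda>_. t"] t by simp
  qed
  have "\<exists>a\<in>carrier ?M. (\<forall>x\<in>X. cdiff X (cunit X x) (a x) \<in> N) \<and> (\<forall>n\<in>N. \<forall>j\<in>X. lincomb X X a n j \<in> H)"
    by (rule semisimple_splitting[OF K HK r Nsub HFN[unfolded HF_def] Nl[OF r(1)]])
  then obtain a where a: "a \<in> carrier ?M" "\<And>x. x \<in> X \<Longrightarrow> cdiff X (cunit X x) (a x) \<in> N"
    "\<And>n j. n \<in> N \<Longrightarrow> j \<in> X \<Longrightarrow> lincomb X X a n j \<in> H" by blast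
  have aN: "lincomb X X a n \<in> HF" if "n \<in> N" for n
    by (rule HFI[OF lincomb_mat_FC[OF a(1) N(1)[OF that]] a(3)[OF that]])
  let ?J = "mat_ideal X H"
  have J: "ideal ?J ?M" by (rule ideal_mat_ideal[OF H cl])
  have JI: "A \<in> ?J" if "A \<in> carrier ?M" "\<And>x. x \<in> X \<Longrightarrow> A x \<in> HF" for A
    using that HF(2) unfolding mat_ideal_def by blast
  have JD: "A \<in> carrier ?M" "x \<in> X \<Longrightarrow> A x \<in> HF" if A: "A \<in> ?J" for A x
  proof -
    show c: "A \<in> carrier ?M" using A by (simp only: mat_ideal_def mem_Collect_eq)
    show "A x \<in> HF" if x: "x \<in> X"
      by (rule HFI[OF mat_row[OF c x]]) (use A x in \<open>simp only: mat_ideal_def mem_Collect_eq\<close>)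
  qed
  \<comment> \<open>The rows of 1 - a lie in \<open>N\<close>, and \<open>a\<close> carries
    \<open>N\<close> into the rows over \<open>H\<close>, so (1 - a) a has entries in
    \<open>H\<close>. The two factors commute.\<close>
  have aJ: "a \<otimes>\<^bsub>?M\<^esub> (\<one>\<^bsub>?M\<^esub> \<ominus>\<^bsub>?M\<^esub> a) \<in> ?J"
  proof -
    have c: "\<one>\<^bsub>?M\<^esub> \<ominus>\<^bsub>?M\<^esub> a \<in> carrier ?M" by (rule M.minus_closed[OF M.one_closed a(1)])
    have "(\<one>\<^bsub>?M\<^esub> \<ominus>\<^bsub>?M\<^esub> a) \<otimes>\<^bsub>?M\<^esub> a \<in> ?J"
    proof (rule JI[OF M.m_closed[OF c a(1)]])
      fix x assume x: "x \<in> X"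
      have "(\<one>\<^bsub>?M\<^esub> \<ominus>\<^bsub>?M\<^esub> a) x = cdiff X (cunit X x) (a x)"
        unfolding mat_minus[OF M.one_closed a(1)] using x by simp
      then show "((\<one>\<^bsub>?M\<^esub> \<ominus>\<^bsub>?M\<^esub> a) \<otimes>\<^bsub>?M\<^esub> a) x \<in> HF"
        unfolding mat_mult_row[OF x] using aN[OF a(2)[OF x]] by simp
    qed
    moreover have "(\<one>\<^bsub>?M\<^esub> \<ominus>\<^bsub>?M\<^esub> a) \<otimes>\<^bsub>?M\<^esub> a = a \<otimes>\<^bsub>?M\<^esub> (\<one>\<^bsub>?M\<^esub> \<ominus>\<^bsub>?M\<^esub> a)"
      using a(1) unfolding M.minus_eq by (simp only: M.l_distr M.r_distr M.l_minus M.r_minus M.one_closed M.a_inv_closed M.l_one M.r_one)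
    ultimately show ?thesis by simp
  qed
  have "\<exists>E\<in>carrier ?M. E \<otimes>\<^bsub>?M\<^esub> E = E \<and> E \<ominus>\<^bsub>?M\<^esub> a \<in> ?J"
    by (rule M.idempotent_lift[OF J mat_ideal_closed_under_limits[OF cl] a(1) aJ mat_ideal_powers_null[OF nil aJ]])
  then obtain E where E: "E \<in> carrier ?M" and EE: "E \<otimes>\<^bsub>?M\<^esub> E = E" and Ea: "E \<ominus>\<^bsub>?M\<^esub> a \<in> ?J" by blast
  have Ea_row: "cdiff X (E x) (a x) \<in> HF" if "x \<in> X" for x
    using JD(2)[OF Ea that] that unfolding mat_minus[OF E a(1)] by simp
  \<comment> \<open>Both properties of \<open>a\<close> pass to \<open>E\<close>, because
    \<open>E\<close> and \<open>a\<close> differ by a matrix over \<open>H\<close> and rows over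
    \<open>H\<close> belong to \<open>N\<close>.\<close>
  have E1: "cdiff X (cunit X x) (E x) \<in> N" if x: "x \<in> X" for x
  proof -
    have "cdiff X (cdiff X (cunit X x) (a x)) (cdiff X (E x) (a x)) \<in> N"
      by (rule Nd[OF a(2)[OF x]]) (use Ea_row[OF x] HFN in blast)
    moreover have "cdiff X (cdiff X (cunit X x) (a x)) (cdiff X (E x) (a x)) = cdiff X (cunit X x) (E x)"
      unfolding cdiff_def
      by (rule restrict_ext)
         (use FC_D[OF unit_FC[OF x]] FC_D[OF mat_row[OF E x]] FC_D[OF mat_row[OF a(1) x]]
          in \<open>simp add: diff_diff_cancel\<close>)
    ultimately show ?thesis by simp
  qed
  have E2: "lincomb X X E n \<in> HF" if n: "n \<in> N" for n
  proof (rule HFI[OF lincomb_mat_FC[OF E N(1)[OF n]]])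
    fix j assume j: "j \<in> X"
    have "lincomb X X (\<lambda>x. cdiff X (E x) (a x)) n \<in> HF" by (rule HF_lincomb[OF N(1)[OF n] Ea_row])
    moreover have "lincomb X X (\<lambda>x. cdiff X (E x) (a x)) n = cdiff X (lincomb X X E n) (lincomb X X a n)"
      by (rule lincomb_diff_right[OF N(1)[OF n]]) (fact mat_row[OF E] mat_row[OF a(1)])+
    ultimately have "cdiff X (lincomb X X E n) (lincomb X X a n) \<in> HF" by simp
    from HF(2)[OF this j] have "lincomb X X E n j \<ominus> lincomb X X a n j \<in> H" using j by (simp add: cdiff_def)
    then show "lincomb X X E n j \<in> H"
      by (rule ideal_diff_mem[OF H _ a(3)[OF n j] FC_D[OF lincomb_mat_FC[OF E N(1)[OF n]] j]])
  qed
  define P where "P = summand X E"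
  have Pi: "t \<in> carrier P \<longleftrightarrow> t \<in> FC X \<and> lincomb X X E t = t" for t unfolding P_def by (rule summand_iff)
  have EP: "E x \<in> carrier P" if "x \<in> X" for x unfolding P_def by (rule idem_row[OF E EE that])
  have P: "contramodule R T P" unfolding P_def by (rule contramodule_summand[OF E EE])
  have incl: "(\<lambda>t. t) \<in> chom P (free_contra R T X)" unfolding P_def by (rule incl_hom[OF E EE])
  have proj: "lincomb X X E \<in> chom (free_contra R T X) P" unfolding P_def by (rule proj_hom[OF E EE])
  have inv: "\<exists>B\<in>carrier ?M. B \<otimes>\<^bsub>?M\<^esub> (\<one>\<^bsub>?M\<^esub> \<ominus>\<^bsub>?M\<^esub> A) = \<one>\<^bsub>?M\<^esub> \<and> (\<one>\<^bsub>?M\<^esub> \<ominus>\<^bsub>?M\<^esub> A) \<otimes>\<^bsub>?M\<^esub> B = \<one>\<^bsub>?M\<^esub>"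
    if A: "A \<in> ?J" for A
    by (rule M.one_minus_invertible[OF JD(1)[OF A] mat_ideal_powers_null[OF nil A]])
  have hom: "act C \<in> chom P C" using hom_comp[OF incl act_hom[OF C, folded X_def]] by simp
  have "act C ` carrier P = carrier C"
  proof
    show "act C ` carrier P \<subseteq> carrier C" using hom_map[OF hom] by blast
    show "carrier C \<subseteq> act C ` carrier P"
    proof
      fix c assume "c \<in> carrier C"
      then have c: "c \<in> X" by (simp add: X_def)
      have "\<forall>x\<in>X. \<exists>h. h \<in> HF \<and> act C (cdiff X (cunit X x) (E x)) = act C h" using N(2)[OF E1] by blast
      from bchoice[OF this] obtain h where h: "\<forall>x\<in>X. h x \<in> HF \<and> act C (cdiff X (cunit X x) (E x)) = act C (h x)" ..
      \<comment> \<open>The Nakayama argument: row x of 1 - A has the same image in \<open>C\<close>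
        as \<open>E x\<close>. Multiplying by row \<open>c\<close> of the inverse of 1 - A expresses
        the basis element \<open>c\<close> by rows of 1 - A, which may then be replaced by those of
        \<open>E\<close>.\<close>
      define A where "A = (\<lambda>x\<in>X. h x)"
      have Ah: "A x = h x" if "x \<in> X" for x using that by (simp add: A_def)
      have AJ: "A \<in> ?J" by (rule JI) (use h HF(1) Ah in \<open>auto simp: A_def\<close>)
      note Ac = JD(1)[OF AJ]
      obtain B where B: "B \<in> carrier ?M" "B \<otimes>\<^bsub>?M\<^esub> (\<one>\<^bsub>?M\<^esub> \<ominus>\<^bsub>?M\<^esub> A) = \<one>\<^bsub>?M\<^esub>" using inv[OF AJ] by blast
      have D: "\<one>\<^bsub>?M\<^esub> \<ominus>\<^bsub>?M\<^esub> A \<in> carrier ?M" by (rule M.minus_closed[OF M.one_closed Ac])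
      let ?u = "B c"
      have u: "?u \<in> FC X" by (rule mat_row[OF B(1) c])
      have row: "act C ((\<one>\<^bsub>?M\<^esub> \<ominus>\<^bsub>?M\<^esub> A) x) = act C (E x)" if x: "x \<in> X" for x
      proof -
        have "(\<one>\<^bsub>?M\<^esub> \<ominus>\<^bsub>?M\<^esub> A) x = cdiff X (cunit X x) (A x)"
          unfolding mat_minus[OF M.one_closed Ac] using x by simp
        moreover have "act C (cdiff X (cunit X x) (A x)) = act C (E x)"
          by (rule C'(3)[OF unit_FC[OF x] mat_row[OF E x] mat_row[OF Ac x]]) (use h x Ah in auto)
        ultimately show ?thesis by simp
      qed
      have "c = act C (cunit X c)" using act_unit[OF C, of c] c by (simp add: X_def)
      also have "cunit X c = (B \<otimes>\<^bsub>?M\<^esub> (\<one>\<^bsub>?M\<^esub> \<ominus>\<^bsub>?M\<^esub> A)) c" unfolding B(2) using c by simp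
      also have "\<dots> = lincomb X X (\<one>\<^bsub>?M\<^esub> \<ominus>\<^bsub>?M\<^esub> A) ?u" by (rule mat_mult_row[OF c])
      also have "act C \<dots> = act C (lincomb X X E ?u)"
        by (rule C'(1)[OF u mat_row[OF D] mat_row[OF E] row])
      finally have "c = act C (lincomb X X E ?u)" .
      moreover have "lincomb X X E ?u \<in> carrier P" unfolding P_def by (rule lincomb_idem[OF E EE u])
      ultimately show "c \<in> act C ` carrier P" by blast
    qed
  qed
  then have epi: "contra_epi R T P C (act C)" by (rule surj_epi[OF hom])
  have "contra_aut R T P f" if f: "f \<in> chom P P" and pf: "\<forall>t\<in>carrier P. act C (f t) = act C t" for f
  proof -
    have fP: "f t \<in> carrier P" if "t \<in> carrier P" for t using hom_map[OF f] that by blast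
    define G where "G = (\<lambda>x\<in>X. f (E x))"
    have Gx: "G x = f (E x)" if "x \<in> X" for x using that by (simp add: G_def)
    have GP: "G x \<in> carrier P" if "x \<in> X" for x unfolding Gx[OF that] by (rule fP[OF EP[OF that]])
    have G: "G \<in> carrier ?M" using GP by (auto simp: G_def Pi)
    have fG: "f t = lincomb X X G t" if t: "t \<in> carrier P" for t
    proof -
      have "f t = lincomb X X (\<lambda>x. f (E x)) t"
        by (rule summand_endo_apply[OF E EE f[unfolded P_def] t[unfolded P_def]])
      also have "\<dots> = lincomb X X G t"
        by (rule lincomb_cong) (use t GP Gx in \<open>auto simp: Pi\<close>)
      finally show ?thesis .
    qed
    let ?A = "E \<ominus>\<^bsub>?M\<^esub> G"
    have A: "?A \<in> carrier ?M" by (rule M.minus_closed[OF E G])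
    have Ax: "?A x = cdiff X (E x) (G x)" if "x \<in> X" for x unfolding mat_minus[OF E G] using that by simp
    have Ex: "E x \<in> FC X" and Gxc: "G x \<in> FC X" if "x \<in> X" for x
      using mat_row[OF E that] mat_row[OF G that] by auto
    have EG: "G \<otimes>\<^bsub>?M\<^esub> E = G"
    proof (rule mat_eqI[OF M.m_closed[OF G E] G])
      show "(G \<otimes>\<^bsub>?M\<^esub> E) i j = G i j" if "i \<in> X" for i j
        unfolding mat_mult_row[OF that] using GP[OF that] by (simp add: Pi)
    qed
    have GE: "E \<otimes>\<^bsub>?M\<^esub> G = G"
    proof (rule mat_eqI[OF M.m_closed[OF E G] G])
      show "(E \<otimes>\<^bsub>?M\<^esub> G) i j = G i j" if "i \<in> X" for i j
        unfolding mat_mult_row[OF that] using fG[OF EP[OF that]] Gx[OF that] by simp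
    qed
    have AE: "?A \<otimes>\<^bsub>?M\<^esub> E = ?A" and EA: "E \<otimes>\<^bsub>?M\<^esub> ?A = ?A"
      using E G EE EG GE by (simp_all only: M.minus_eq M.l_distr M.r_distr M.l_minus M.r_minus M.a_inv_closed)
    \<comment> \<open>As \<open>f\<close> respects \<open>act C\<close>, the rows of E - G map to
      zero in \<open>C\<close> and so lie in \<open>N\<close>. \<open>E\<close> carries them to rows
      over \<open>H\<close>, but it also fixes them.\<close>
    have AJ: "?A \<in> ?J"
    proof (rule JI[OF A])
      fix x assume x: "x \<in> X"
      have "act C (cdiff X (E x) (G x)) = act C (cdiff X (E x) (E x))"
        by (rule C'(2)[OF Ex[OF x] Gxc[OF x] Ex[OF x] Ex[OF x] refl]) (use pf EP[OF x] Gx[OF x] in simp)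
      moreover have "cdiff X (E x) (E x) = czero X"
        unfolding cdiff_def czero_def by (rule restrict_ext) (use FC_D[OF Ex[OF x]] in \<open>simp add: a_minus_def r_neg\<close>)
      ultimately have "act C (?A x) = act C (czero X)" unfolding Ax[OF x] by simp
      then have "?A x \<in> N" by (rule NI[OF mat_row[OF A x] HF0])
      from E2[OF this] have "(?A \<otimes>\<^bsub>?M\<^esub> E) x \<in> HF" unfolding mat_mult_row[OF x] .
      then show "?A x \<in> HF" unfolding AE .
    qed
    \<comment> \<open>This is G + (1 - E): the endomorphism \<open>f\<close> on the image of
      \<open>E\<close>, extended by the identity of the complementary summand.\<close>
    let ?D = "\<one>\<^bsub>?M\<^esub> \<ominus>\<^bsub>?M\<^esub> ?A"
    have D: "?D \<in> carrier ?M" by (rule M.minus_closed[OF M.one_closed A])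
    obtain B where B: "B \<in> carrier ?M" "B \<otimes>\<^bsub>?M\<^esub> ?D = \<one>\<^bsub>?M\<^esub>" "?D \<otimes>\<^bsub>?M\<^esub> B = \<one>\<^bsub>?M\<^esub>"
      using inv[OF AJ] by blast
    have DE: "?D \<otimes>\<^bsub>?M\<^esub> E = E \<ominus>\<^bsub>?M\<^esub> ?A" "E \<otimes>\<^bsub>?M\<^esub> ?D = E \<ominus>\<^bsub>?M\<^esub> ?A"
      using E A AE EA unfolding M.minus_eq[of "\<one>\<^bsub>?M\<^esub>"] M.minus_eq[of E ?A]
      by (simp_all only: M.l_distr M.r_distr M.l_minus M.r_minus M.a_inv_closed M.l_one M.r_one M.one_closed)
    have EDG: "E \<otimes>\<^bsub>?M\<^esub> ?D = G"
      unfolding DE(2) by (rule M.diff_diff_self[OF E G])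
    \<comment> \<open>\<open>E\<close> commutes with \<open>?D\<close>, hence with its inverse,
      which therefore maps \<open>P\<close> to itself.\<close>
    have BE: "B \<otimes>\<^bsub>?M\<^esub> E = E \<otimes>\<^bsub>?M\<^esub> B"
    proof -
      have "B \<otimes>\<^bsub>?M\<^esub> E = B \<otimes>\<^bsub>?M\<^esub> (E \<otimes>\<^bsub>?M\<^esub> (?D \<otimes>\<^bsub>?M\<^esub> B))" unfolding B(3) M.r_one[OF E] ..
      also have "\<dots> = B \<otimes>\<^bsub>?M\<^esub> ((?D \<otimes>\<^bsub>?M\<^esub> E) \<otimes>\<^bsub>?M\<^esub> B)"
        unfolding M.m_assoc[OF E D B(1), symmetric] DE ..
      also have "\<dots> = (B \<otimes>\<^bsub>?M\<^esub> ?D) \<otimes>\<^bsub>?M\<^esub> (E \<otimes>\<^bsub>?M\<^esub> B)"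
        unfolding M.m_assoc[OF D E B(1)] M.m_assoc[OF B(1) D M.m_closed[OF E B(1)]] ..
      also have "\<dots> = E \<otimes>\<^bsub>?M\<^esub> B" unfolding B(2) by (rule M.l_one[OF M.m_closed[OF E B(1)]])
      finally show ?thesis .
    qed
    have fD: "f t = lincomb X X ?D t" if t: "t \<in> carrier P" for t
    proof -
      have t': "t \<in> FC X" "lincomb X X E t = t" using t by (simp_all add: Pi)
      have "lincomb X X ?D t = lincomb X X ?D (lincomb X X E t)" by (simp only: t'(2))
      also have "\<dots> = lincomb X X G t" unfolding lincomb_mat_mult[OF E D t'(1)] EDG ..
      finally show ?thesis using fG[OF t] by simp
    qed
    let ?e = "\<lambda>t. lincomb X X E (lincomb X X B t)"
    have eB: "?e t = lincomb X X B t" if t: "t \<in> carrier P" for t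
    proof -
      have t': "t \<in> FC X" "lincomb X X E t = t" using t by (simp_all add: Pi)
      have "?e t = lincomb X X B (lincomb X X E t)"
        unfolding lincomb_mat_mult[OF B(1) E t'(1)] lincomb_mat_mult[OF E B(1) t'(1)] BE ..
      then show ?thesis by (simp only: t'(2))
    qed
    have e: "?e \<in> chom P P"
      using hom_comp[OF hom_comp[OF incl lincomb_hom[OF mat_map[OF B(1)]]] proj] .
    have "?e (f t) = t \<and> f (?e t) = t" if t: "t \<in> carrier P" for t
    proof
      have t': "t \<in> FC X" using t by (simp add: Pi)
      have eP: "?e t \<in> carrier P" using hom_map[OF e] t by blast
      show "?e (f t) = t"
        unfolding eB[OF fP[OF t]] unfolding fD[OF t] lincomb_mat_mult[OF D B(1) t'] B(3) by (rule lincomb_mat_one[OF t'])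
      show "f (?e t) = t"
        unfolding fD[OF eP] unfolding eB[OF t] lincomb_mat_mult[OF B(1) D t'] B(2) by (rule lincomb_mat_one[OF t'])
    qed
    then have "\<forall>t\<in>carrier P. ?e (f t) = t \<and> f (?e t) = t" by blast
    then show ?thesis unfolding contra_aut_def by (rule conjI[OF f bexI[OF _ e]])
  qed
  then have "projective_cover R T P C (act C)"
    unfolding projective_cover_def
    by (intro conjI ballI impI epi contra_projective_summand[OF E EE, folded P_def])
  then show ?thesis by blast
qed

section \<open>Products of simple Artinian rings\<close>


text \<open>Ideals of \<open>R\<close> above the kernel correspond to ideals of \<open>S\<close>, so
  simplicity carries over. If there were no minimal left ideal above the kernel, dependent choice
  would give a strictly descending chain, whose images in the Artinian ring \<open>S\<close> would
  have to become constant.\<close>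

lemma simple_quotient_kernel:
  fixes S :: "('s, 'n) ring_scheme"
  assumes S: "simple_ring S" "artinian S" and h: "h \<in> ring_hom R S" and surj: "h ` carrier R = carrier S"
    and op: "openin T {x \<in> carrier R. h x = \<zero>\<^bsub>S\<^esub>}"
  shows "simple_quotient {x \<in> carrier R. h x = \<zero>\<^bsub>S\<^esub>}"
proof -
  interpret S: ring S using S(1) by (simp add: simple_ring_def)
  interpret h: ring_hom_ring R S h by (rule ring_hom_ringI2[OF ring_axioms S.ring_axioms h])
  define K where "K = {x \<in> carrier R. h x = \<zero>\<^bsub>S\<^esub>}"
  have K: "ideal K R" using h.kernel_is_ideal unfolding a_kernel_def' K_def .
  have img_sub: "additive_subgroup (h ` I) S" if I: "additive_subgroup I R" for I
  proof -
    interpret I: additive_subgroup I R by (rule I)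
    show ?thesis
    proof (rule additive_subgroup.intro, rule S.add.subgroupI)
      show "h ` I \<subseteq> carrier S" using I.a_Hcarr by auto
      show "h ` I \<noteq> {}" using I.zero_closed by blast
      show "\<ominus>\<^bsub>S\<^esub> y \<in> h ` I" if y: "y \<in> h ` I" for y
      proof -
        obtain i where i: "i \<in> I" "y = h i" using y by (rule imageE)
        have "\<ominus>\<^bsub>S\<^esub> y = h (\<ominus> i)" unfolding i(2) by (rule h.hom_a_inv[OF I.a_Hcarr[OF i(1)], symmetric])
        then show ?thesis using I.a_inv_closed[OF i(1)] by blast
      qed
      show "y \<oplus>\<^bsub>S\<^esub> z \<in> h ` I" if yz: "y \<in> h ` I" "z \<in> h ` I" for y z
      proof -
        obtain i k where ik: "i \<in> I" "k \<in> I" "y = h i" "z = h k" using yz by (elim imageE)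
        have "y \<oplus>\<^bsub>S\<^esub> z = h (i \<oplus> k)"
          unfolding ik by (rule h.hom_add[OF I.a_Hcarr[OF ik(1)] I.a_Hcarr[OF ik(2)], symmetric])
        then show ?thesis using I.a_closed[OF ik(1,2)] by blast
      qed
    qed
  qed
  have img_left: "r \<otimes>\<^bsub>S\<^esub> y \<in> h ` I"
    if I: "\<And>a r. a \<in> I \<Longrightarrow> r \<in> carrier R \<Longrightarrow> r \<otimes> a \<in> I" "I \<subseteq> carrier R" and r: "r \<in> carrier S" "y \<in> h ` I" for I r y
  proof -
    obtain i k where ik: "i \<in> I" "k \<in> carrier R" "y = h i" "r = h k" using r surj by blast
    then have "r \<otimes>\<^bsub>S\<^esub> y = h (k \<otimes> i)" using I(2) by auto
    then show ?thesis using I(1)[OF ik(1,2)] by blast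
  qed
  have img_right: "y \<otimes>\<^bsub>S\<^esub> r \<in> h ` I"
    if I: "\<And>a r. a \<in> I \<Longrightarrow> r \<in> carrier R \<Longrightarrow> a \<otimes> r \<in> I" "I \<subseteq> carrier R" and r: "r \<in> carrier S" "y \<in> h ` I" for I r y
  proof -
    obtain i k where ik: "i \<in> I" "k \<in> carrier R" "y = h i" "r = h k" using r surj by blast
    then have "y \<otimes>\<^bsub>S\<^esub> r = h (i \<otimes> k)" using I(2) by auto
    then show ?thesis using I(1)[OF ik(1,2)] by blast
  qed
  \<comment> \<open>The injective half of the correspondence: a subgroup containing the kernel can
    be recovered from its image.\<close>
  have preimage: "x \<in> I" if I: "additive_subgroup I R" "K \<subseteq> I" and x: "x \<in> carrier R" "h x \<in> h ` I" for I x
  proof -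
    interpret I: additive_subgroup I R by (rule I(1))
    obtain i where i: "i \<in> I" "h x = h i" using x(2) by blast
    have ic: "i \<in> carrier R" by (rule I.a_Hcarr[OF i(1)])
    have "h (x \<ominus> i) = \<zero>\<^bsub>S\<^esub>" using x(1) ic i(2) S.r_neg[OF h.hom_closed[OF ic]] by (simp add: a_minus_def)
    then have "x \<ominus> i \<in> I" using I(2) x(1) ic by (auto simp: K_def)
    then have "(x \<ominus> i) \<oplus> i \<in> I" by (rule I.a_closed[OF _ i(1)])
    then show ?thesis using add_minus_cancel(2)[OF x(1) ic] by simp
  qed
  have max: "I = K \<or> I = carrier R" if I: "ideal I R" "K \<subseteq> I" for I
  proof -
    interpret I: ideal I R by (rule I(1))
    have Is: "additive_subgroup I R" by (rule I.additive_subgroup_axioms)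
    have Ic: "I \<subseteq> carrier R" using I.a_Hcarr by blast
    have "ideal (h ` I) S"
    proof (rule idealI[OF S.ring_axioms additive_subgroup.a_subgroup[OF img_sub[OF Is]]])
      show "r \<otimes>\<^bsub>S\<^esub> y \<in> h ` I" if "y \<in> h ` I" "r \<in> carrier S" for y r
        by (rule img_left[OF I.I_l_closed Ic that(2,1)])
      show "y \<otimes>\<^bsub>S\<^esub> r \<in> h ` I" if "y \<in> h ` I" "r \<in> carrier S" for y r
        by (rule img_right[OF I.I_r_closed Ic that(2,1)])
    qed
    then consider "h ` I = {\<zero>\<^bsub>S\<^esub>}" | "h ` I = carrier S" using S(1) unfolding simple_ring_def by blast
    then show ?thesis
    proof cases
      case 1
      then have "I \<subseteq> K" using Ic by (auto simp: K_def)
      then show ?thesis using I(2) by blast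
    next
      case 2
      then have "carrier R \<subseteq> I" using preimage[OF Is I(2)] by auto
      then show ?thesis using Ic by blast
    qed
  qed
  have "\<exists>L. (left_ideal R L \<and> K \<subset> L) \<and> (\<forall>I. left_ideal R I \<and> K \<subseteq> I \<and> I \<subseteq> L \<longrightarrow> I = K \<or> I = L)"
  proof (rule ccontr)
    assume no: "\<not> ?thesis"
    have step: "\<exists>I. (left_ideal R I \<and> K \<subset> I) \<and> I \<subset> L" if L: "left_ideal R L \<and> K \<subset> L" for L
    proof -
      have "\<not> (\<forall>I. left_ideal R I \<and> K \<subseteq> I \<and> I \<subseteq> L \<longrightarrow> I = K \<or> I = L)" using no L by blast
      then obtain I where "left_ideal R I" "K \<subseteq> I" "I \<subseteq> L" "I \<noteq> K" "I \<noteq> L" by blast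
      then show ?thesis by (intro exI[of _ I]) auto
    qed
    have one: "\<one> \<notin> K" using S(1) h.hom_one by (simp add: K_def simple_ring_def)
    have "additive_subgroup (carrier R) R"
      by (rule additive_subgroup.intro, rule add.subgroupI) auto
    moreover have "K \<subset> carrier R"
    proof
      show "K \<subseteq> carrier R" by (auto simp: K_def)
      show "K \<noteq> carrier R" using one one_closed by blast
    qed
    ultimately have init: "left_ideal R (carrier R) \<and> K \<subset> carrier R" by (simp add: left_ideal_def)
    obtain f :: "nat \<Rightarrow> 'a set" where f: "\<And>n. left_ideal R (f n) \<and> K \<subset> f n" "\<And>n. f (Suc n) \<subset> f n"
      using dependent_nat_choice[of "\<lambda>_ L. left_ideal R L \<and> K \<subset> L" "\<lambda>_ L I. I \<subset> L"] init step by metis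
    have fs: "additive_subgroup (f n) R" and fm: "\<And>a r. a \<in> f n \<Longrightarrow> r \<in> carrier R \<Longrightarrow> r \<otimes> a \<in> f n" for n
      using f(1) by (auto simp: left_ideal_def)
    have fc: "f n \<subseteq> carrier R" for n by (rule additive_subgroup.a_subset[OF fs])
    have "decseq (\<lambda>n. h ` f n)"
      unfolding decseq_Suc_iff using f(2) by (intro allI image_mono) (rule psubset_imp_subset)
    moreover have "left_ideal S (h ` f n)" for n
      unfolding left_ideal_def using img_sub[OF fs] img_left[OF fm fc] by blast
    ultimately obtain N where N: "\<And>n. n \<ge> N \<Longrightarrow> h ` f n = h ` f N"
      using S(2) unfolding artinian_def by meson
    have "f N \<subseteq> f (Suc N)"
    proof
      fix x assume x: "x \<in> f N"
      show "x \<in> f (Suc N)"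
        by (rule preimage[OF fs psubset_imp_subset[OF conjunct2[OF f(1)]]]) (use x fc N[of "Suc N"] in auto)
    qed
    then show False using f(2)[of N] by blast
  qed
  then have "\<exists>L. left_ideal R L \<and> K \<subset> L \<and> (\<forall>I. left_ideal R I \<and> K \<subseteq> I \<and> I \<subseteq> L \<longrightarrow> I = K \<or> I = L)"
    unfolding conj_assoc .
  then have "simple_quotient K" unfolding simple_quotient_def using K max op[folded K_def] by simp
  then show ?thesis by (simp only: K_def)
qed

lemma topspace_quot_topology: "topspace (quot_topology R T H) = a_rcosets H" if H: "ideal H R"
proof -
  interpret H: ideal H R by (rule H)
  have "{a \<in> carrier R. H +> a \<in> a_rcosets H} = carrier R" using a_rcosetsI[OF H.a_subset] by blast
  then have "openin (quot_topology R T H) (a_rcosets H)"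
    using openin_topspace[of T] by (simp add: openin_quot_topology)
  then have "a_rcosets H \<subseteq> topspace (quot_topology R T H)" by (rule openin_subset)
  moreover have "topspace (quot_topology R T H) \<subseteq> a_rcosets H"
    using openin_topspace[of "quot_topology R T H"] unfolding openin_quot_topology by (rule conjunct1)
  ultimately show ?thesis by (rule equalityI[rotated])
qed

text \<open>The coordinate idempotents of the product form a null family: a neighbourhood of zero
  restricts only finitely many coordinates, so it contains all but finitely many of them. They are
  thus a formal combination over the quotient ring, and strong closedness lifts it to
  \<open>R\<close>. Each \<open>K \<gamma>\<close> is the kernel of a coordinate of
  \<open>\<phi>\<close>, open because the factor is discrete.\<close>

lemma product_quotient_data:
  fixes S :: "'i \<Rightarrow> ('s, 'n) ring_scheme"
  assumes H: "ideal H R" and sc: "strongly_closed R T H"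
    and SA: "\<forall>\<gamma>\<in>\<Gamma>. simple_ring (S \<gamma>) \<and> artinian (S \<gamma>)"
    and \<phi>: "\<phi> \<in> top_ring_iso (R Quot H) (quot_topology R T H) (product_ring \<Gamma> S)
      (product_topology (\<lambda>\<gamma>. discrete_topology (carrier (S \<gamma>))) \<Gamma>)"
  shows "\<exists>K r. (\<forall>\<gamma>\<in>\<Gamma>. simple_quotient (K \<gamma>)) \<and> H = {x \<in> carrier R. \<forall>\<gamma>\<in>\<Gamma>. x \<in> K \<gamma>} \<and> r \<in> FC \<Gamma> \<and>
    (\<forall>\<gamma>\<in>\<Gamma>. r \<gamma> \<ominus> \<one> \<in> K \<gamma>) \<and> (\<forall>\<gamma>\<in>\<Gamma>. \<forall>\<delta>\<in>\<Gamma>. \<delta> \<noteq> \<gamma> \<longrightarrow> r \<delta> \<in> K \<gamma>)"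
proof -
  interpret H: ideal H R by (rule H)
  let ?Q = "R Quot H" and ?P = "product_ring \<Gamma> S" and ?q = "quot_topology R T H"
  let ?p = "product_topology (\<lambda>\<gamma>. discrete_topology (carrier (S \<gamma>))) \<Gamma>"
  have S: "simple_ring (S \<gamma>) \<and> artinian (S \<gamma>)" if "\<gamma> \<in> \<Gamma>" for \<gamma> using SA that by (rule bspec)
  have Sr: "ring (S \<gamma>)" if "\<gamma> \<in> \<Gamma>" for \<gamma> using S[OF that] by (simp add: simple_ring_def)
  have cQ: "carrier ?Q = a_rcosets H" by (simp add: FactRing_def)
  have zQ: "\<zero>\<^bsub>?Q\<^esub> = H" by (simp add: FactRing_def)
  have cP: "carrier ?P = (\<Pi>\<^sub>E \<gamma>\<in>\<Gamma>. carrier (S \<gamma>))" by (simp add: product_ring_def)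
  have hom: "\<phi> \<in> ring_hom ?Q ?P" and bij: "bij_betw \<phi> (carrier ?Q) (carrier ?P)"
    and homeo: "homeomorphic_map ?q ?p \<phi>"
    using \<phi> by (auto simp: top_ring_iso_def ring_iso_def)
  have tq: "topspace ?q = a_rcosets H" by (rule topspace_quot_topology[OF H])
  have rcos: "H +> x \<in> a_rcosets H" if "x \<in> carrier R" for x by (rule a_rcosetsI[OF H.a_subset that])
  have rc: "(+>) H \<in> ring_hom R ?Q" by (rule H.rcos_ring_hom)
  define \<theta> where "\<theta> \<gamma> x = \<phi> (H +> x) \<gamma>" for \<gamma> x
  have \<theta>: "\<theta> \<gamma> \<in> ring_hom R (S \<gamma>)" if g: "\<gamma> \<in> \<Gamma>" for \<gamma>
  proof -
    have c: "(\<lambda>x. \<phi> (H +> x)) \<in> ring_hom R ?P" using ring_hom_trans[OF rc hom] by (simp add: o_def)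
    have "(\<lambda>z. z \<gamma>) \<in> ring_hom ?P (S \<gamma>)"
      using g by (auto simp: ring_hom_def product_ring_def)
    from ring_hom_trans[OF c this] show ?thesis by (simp add: o_def \<theta>_def[abs_def])
  qed
  define K where "K \<gamma> = {x \<in> carrier R. \<theta> \<gamma> x = \<zero>\<^bsub>S \<gamma>\<^esub>}" for \<gamma>
  define e where "e \<gamma> s = (\<lambda>\<delta>\<in>\<Gamma>. if \<delta> = \<gamma> then s else \<zero>\<^bsub>S \<delta>\<^esub>)" for \<gamma> s
  have e: "e \<gamma> s \<in> carrier ?P" if "s \<in> carrier (S \<gamma>)" for \<gamma> s
    unfolding cP e_def using that ring.ring_simprules(2)[OF Sr] by auto
  have lift: "\<exists>x\<in>carrier R. \<phi> (H +> x) = z" if z: "z \<in> carrier ?P" for z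
  proof -
    obtain c where "c \<in> carrier ?Q" "z = \<phi> c" using bij z by (auto simp: bij_betw_def)
    then show ?thesis by (auto simp: cQ A_RCOSETS_def')
  qed
  have surj: "\<theta> \<gamma> ` carrier R = carrier (S \<gamma>)" if g: "\<gamma> \<in> \<Gamma>" for \<gamma>
  proof
    show "\<theta> \<gamma> ` carrier R \<subseteq> carrier (S \<gamma>)" using ring_hom_closed[OF \<theta>[OF g]] by blast
    show "carrier (S \<gamma>) \<subseteq> \<theta> \<gamma> ` carrier R"
    proof
      fix s assume "s \<in> carrier (S \<gamma>)"
      from lift[OF e[OF this]] obtain x where "x \<in> carrier R" "\<phi> (H +> x) = e \<gamma> s" by blast
      then show "s \<in> \<theta> \<gamma> ` carrier R" using g by (auto simp: \<theta>_def e_def image_iff intro!: bexI[of _ x])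
    qed
  qed
  have op: "openin T (K \<gamma>)" if g: "\<gamma> \<in> \<Gamma>" for \<gamma>
  proof -
    have "continuous_map ?q (discrete_topology (carrier (S \<gamma>))) (\<lambda>c. \<phi> c \<gamma>)"
      using continuous_map_compose[OF homeomorphic_imp_continuous_map[OF homeo] continuous_map_product_projection[OF g]]
      by (simp add: o_def)
    from openin_continuous_map_preimage[OF this, of "{\<zero>\<^bsub>S \<gamma>\<^esub>}"]
    have "openin ?q {c \<in> a_rcosets H. \<phi> c \<gamma> = \<zero>\<^bsub>S \<gamma>\<^esub>}"
      using ring.ring_simprules(2)[OF Sr[OF g]] by (simp add: tq)
    then have "openin T {a \<in> carrier R. H +> a \<in> {c \<in> a_rcosets H. \<phi> c \<gamma> = \<zero>\<^bsub>S \<gamma>\<^esub>}}"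
      unfolding openin_quot_topology by (rule conjunct2)
    also have "{a \<in> carrier R. H +> a \<in> {c \<in> a_rcosets H. \<phi> c \<gamma> = \<zero>\<^bsub>S \<gamma>\<^esub>}} = K \<gamma>"
      using rcos by (auto simp: K_def \<theta>_def)
    finally show ?thesis .
  qed
  have Ksq: "simple_quotient (K \<gamma>)" if g: "\<gamma> \<in> \<Gamma>" for \<gamma>
    unfolding K_def
    by (rule simple_quotient_kernel[OF _ _ \<theta>[OF g] surj[OF g] op[OF g, unfolded K_def]]) (use S[OF g] in simp_all)
  have z0: "\<phi> H = \<zero>\<^bsub>?P\<^esub>"
  proof (rule extensionalityI[of _ \<Gamma>])
    have "H \<in> carrier ?Q" using ring.ring_simprules(2)[OF H.quotient_is_ring] by (simp only: zQ)
    then show "\<phi> H \<in> extensional \<Gamma>" using ring_hom_closed[OF hom] by (auto simp: cP PiE_def)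
    show "\<zero>\<^bsub>?P\<^esub> \<in> extensional \<Gamma>" by (simp add: product_ring_def)
    fix \<gamma> assume g: "\<gamma> \<in> \<Gamma>"
    have "\<theta> \<gamma> \<zero> = \<zero>\<^bsub>S \<gamma>\<^esub>" by (rule ring_hom_zero[OF \<theta>[OF g] ring_axioms Sr[OF g]])
    then show "\<phi> H \<gamma> = \<zero>\<^bsub>?P\<^esub> \<gamma>" using g a_coset_add_zero[OF H.a_subset] by (simp add: \<theta>_def product_ring_def)
  qed
  \<comment> \<open>An element of every \<open>K \<gamma>\<close> has image zero in the product, and
    injectivity of \<open>\<phi>\<close> then puts it in \<open>H\<close>.\<close>
  have HK: "H = {x \<in> carrier R. \<forall>\<gamma>\<in>\<Gamma>. x \<in> K \<gamma>}"
  proof (intro equalityI subsetI)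
    fix x assume x: "x \<in> H"
    have xc: "x \<in> carrier R" by (rule H.a_Hcarr[OF x])
    have "H +> x = H" by (rule H.a_rcos_const[OF x])
    then have "\<theta> \<gamma> x = \<zero>\<^bsub>S \<gamma>\<^esub>" if "\<gamma> \<in> \<Gamma>" for \<gamma> using z0 that by (simp add: \<theta>_def product_ring_def)
    then show "x \<in> {x \<in> carrier R. \<forall>\<gamma>\<in>\<Gamma>. x \<in> K \<gamma>}" using xc by (simp add: K_def)
  next
    fix x assume "x \<in> {x \<in> carrier R. \<forall>\<gamma>\<in>\<Gamma>. x \<in> K \<gamma>}"
    then have xc: "x \<in> carrier R" and z: "\<And>\<gamma>. \<gamma> \<in> \<Gamma> \<Longrightarrow> \<phi> (H +> x) \<gamma> = \<zero>\<^bsub>S \<gamma>\<^esub>" by (auto simp: K_def \<theta>_def)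
    have c: "H +> x \<in> carrier ?Q" "H \<in> carrier ?Q"
      using rcos[OF xc] ring.ring_simprules(2)[OF H.quotient_is_ring] by (simp_all add: cQ zQ)
    have P: "\<phi> (H +> x) \<in> carrier ?P" using ring_hom_closed[OF hom c(1)] .
    have "\<phi> (H +> x) = \<zero>\<^bsub>?P\<^esub>"
      by (rule extensionalityI[of _ \<Gamma>]) (use P z in \<open>auto simp: product_ring_def PiE_def\<close>)
    then have "\<phi> (H +> x) = \<phi> H" using z0 by simp
    then have "H +> x = H" using bij c by (auto simp: bij_betw_def inj_on_def)
    then show "x \<in> H" using H.a_rcos_self[OF xc] by simp
  qed
  define u where "u \<gamma> = e \<gamma> \<one>\<^bsub>S \<gamma>\<^esub>" for \<gamma>
  have u: "u \<gamma> \<in> carrier ?P" if "\<gamma> \<in> \<Gamma>" for \<gamma>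
    unfolding u_def by (rule e) (use ring.ring_simprules(6)[OF Sr[OF that]] in simp)
  define b where "b = (\<lambda>\<gamma>\<in>\<Gamma>. inv_into (carrier ?Q) \<phi> (u \<gamma>))"
  have b: "b \<gamma> \<in> carrier ?Q" "\<phi> (b \<gamma>) = u \<gamma>" if "\<gamma> \<in> \<Gamma>" for \<gamma>
    using bij_betw_inv_into_right[OF bij u[OF that]] bij_betw_apply[OF bij_betw_inv_into[OF bij] u[OF that]] that
    by (simp_all add: b_def)
  have "b \<in> formal_combs ?Q ?q \<Gamma>"
    unfolding formal_combs_def
  proof (intro CollectI conjI ballI)
    show "b \<in> \<Gamma> \<rightarrow>\<^sub>E carrier ?Q" using b(1) by (auto simp: b_def)
    fix V assume V: "V \<in> open_subgroups ?Q ?q"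
    then have Vo: "openin ?q V" and Vs: "additive_subgroup V ?Q" by (auto simp: open_subgroups_def)
    have Vc: "V \<subseteq> carrier ?Q" by (rule additive_subgroup.a_subset[OF Vs])
    have "H \<in> V" using additive_subgroup.zero_closed[OF Vs] by (simp add: zQ)
    then have zV: "\<zero>\<^bsub>?P\<^esub> \<in> \<phi> ` V" using z0 by (metis imageI)
    have "openin ?p (\<phi> ` V)"
      using homeomorphic_imp_open_map[OF homeo] Vo by (simp add: open_map_def)
    then obtain W where W: "finite {i \<in> \<Gamma>. W i \<noteq> topspace (discrete_topology (carrier (S i)))}"
        "\<zero>\<^bsub>?P\<^esub> \<in> Pi\<^sub>E \<Gamma> W" "Pi\<^sub>E \<Gamma> W \<subseteq> \<phi> ` V"
      using zV unfolding openin_product_topology_alt by meson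
    \<comment> \<open>Where the box \<open>W\<close> is unrestricted at \<open>\<gamma>\<close>, it
      contains the idempotent \<open>u \<gamma>\<close>, whose other coordinates are zero.\<close>
    have "b \<gamma> \<in> V" if g: "\<gamma> \<in> \<Gamma>" and Wg: "W \<gamma> = carrier (S \<gamma>)" for \<gamma>
    proof -
      have "\<one>\<^bsub>S \<gamma>\<^esub> \<in> W \<gamma>" using Wg ring.ring_simprules(6)[OF Sr[OF g]] by simp
      moreover have "\<zero>\<^bsub>S \<delta>\<^esub> \<in> W \<delta>" if "\<delta> \<in> \<Gamma>" for \<delta>
        using PiE_mem[OF W(2) that] that by (simp add: product_ring_def)
      ultimately have "u \<gamma> \<in> Pi\<^sub>E \<Gamma> W" by (auto simp: u_def e_def)
      then obtain v where v: "v \<in> V" "\<phi> v = \<phi> (b \<gamma>)" using W(3) b(2)[OF g] by auto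
      then have "v = b \<gamma>" using bij b(1)[OF g] Vc by (auto simp: bij_betw_def inj_on_def)
      then show ?thesis using v by simp
    qed
    then show "finite {x \<in> \<Gamma>. b x \<notin> V}"
      by (intro finite_subset[OF _ W(1)]) auto
  qed
  \<comment> \<open>\<open>strongly_closed_lift\<close> is applied since the index set
    \<open>\<Gamma>\<close> has an arbitrary type.\<close>
  from strongly_closed_lift[OF _ sc this] top_ring obtain r where r: "r \<in> FC \<Gamma>" "(\<lambda>\<gamma>\<in>\<Gamma>. H +> r \<gamma>) = b"
    by (auto simp: topological_ring_def)
  have rg: "\<theta> \<delta> (r \<gamma>) = u \<gamma> \<delta>" if "\<gamma> \<in> \<Gamma>" for \<gamma> \<delta>
  proof -
    have "H +> r \<gamma> = b \<gamma>" using fun_cong[OF r(2), of \<gamma>] that by simp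
    then show ?thesis using b(2)[OF that] by (simp add: \<theta>_def)
  qed
  have r1: "r \<gamma> \<ominus> \<one> \<in> K \<gamma>" if g: "\<gamma> \<in> \<Gamma>" for \<gamma>
  proof -
    interpret h: ring_hom_ring R "S \<gamma>" "\<theta> \<gamma>" by (rule ring_hom_ringI2[OF ring_axioms Sr[OF g] \<theta>[OF g]])
    have "\<theta> \<gamma> (r \<gamma> \<ominus> \<one>) = \<one>\<^bsub>S \<gamma>\<^esub> \<oplus>\<^bsub>S \<gamma>\<^esub> \<ominus>\<^bsub>S \<gamma>\<^esub> \<one>\<^bsub>S \<gamma>\<^esub>"
      using FC_D[OF r(1) g] rg[OF g] g by (simp add: a_minus_def u_def e_def)
    also have "\<dots> = \<zero>\<^bsub>S \<gamma>\<^esub>" by (rule h.S.r_neg) simp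
    finally show ?thesis using FC_D[OF r(1) g] by (simp add: K_def)
  qed
  have r0: "r \<delta> \<in> K \<gamma>" if "\<gamma> \<in> \<Gamma>" "\<delta> \<in> \<Gamma>" "\<delta> \<noteq> \<gamma>" for \<gamma> \<delta>
    using rg[OF that(2)] FC_D[OF r(1) that(2)] that by (simp add: K_def u_def e_def)
  show ?thesis
  proof (rule exI[of _ K], rule exI[of _ r], intro conjI)
    show "\<forall>\<gamma>\<in>\<Gamma>. simple_quotient (K \<gamma>)" using Ksq by (rule ballI)
    show "\<forall>\<gamma>\<in>\<Gamma>. r \<gamma> \<ominus> \<one> \<in> K \<gamma>" using r1 by (rule ballI)
    show "\<forall>\<gamma>\<in>\<Gamma>. \<forall>\<delta>\<in>\<Gamma>. \<delta> \<noteq> \<gamma> \<longrightarrow> r \<delta> \<in> K \<gamma>" using r0 by (intro ballI impI)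
  qed (fact HK r(1))+

qed

end

theorem theorem10p4:
  fixes R :: "'a ring" and T :: "'a topology" and H :: "'a set"
    and \<Gamma> :: "'i set" and S :: "'i \<Rightarrow> 's ring" and C :: "('c, 'a) contra"
  assumes "topological_ring R T" and "top_separated R T" and "top_complete R T"
    and "open_right_ideal_base R T"
    and "ideal H R" and "top_left_T_nilpotent R T H" and "strongly_closed R T H"
    and "\<And>\<gamma>. \<gamma> \<in> \<Gamma> \<Longrightarrow> simple_ring (S \<gamma>) \<and> artinian (S \<gamma>)"
    and "top_ring_iso (R Quot H) (quot_topology R T H)
           (product_ring \<Gamma> S) (product_topology (\<lambda>\<gamma>. discrete_topology (carrier (S \<gamma>))) \<Gamma>) \<noteq> {}"
    and "contramodule R T C"
  shows "\<exists>(P :: ('c \<Rightarrow> 'a, 'a) contra) p. projective_cover R T P C p"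
proof -
  interpret complete_lin_ring R T
    using assms(1-4) unfolding topological_ring_def
    by (intro complete_lin_ring.intro complete_lin_ring_axioms.intro) (auto simp: topological_ring_def)
  obtain \<phi> where \<phi>: "\<phi> \<in> top_ring_iso (R Quot H) (quot_topology R T H) (product_ring \<Gamma> S)
      (product_topology (\<lambda>\<gamma>. discrete_topology (carrier (S \<gamma>))) \<Gamma>)"
    using assms(9) by blast
  have S: "\<forall>\<gamma>\<in>\<Gamma>. simple_ring (S \<gamma>) \<and> artinian (S \<gamma>)" using assms(8) by (rule ballI)
  obtain K r where K: "\<forall>\<gamma>\<in>\<Gamma>. simple_quotient (K \<gamma>)" "H = {x \<in> carrier R. \<forall>\<gamma>\<in>\<Gamma>. x \<in> K \<gamma>}"
    and r: "r \<in> FC \<Gamma>" "\<forall>\<gamma>\<in>\<Gamma>. r \<gamma> \<ominus>\<^bsub>R\<^esub> \<one>\<^bsub>R\<^esub> \<in> K \<gamma>" "\<forall>\<gamma>\<in>\<Gamma>. \<forall>\<delta>\<in>\<Gamma>. \<delta> \<noteq> \<gamma> \<longrightarrow> r \<delta> \<in> K \<gamma>"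
    using product_quotient_data[OF assms(5,7) S \<phi>] by (elim exE conjE)
  have cl: "closedin T H" using assms(7) by (simp add: strongly_closed_def)
  show ?thesis
    by (rule projective_cover_exists[OF assms(5) cl assms(6) _ K(2) r(1) _ _ assms(10)])
       (simp_all add: K(1) r(2,3))
qed

end
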